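(* Let $\Bbbk$ be a field, let $S=\Bbbk[x_1,\ldots,x_n]$ be a polynomial ring with the standard grading, and let $P\subseteq S$ be a homogeneous prime ideal of height $h$. Then for every integer $j\geq 0$, $$\beta_{0,j}(P)\leq h^{2^{j+1}-3}.$$
   Context: The standard grading on $S=\Bbbk[x_1,\ldots,x_n]$ has $\deg(x_i)=1$ for all $i$. For a finitely generated graded $S$-module $M$, $\beta_{i,j}(M)=\dim_\Bbbk(\operatorname{Tor}_i^S(M,\Bbbk)_j)$ denotes the $(i,j)$-th graded Betti number; in particular $\beta_{0,j}(P)$ is the number of minimal homogeneous generators of $P$ of degree $j$. For $j=0$ the exponent $2^{j+1}-3$ equals $-1$, so the right-hand side is $h^{-1}$; in the degenerate case $h=0$ (i.e. $P=0$), $j=0$, the right-hand side is read as $0$. *)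

theory Defs
  imports
    Complex_Main
    "HOL-Library.Poly_Mapping"
    "HOL-Library.Extended_Nat"
    "HOL-Algebra.QuotRing"
    "HOL-Algebra.Ideal_Product"
    "HOL-Algebra.Embedded_Algebras"
begin

text \<open>
  Monomials are exponent vectors, polynomials are finitely supported coefficient functions on
  them.  The type has variables indexed by all natural numbers; the polynomial ring in
  \<open>n\<close> variables is cut out by a carrier set, so that \<open>n\<close> is an ordinary variable.
  The variables \<open>x\<^sub>1, \<dots>, x\<^sub>n\<close> carry the indices \<open>0, \<dots>, n - 1\<close>.
\<close>

type_synonym 'k mpoly = "(nat \<Rightarrow>\<^sub>0 nat) \<Rightarrow>\<^sub>0 'k"

definition mpoly_ring :: "nat \<Rightarrow> 'k::field mpoly ring" where
  "mpoly_ring n =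
     \<lparr>carrier = {f. \<forall>m \<in> Poly_Mapping.keys f. Poly_Mapping.keys m \<subseteq> {..<n}},
      mult = (*), one = 1, zero = 0, add = (+)\<rparr>"

definition Const :: "'k::field \<Rightarrow> 'k mpoly" where
  "Const c = Poly_Mapping.single 0 c"

definition Var :: "nat \<Rightarrow> 'k::field mpoly" where
  "Var i = Poly_Mapping.single (Poly_Mapping.single i 1) 1"

definition monom_degree :: "(nat \<Rightarrow>\<^sub>0 nat) \<Rightarrow> nat" where
  "monom_degree m = (\<Sum>i \<in> Poly_Mapping.keys m. Poly_Mapping.lookup m i)"

text \<open>As usual, \<open>0\<close> is homogeneous of every degree.\<close>

definition homogeneous :: "nat \<Rightarrow> 'k::field mpoly \<Rightarrow> bool" where
  "homogeneous d f \<longleftrightarrow> (\<forall>m \<in> Poly_Mapping.keys f. monom_degree m = d)"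

definition homogeneous_ideal :: "nat \<Rightarrow> 'k::field mpoly set \<Rightarrow> bool" where
  "homogeneous_ideal n I \<longleftrightarrow>
     ideal I (mpoly_ring n) \<and>
     (\<exists>G \<subseteq> carrier (mpoly_ring n). (\<forall>g \<in> G. \<exists>d. homogeneous d g) \<and> I = Idl\<^bsub>mpoly_ring n\<^esub> G)"

definition irrelevant_ideal :: "nat \<Rightarrow> 'k::field mpoly set" where
  "irrelevant_ideal n = Idl\<^bsub>mpoly_ring n\<^esub> (Var ` {..<n})"

text \<open>The height of a prime ideal \<open>P\<close>; the definition is only meant for prime \<open>P\<close>.\<close>

definition prime_height :: "('a, 'b) ring_scheme \<Rightarrow> 'a set \<Rightarrow> enat" where
  "prime_height R P =
     Sup {enat l | l. \<exists>Q :: nat \<Rightarrow> 'a set.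
            (\<forall>i \<le> l. primeideal (Q i) R) \<and> (\<forall>i < l. Q i \<subset> Q (Suc i)) \<and> Q l = P}"

text \<open>
  Let \<open>S = mpoly_ring n\<close> and let \<open>\<mm> = irrelevant_ideal n\<close>, so that \<open>\<kk> = S/\<mm>\<close>.  For a homogeneous
  ideal \<open>I\<close>, the graded \<open>\<kk>\<close>-vector space \<open>Tor\<^sub>0\<^sup>S(I, \<kk>) = I \<otimes>\<^sub>S S/\<mm>\<close> is \<open>I/\<mm>I\<close>, and its degree \<open>j\<close> part
  consists of the classes of the elements of \<open>I\<close> that are homogeneous of degree \<open>j\<close>.  Both are
  formed inside the ring \<open>S/\<mm>I\<close>, whose subfield of classes of constants is a copy of \<open>\<kk>\<close>; this
  allows the use of the library's dimension of a subspace of a ring over a subfield.  The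
  dimension is always finite, since only finitely many monomials have degree \<open>j\<close>.
\<close>

definition Tor0 :: "nat \<Rightarrow> 'k::field mpoly set \<Rightarrow> nat \<Rightarrow> 'k mpoly set set" where
  "Tor0 n I j =
     (let mI = irrelevant_ideal n \<cdot>\<^bsub>mpoly_ring n\<^esub> I
      in {mI +>\<^bsub>mpoly_ring n\<^esub> f | f. f \<in> I \<and> homogeneous j f})"

definition graded_betti0 :: "nat \<Rightarrow> nat \<Rightarrow> 'k::field mpoly set \<Rightarrow> nat" where
  "graded_betti0 n j I =
     (let mI = irrelevant_ideal n \<cdot>\<^bsub>mpoly_ring n\<^esub> I
      in ring.dim (mpoly_ring n Quot mI)
           (range (\<lambda>c. mI +>\<^bsub>mpoly_ring n\<^esub> Const c)) (Tor0 n I j))"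

end

theory Submission
  imports
    Defs
    "HOL-Computational_Algebra.Formal_Power_Series"
    "HOL-Computational_Algebra.Fraction_Field"
    "HOL-Computational_Algebra.Polynomial"
begin

text \<open>
Let \<open>V\<close> be the set of all variables, and \<open>Y\<close> a maximal subset with \<open>P \<inter> k[Y] = 0\<close>.  Contracting \<open>P\<close> to
polynomial subrings and extending the contractions again gives a chain of primes of length \<open>|V - Y|\<close> below
\<open>P\<close>; so the number \<open>e\<close> of the other variables is at most the height \<open>h\<close> (\<open>independent_variables\<close>).  It is enough to
bound the number of minimal generators of degree \<open>j\<close> in terms of \<open>e\<close> and \<open>j\<close>, whatever the size of \<open>Y\<close>.

Write the forms of degree \<open>j\<close> in \<open>P\<close> as \<open>\<Sum>\<alpha>. x^\<alpha> w\<^sub>\<alpha>\<close> with monomials \<open>x^\<alpha>\<close> in the \<open>e\<close> variables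
outside of \<open>Y\<close> and coefficients \<open>w\<^sub>\<alpha> \<in> k[Y]\<close> of degree \<open>j - |\<alpha>|\<close>.  The vectors \<open>w\<close> with
\<open>\<Sum>\<alpha>. x^\<alpha> w\<^sub>\<alpha> \<in> P\<close> form a module \<open>R\<close> over \<open>k[Y]\<close>.  As \<open>P\<close> is prime and contains no nonzero polynomial in
\<open>Y\<close>, the module is saturated: \<open>c w \<in> R\<close> and \<open>c \<noteq> 0\<close> imply \<open>w \<in> R\<close>.  A vector that is a combination, with
coefficients of degree at most 1, of vectors of \<open>R\<close> whose entries obey the degree bounds diminished by 1
contributes nothing to the minimal generators of degree \<open>j\<close>.  So the question becomes how many vectors of \<open>R\<close> with entries
of degrees at most \<open>a\<^sub>\<alpha> = j - |\<alpha>|\<close> are linearly independent modulo such decomposable vectors.  The answer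
is bounded by the number and the degrees \<open>a\<^sub>\<alpha>\<close> of the columns \<open>\<alpha>\<close> alone.

A saturated module is given by equations \<open>\<delta> w\<^sub>j = \<Sum>i. w\<^sub>i \<beta>\<^sub>i\<^sub>j\<close> that express some entries by the others, the
pivots (\<open>pivot_description\<close>).  Extend the field so that it becomes infinite and translate a point with
\<open>\<delta> \<noteq> 0\<close> to the origin.  At the cost of one dimension for each pivot, the pivot entries have no constant term.
Now split the pivot entries into their homogeneous components.  The other entries are power series in
the components, and the condition that they are polynomials of degree at most \<open>a\<^sub>j\<close> says that their components
of larger degree vanish.  These conditions are linear again and define a new saturated module: each
pivot of degree \<open>a\<close> has become \<open>a\<close> columns of degrees \<open>1, \<dots>, a\<close>, and the other columns are gone
(\<open>expand_at_origin\<close>, \<open>expand_at_general_point\<close>).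

One may take any column whose unit vector is not in \<open>R\<close> as a non-pivot, and columns whose unit vector is in \<open>R\<close>
can be deleted.  With a column of top degree in this role, the number of columns of top degree drops in
every step, and the number in degree \<open>u\<close> becomes at most the number in degrees \<open>\<ge> u\<close>.  When the
top degree is exhausted, the number of columns one degree lower has the order of the square of the initial
number in top degree (\<open>codim_phases\<close>).  Starting from \<open>e\<close> columns of degree \<open>j - 1\<close>, the repeated squaring leads to a
bound that is at most \<open>e ^ (2 ^ (j + 1) - 3)\<close> for \<open>e \<ge> 2\<close> and \<open>j \<ge> 1\<close> (\<open>codim_bound_le\<close>).

For \<open>e = 0\<close> the ideal is \<open>0\<close>, and there are no generators of degree 0.  For \<open>e = 1\<close> the bound is 1 and the
count above is too coarse; here unique factorization in \<open>k[Y]\<close> shows that \<open>P\<close> is principal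
(\<open>prime_principal\<close>).
\<close>

abbreviation "lookup \<equiv> Poly_Mapping.lookup"
abbreviation "keys \<equiv> Poly_Mapping.keys"
abbreviation "single \<equiv> Poly_Mapping.single"

section \<open>Polynomials and monomials\<close>

text \<open>A linear map out of a polynomial ring is given by its values \<open>g m c\<close> on the terms.  All maps between
polynomial rings below (homogeneous components, substitutions, changes of coefficients, regroupings of
variables) have this form; \<open>monomial_sum_mult\<close> is the reason why the multiplicative ones are ring
homomorphisms.\<close>

definition monomial_sum :: "('a \<Rightarrow> 'b::zero \<Rightarrow> 'c::comm_monoid_add) \<Rightarrow> ('a \<Rightarrow>\<^sub>0 'b) \<Rightarrow> 'c" where
  "monomial_sum g f = (\<Sum>m\<in>keys f. g m (lookup f m))"

lemma monomial_sum_superset: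
  assumes "\<And>m. g m 0 = 0" "finite S" "keys f \<subseteq> S"
  shows "monomial_sum g f = (\<Sum>m\<in>S. g m (lookup f m))"
  unfolding monomial_sum_def
  by (rule sum.mono_neutral_left) (use assms in \<open>auto simp: in_keys_iff\<close>)

lemma monomial_sum_zero [simp]: "monomial_sum g 0 = 0"
  by (simp add: monomial_sum_def)

lemma monomial_sum_single:
  assumes "\<And>m. g m 0 = 0"
  shows "monomial_sum g (single m c) = g m c"
  by (subst monomial_sum_superset[of g "{m}"]) (auto simp: assms)

lemma monomial_sum_add:
  assumes "\<And>m. g m 0 = 0" "\<And>m a b. g m (a + b) = g m a + g m b"
  shows "monomial_sum g (f + f') = monomial_sum g f + monomial_sum g f'"
proof -
  let ?S = "keys f \<union> keys f'"
  have "monomial_sum g (f + f') = (\<Sum>m\<in>?S. g m (lookup (f + f') m))"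
    by (rule monomial_sum_superset) (use assms keys_add[of f f'] in auto)
  also have "\<dots> = (\<Sum>m\<in>?S. g m (lookup f m)) + (\<Sum>m\<in>?S. g m (lookup f' m))"
    by (simp add: lookup_add assms(2) sum.distrib)
  also have "\<dots> = monomial_sum g f + monomial_sum g f'"
    by (subst (1 2) monomial_sum_superset[of g ?S]) (use assms in auto)
  finally show ?thesis .
qed

lemma poly_mapping_expand: "f = (\<Sum>m\<in>keys f. single m (lookup f m))"
proof (rule poly_mapping_eqI)
  fix k
  have "lookup (\<Sum>m\<in>keys f. single m (lookup f m)) k
     = (\<Sum>m\<in>keys f. if m = k then lookup f m else 0)"
    unfolding lookup_sum by (rule sum.cong) (auto simp: lookup_single)
  also have "\<dots> = lookup f k"
    by (simp add: sum.delta' in_keys_iff)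
  finally show "lookup f k = lookup (\<Sum>m\<in>keys f. single m (lookup f m)) k"
    by simp
qed

lemma poly_mapping_induct_single [case_names zero single add]:
  fixes f :: "'a \<Rightarrow>\<^sub>0 'b::comm_monoid_add"
  assumes zero: "Q 0" and single: "\<And>m c. c \<noteq> 0 \<Longrightarrow> m \<in> keys f \<Longrightarrow> Q (single m c)"
    and add: "\<And>p q. Q p \<Longrightarrow> Q q \<Longrightarrow> Q (p + q)"
  shows "Q f"
proof -
  have "Q (\<Sum>m\<in>S. single m (lookup f m))"
    if "finite S" "S \<subseteq> keys f" for S
    using that by (induction S) (auto intro!: assms simp: in_keys_iff)
  from this[of "keys f"] show ?thesis
    using poly_mapping_expand[of f] by simp
qed

lemma monomial_sum_mult:
  fixes g :: "'a::monoid_add \<Rightarrow> 'b::semiring_0 \<Rightarrow> 'c::semiring_0"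
  assumes z: "\<And>m. g m 0 = 0" and a: "\<And>m a b. g m (a + b) = g m a + g m b"
    and m: "\<And>m m' c c'. g (m + m') (c * c') = g m c * g m' c'"
  shows "monomial_sum g (f * f') = monomial_sum g f * monomial_sum g f'"
proof (induction f rule: poly_mapping_induct_single)
  case (single m c)
  show ?case
  proof (induction f' rule: poly_mapping_induct_single)
    case (single m' c')
    then show ?case by (simp add: mult_single monomial_sum_single z m)
  next
    case (add p q)
    then show ?case by (simp add: distrib_left monomial_sum_add[of g, OF z a])
  qed auto
next
  case (add p q)
  then show ?case by (simp add: distrib_right monomial_sum_add[of g, OF z a])
qed auto

lemma additive_sum:
  assumes "\<And>a b. F (a + b) = F a + (F b :: 'b::comm_monoid_add)" "F 0 = 0"
  shows "F (sum f A) = (\<Sum>x\<in>A. F (f x :: 'a::comm_monoid_add))"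
  by (induction A rule: infinite_finite_induct) (auto simp: assms)

lift_definition restrict_mono :: "nat set \<Rightarrow> (nat \<Rightarrow>\<^sub>0 nat) \<Rightarrow> (nat \<Rightarrow>\<^sub>0 nat)" is
  "\<lambda>Z m i. if i \<in> Z then m i else 0"
  by (rule finite_subset[rotated]) auto

lemma lookup_restrict_mono: "lookup (restrict_mono Z m) i = (if i \<in> Z then lookup m i else 0)"
  by transfer simp

lemma keys_restrict_mono: "keys (restrict_mono Z m) = keys m \<inter> Z"
  by (auto simp: in_keys_iff lookup_restrict_mono split: if_splits)

lemma restrict_mono_add: "restrict_mono Z (m + m') = restrict_mono Z m + restrict_mono Z m'"
  by (rule poly_mapping_eqI) (simp add: lookup_restrict_mono lookup_add)

lemma restrict_mono_split: "restrict_mono Z m + restrict_mono (- Z) m = m"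
  by (rule poly_mapping_eqI) (simp add: lookup_restrict_mono lookup_add)

lemma restrict_mono_id: "keys m \<subseteq> Z \<Longrightarrow> restrict_mono Z m = m"
  by (rule poly_mapping_eqI) (auto simp: lookup_restrict_mono in_keys_iff)

lemma restrict_mono_0: "keys m \<inter> Z = {} \<Longrightarrow> restrict_mono Z m = 0"
  by (rule poly_mapping_eqI) (auto simp: lookup_restrict_mono in_keys_iff)

lemma keys_add_nat: "keys (m + m') = keys m \<union> keys (m' :: 'a \<Rightarrow>\<^sub>0 nat)"
  by (auto simp: in_keys_iff lookup_add)

lemma monom_degree_superset: "finite S \<Longrightarrow> keys m \<subseteq> S \<Longrightarrow> monom_degree m = (\<Sum>i\<in>S. lookup m i)"
  unfolding monom_degree_def by (rule sum.mono_neutral_left) (auto simp: in_keys_iff)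

lemma monom_degree_add [simp]: "monom_degree (m + m') = monom_degree m + monom_degree m'"
proof -
  let ?S = "keys m \<union> keys m'"
  show ?thesis
    using monom_degree_superset[of ?S m] monom_degree_superset[of ?S m'] monom_degree_superset[of ?S "m + m'"]
    by (simp add: keys_add_nat lookup_add sum.distrib)
qed

lemma monom_degree_0 [simp]: "monom_degree 0 = 0"
  by (simp add: monom_degree_def)

lemma monom_degree_single [simp]: "monom_degree (single i e) = e"
  by (simp add: monom_degree_def)

lemma monom_degree_eq_0: "monom_degree m = 0 \<longleftrightarrow> m = 0"
proof
  assume "monom_degree m = 0"
  then have "\<forall>i\<in>keys m. lookup m i = 0"
    by (simp add: monom_degree_def)
  then have "lookup m i = 0" for i by (cases "i \<in> keys m") (auto simp: in_keys_iff)
  then show "m = 0" by (intro poly_mapping_eqI) simp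
qed simp

lemma monomial_factor:
  assumes "(m :: nat \<Rightarrow>\<^sub>0 nat) \<noteq> 0"
  obtains l m' where "l \<in> keys m" "m = single l 1 + m'"
proof -
  obtain l where l: "l \<in> keys m" using assms by (metis ex_in_conv keys_eq_empty)
  have "m = single l 1 + (m - single l 1)"
    by (rule poly_mapping_eqI) (use l in \<open>auto simp: lookup_add lookup_minus lookup_single when_def in_keys_iff\<close>)
  then show thesis using that l by blast
qed

lemma finite_monomials:
  assumes "finite V"
  shows "finite {m. keys m \<subseteq> V \<and> monom_degree m \<le> d}"
proof -
  let ?M = "{m. keys m \<subseteq> V \<and> monom_degree m \<le> d}"
  have "lookup ` ?M \<subseteq> {f. (\<forall>i\<in>V. f i \<in> {..d}) \<and> (\<forall>i. i \<notin> V \<longrightarrow> f i = 0)}"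
  proof (auto simp: in_keys_iff subset_iff)
    fix m :: "nat \<Rightarrow>\<^sub>0 nat" and i assume "i \<in> V" "monom_degree m \<le> d" and "\<forall>t. 0 < lookup m t \<longrightarrow> t \<in> V"
    then have "lookup m i \<le> (\<Sum>i\<in>V. lookup m i)"
      using member_le_sum[of i V "lookup m"] assms by simp
    also have "\<dots> = monom_degree m"
      by (rule monom_degree_superset[symmetric]) (use assms \<open>\<forall>t. 0 < lookup m t \<longrightarrow> t \<in> V\<close> in \<open>auto simp: in_keys_iff\<close>)
    finally show "lookup m i \<le> d" using \<open>monom_degree m \<le> d\<close> by simp
  qed
  moreover have "finite {f. (\<forall>i\<in>V. f i \<in> {..d}) \<and> (\<forall>i. i \<notin> V \<longrightarrow> f i = (0::nat))}"
    using finite_set_of_finite_funs[OF assms, of "{..d}" 0] by (rule finite_subset[rotated]) auto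
  ultimately have "finite (lookup ` ?M)" by (rule finite_subset)
  then show ?thesis by (rule finite_imageD) (auto simp: inj_on_def intro: poly_mapping_eqI)
qed

definition vars_in :: "nat set \<Rightarrow> 'k::field mpoly set" where
  "vars_in V = {f. \<forall>m\<in>keys f. keys m \<subseteq> V}"

lemma vars_in_0 [simp]: "0 \<in> vars_in V" by (simp add: vars_in_def)
lemma vars_in_1 [simp]: "1 \<in> vars_in V" by (simp add: vars_in_def)
lemma vars_in_UNIV [simp]: "f \<in> vars_in UNIV" by (simp add: vars_in_def)
lemma vars_in_Const [simp]: "Const c \<in> vars_in V" by (simp add: vars_in_def Const_def)
lemma vars_in_Var: "i \<in> V \<Longrightarrow> Var i \<in> vars_in V" by (simp add: vars_in_def Var_def)
lemma vars_in_single: "single m c \<in> vars_in V \<longleftrightarrow> c = 0 \<or> keys m \<subseteq> V"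
  by (simp add: vars_in_def)
lemma vars_in_mono: "V \<subseteq> W \<Longrightarrow> vars_in V \<subseteq> vars_in W" by (auto simp: vars_in_def)
lemma vars_in_add: "f \<in> vars_in V \<Longrightarrow> g \<in> vars_in V \<Longrightarrow> f + g \<in> vars_in V"
  using keys_add[of f g] by (auto simp: vars_in_def)
lemma vars_in_uminus: "f \<in> vars_in V \<Longrightarrow> - f \<in> vars_in V"
  by (auto simp: vars_in_def in_keys_iff)
lemma vars_in_diff: "f \<in> vars_in V \<Longrightarrow> g \<in> vars_in V \<Longrightarrow> f - g \<in> vars_in V"
  using vars_in_add[of f V "- g"] vars_in_uminus[of g V] by simp
lemma vars_in_mult: "f \<in> vars_in V \<Longrightarrow> g \<in> vars_in V \<Longrightarrow> f * g \<in> vars_in V"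
  using keys_mult[of f g] by (fastforce simp: vars_in_def keys_add_nat)
lemma vars_in_sum: "(\<And>x. x \<in> A \<Longrightarrow> f x \<in> vars_in V) \<Longrightarrow> sum f A \<in> vars_in V"
  by (induction A rule: infinite_finite_induct) (auto intro: vars_in_add)
lemma vars_in_prod: "(\<And>x. x \<in> A \<Longrightarrow> f x \<in> vars_in V) \<Longrightarrow> prod f A \<in> vars_in V"
  by (induction A rule: infinite_finite_induct) (auto intro: vars_in_mult)

lemma Const_0 [simp]: "Const 0 = 0" by (simp add: Const_def)
lemma Const_1 [simp]: "Const 1 = 1" by (simp add: Const_def)
lemma Const_add: "Const (a + b) = Const a + Const b" by (simp add: Const_def single_add)
lemma Const_mult: "Const (a * b) = Const a * Const b" by (simp add: Const_def mult_single)
lemma Const_uminus: "Const (- a) = - Const a" by (simp add: Const_def single_uminus)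
lemma Const_inj [simp]: "Const a = Const b \<longleftrightarrow> a = b"
  by (metis Const_def lookup_single_eq)
lemma Const_eq_0 [simp]: "Const a = 0 \<longleftrightarrow> a = 0"
  using Const_inj[of a 0] by (simp del: Const_inj)

lemma Const_mult_single: "Const c * single m d = single m (c * d)"
  by (simp add: Const_def mult_single)

lemma lookup_Const_mult [simp]: "lookup (Const c * f) m = c * lookup f m"
proof -
  have "Poly_Mapping.map ((*) c) f = Const c * f"
    by (simp add: mult_map_scale_conv_mult Const_def)
  then have "lookup (Const c * f) m = lookup (Poly_Mapping.map ((*) c) f) m"
    by simp
  also have "\<dots> = c * lookup f m"
    by (simp add: map.rep_eq when_def)
  finally show ?thesis .
qed

lemma keys_Const_mult: "keys (Const c * f) \<subseteq> keys f"
  by (auto simp: in_keys_iff)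

definition deg_le :: "nat \<Rightarrow> 'k::field mpoly \<Rightarrow> bool" where
  "deg_le d f \<longleftrightarrow> (\<forall>m\<in>keys f. monom_degree m \<le> d)"

definition deg_less :: "nat \<Rightarrow> 'k::field mpoly \<Rightarrow> bool" where
  "deg_less d f \<longleftrightarrow> (\<forall>m\<in>keys f. monom_degree m < d)"

lemma deg_less_0 [simp]: "deg_less d 0" by (simp add: deg_less_def)
lemma deg_le_0 [simp]: "deg_le d 0" by (simp add: deg_le_def)
lemma deg_less_add: "deg_less d f \<Longrightarrow> deg_less d g \<Longrightarrow> deg_less d (f + g)"
  using keys_add[of f g] by (auto simp: deg_less_def)
lemma deg_le_add: "deg_le d f \<Longrightarrow> deg_le d g \<Longrightarrow> deg_le d (f + g)"
  using keys_add[of f g] by (auto simp: deg_le_def)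
lemma deg_less_Const_mult: "deg_less d f \<Longrightarrow> deg_less d (Const c * f)"
  using keys_Const_mult[of c f] by (auto simp: deg_less_def)
lemma deg_le_Const_mult: "deg_le d f \<Longrightarrow> deg_le d (Const c * f)"
  using keys_Const_mult[of c f] by (auto simp: deg_le_def)
lemma deg_less_sum: "(\<And>x. x \<in> A \<Longrightarrow> deg_less d (f x)) \<Longrightarrow> deg_less d (sum f A)"
  by (induction A rule: infinite_finite_induct) (auto intro: deg_less_add)
lemma deg_le_sum: "(\<And>x. x \<in> A \<Longrightarrow> deg_le d (f x)) \<Longrightarrow> deg_le d (sum f A)"
  by (induction A rule: infinite_finite_induct) (auto intro: deg_le_add)
lemma deg_less_Suc: "deg_less (Suc d) f \<longleftrightarrow> deg_le d f"
  by (auto simp: deg_less_def deg_le_def)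

definition hcomp :: "nat \<Rightarrow> 'k::field mpoly \<Rightarrow> 'k mpoly" where
  "hcomp u f = monomial_sum (\<lambda>m c. if monom_degree m = u then single m c else 0) f"

lemma hcomp_0 [simp]: "hcomp u 0 = 0" by (simp add: hcomp_def)
lemma hcomp_add: "hcomp u (f + g) = hcomp u f + hcomp u g"
  unfolding hcomp_def by (rule monomial_sum_add) (auto simp: single_add)
lemma hcomp_single: "hcomp u (single m c) = (if monom_degree m = u then single m c else 0)"
  unfolding hcomp_def by (rule monomial_sum_single) auto
lemma hcomp_sum: "hcomp u (sum f A) = (\<Sum>x\<in>A. hcomp u (f x))"
  by (rule additive_sum) (auto simp: hcomp_add)
lemma lookup_hcomp: "lookup (hcomp u f) m = (if monom_degree m = u then lookup f m else 0)"
proof (induction f rule: poly_mapping_induct_single)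
  case (single m' c) then show ?case by (auto simp: hcomp_single lookup_single when_def)
qed (auto simp: hcomp_add lookup_add)

lemma hcomp_Const_mult: "hcomp u (Const c * f) = Const c * hcomp u f"
  by (rule poly_mapping_eqI) (simp add: lookup_hcomp)

lemma homogeneous_hcomp: "homogeneous u (hcomp u f)"
  by (auto simp: homogeneous_def in_keys_iff lookup_hcomp split: if_splits)

lemma hcomp_homogeneous: "homogeneous d f \<Longrightarrow> hcomp u f = (if u = d then f else 0)"
  by (rule poly_mapping_eqI) (auto simp: lookup_hcomp homogeneous_def in_keys_iff)

lemma hcomp_deg_less: "deg_less d f \<Longrightarrow> u \<ge> d \<Longrightarrow> hcomp u f = 0"
  by (rule poly_mapping_eqI) (auto simp: lookup_hcomp deg_less_def in_keys_iff not_less[symmetric])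

lemma hcomp_expand: "deg_less d f \<Longrightarrow> f = (\<Sum>u<d. hcomp u f)"
  by (rule poly_mapping_eqI) (auto simp: lookup_sum lookup_hcomp deg_less_def in_keys_iff)

lemma ex_deg_less: "\<exists>d. deg_less d (f::'k::field mpoly)"
proof -
  have "\<forall>m\<in>keys f. monom_degree m < Suc (\<Sum>m\<in>keys f. monom_degree m)"
    using member_le_sum[of _ "keys f" monom_degree] by (auto simp: less_Suc_eq_le)
  then show ?thesis by (auto simp: deg_less_def)
qed

lemma hcomp_eqI: "(\<And>u. hcomp u f = hcomp u g) \<Longrightarrow> f = g"
  by (rule poly_mapping_eqI) (metis lookup_hcomp)

lemma homogeneous_0 [simp]: "homogeneous u 0" by (simp add: homogeneous_def)
lemma homogeneous_add: "homogeneous u f \<Longrightarrow> homogeneous u g \<Longrightarrow> homogeneous u (f + g)"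
  using keys_add[of f g] by (auto simp: homogeneous_def)
lemma homogeneous_uminus: "homogeneous u f \<Longrightarrow> homogeneous u (- f)"
  by (simp add: homogeneous_def in_keys_iff)
lemma homogeneous_sum: "(\<And>x. x \<in> A \<Longrightarrow> homogeneous d (f x)) \<Longrightarrow> homogeneous d (sum f A)"
  by (induction A rule: infinite_finite_induct) (auto intro: homogeneous_add)
lemma homogeneous_mult: "homogeneous u f \<Longrightarrow> homogeneous v g \<Longrightarrow> homogeneous (u + v) (f * g)"
  using keys_mult[of f g] by (fastforce simp: homogeneous_def)
lemma homogeneous_Const [simp]: "homogeneous 0 (Const c)" by (simp add: homogeneous_def Const_def)
lemma homogeneous_Var [simp]: "homogeneous 1 (Var i)" by (simp add: homogeneous_def Var_def)
lemma homogeneous_Const_mult: "homogeneous u f \<Longrightarrow> homogeneous u (Const c * f)"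
  using homogeneous_mult[of 0 "Const c" u f] by simp
lemma homogeneous_deg_less: "homogeneous u f \<Longrightarrow> u < d \<Longrightarrow> deg_less d f"
  by (auto simp: homogeneous_def deg_less_def)
lemma homogeneous_deg_le: "homogeneous u f \<Longrightarrow> u \<le> d \<Longrightarrow> deg_le d f"
  by (auto simp: homogeneous_def deg_le_def)

text \<open>Splitting \<open>f\<close> into its components reduces this to a product of two homogeneous polynomials.\<close>

lemma hcomp_homogeneous_mult:
  assumes "homogeneous d g"
  shows "hcomp u (f * g) = (if d \<le> u then hcomp (u - d) f * g else 0)"
proof (cases "f = 0")
  case False
  obtain e where e: "deg_less e f" using ex_deg_less by blast
  have "f * g = (\<Sum>v<e. hcomp v f * g)"
    by (subst hcomp_expand[OF e]) (simp add: sum_distrib_right)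
  then have "hcomp u (f * g) = (\<Sum>v<e. hcomp u (hcomp v f * g))" by (simp add: hcomp_sum)
  also have "\<dots> = (\<Sum>v<e. if v + d = u then hcomp v f * g else 0)"
    by (rule sum.cong) (auto simp: hcomp_homogeneous[OF homogeneous_mult[OF homogeneous_hcomp assms]])
  also have "\<dots> = (\<Sum>v<e. if v = u - d then (if d \<le> u then hcomp v f * g else 0) else 0)"
    by (rule sum.cong) auto
  also have "\<dots> = (if d \<le> u then hcomp (u - d) f * g else 0)"
    using hcomp_deg_less[OF e, of "u - d"] by (auto simp: sum.delta)
  finally show ?thesis .
qed simp

lemma hcomp_Var_mult: "hcomp (Suc u) (Var l * f) = Var l * hcomp u f" "hcomp 0 (Var l * f) = 0"
  using hcomp_homogeneous_mult[OF homogeneous_Var, of "Suc u" f l]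
   hcomp_homogeneous_mult[OF homogeneous_Var, of 0 f l] by (simp_all add: mult.commute)

lemma homogeneous_0_Const: "homogeneous 0 f \<Longrightarrow> f = Const (lookup f 0)"
  by (rule poly_mapping_eqI) (auto simp: homogeneous_def Const_def lookup_single monom_degree_eq_0 in_keys_iff when_def)

lemma hcomp_0_Const: "hcomp 0 f = Const (lookup f 0)"
  using homogeneous_0_Const[OF homogeneous_hcomp, of f] by (simp add: lookup_hcomp)

lemma lookup_mult_0: "lookup (f * g) 0 = lookup f 0 * lookup (g::'k::field mpoly) 0"
proof (induction f rule: poly_mapping_induct_single)
  case (single m c)
  show ?case
  proof (induction g rule: poly_mapping_induct_single)
    case (single m' c')
    have "m + m' = 0 \<longleftrightarrow> m = 0 \<and> m' = 0"
      by (metis monom_degree_add monom_degree_eq_0 add_is_0)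
    then show ?case by (auto simp: mult_single lookup_single when_def)
  qed (auto simp: distrib_left lookup_add)
qed (auto simp: distrib_right lookup_add)

section \<open>Evaluation and translation\<close>

definition mono_eval :: "(nat \<Rightarrow> 'r::comm_ring_1) \<Rightarrow> (nat \<Rightarrow>\<^sub>0 nat) \<Rightarrow> 'r" where
  "mono_eval s m = (\<Prod>i\<in>keys m. s i ^ lookup m i)"

lemma mono_eval_superset: "finite S \<Longrightarrow> keys m \<subseteq> S \<Longrightarrow> mono_eval s m = (\<Prod>i\<in>S. s i ^ lookup m i)"
  unfolding mono_eval_def by (rule prod.mono_neutral_left) (auto simp: in_keys_iff)

lemma mono_eval_0 [simp]: "mono_eval s 0 = 1" by (simp add: mono_eval_def)

lemma mono_eval_add: "mono_eval s (m + m') = mono_eval s m * mono_eval s m'"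
proof -
  let ?S = "keys m \<union> keys m'"
  show ?thesis
    using mono_eval_superset[of ?S m s] mono_eval_superset[of ?S m' s] mono_eval_superset[of ?S "m + m'" s]
    by (simp add: keys_add_nat lookup_add power_add prod.distrib)
qed

lemma mono_eval_single: "mono_eval s (single i e) = s i ^ e"
  by (subst mono_eval_superset[of "{i}"]) auto

text \<open>The substitution of the polynomials \<open>s i\<close> for the variables.\<close>

definition subst_poly :: "(nat \<Rightarrow> 'k::field mpoly) \<Rightarrow> 'k mpoly \<Rightarrow> 'k mpoly" where
  "subst_poly s = monomial_sum (\<lambda>m c. Const c * mono_eval s m)"

lemma subst_0 [simp]: "subst_poly s 0 = 0" by (simp add: subst_poly_def)
lemma subst_add: "subst_poly s (f + g) = subst_poly s f + subst_poly s g"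
  unfolding subst_poly_def by (rule monomial_sum_add) (auto simp: Const_add algebra_simps)
lemma subst_single: "subst_poly s (single m c) = Const c * mono_eval s m"
  unfolding subst_poly_def by (rule monomial_sum_single) auto
lemma subst_mult: "subst_poly s (f * g) = subst_poly s f * subst_poly s g"
  unfolding subst_poly_def by (rule monomial_sum_mult) (auto simp: Const_add Const_mult mono_eval_add algebra_simps)
lemma subst_Const: "subst_poly s (Const c) = Const c"
  by (simp add: Const_def subst_single)
lemma subst_1 [simp]: "subst_poly s 1 = 1"
  using subst_Const[of s 1] by simp
lemma subst_Var: "subst_poly s (Var i) = s i"
  unfolding Var_def by (simp add: subst_single mono_eval_single)
lemma subst_power: "subst_poly s (f ^ e) = subst_poly s f ^ e"
  by (induction e) (auto simp: subst_mult)
lemma subst_prod: "subst_poly s (prod f A) = (\<Prod>x\<in>A. subst_poly s (f x))"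
  by (induction A rule: infinite_finite_induct) (auto simp: subst_mult)
lemma subst_sum: "subst_poly s (sum f A) = (\<Sum>x\<in>A. subst_poly s (f x))"
  by (rule additive_sum) (auto simp: subst_add)

lemma single_power: "single i (1::nat) = k \<Longrightarrow> single k (1::'k::field) ^ e = single (single i e) 1"
  by (induction e) (auto simp: mult_single single_add[symmetric])

lemma Var_power: "(Var i :: 'k::field mpoly) ^ e = single (single i e) 1"
  unfolding Var_def by (rule single_power) simp

lemma single_prod: "(\<Prod>x\<in>A. single (f x) (1::'k::field)) = single (\<Sum>x\<in>A. f x :: nat \<Rightarrow>\<^sub>0 nat) 1"
  by (induction A rule: infinite_finite_induct) (auto simp: mult_single)

lemma mono_eval_Var: "mono_eval Var m = (single m 1 :: 'k::field mpoly)"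
  unfolding mono_eval_def Var_power single_prod using poly_mapping_expand[of m] by simp

lemma subst_id [simp]: "subst_poly Var f = f"
proof (induction f rule: poly_mapping_induct_single)
  case (single m c) then show ?case by (simp add: subst_single mono_eval_Var Const_mult_single)
qed (auto simp: subst_add)

lemma subst_comp: "subst_poly s (subst_poly s' f) = subst_poly (\<lambda>i. subst_poly s (s' i)) f"
proof (induction f rule: poly_mapping_induct_single)
  case (single m c)
  then show ?case by (simp add: subst_single subst_mult subst_Const mono_eval_def subst_prod subst_power)
qed (auto simp: subst_add)

lemma deg_le_mult: "deg_le a f \<Longrightarrow> deg_le b g \<Longrightarrow> deg_le (a + b) (f * g)"
  using keys_mult[of f g] by (fastforce simp: deg_le_def intro: add_mono)
lemma deg_le_1: "deg_le d 1"
  by (simp add: deg_le_def)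
lemma deg_le_power: "deg_le a f \<Longrightarrow> deg_le (e * a) (f ^ e)"
  by (induction e) (auto intro!: deg_le_mult simp: deg_le_1)
lemma deg_le_prod: "(\<And>x. x \<in> A \<Longrightarrow> deg_le (a x) (f x)) \<Longrightarrow> deg_le (sum a A) (prod f A)"
  by (induction A rule: infinite_finite_induct) (auto intro!: deg_le_mult simp: deg_le_1)

lemma deg_le_subst:
  assumes "\<And>i. deg_le 1 (s i)" "deg_le d f"
  shows "deg_le d (subst_poly s f)"
proof -
  have "deg_le d (Const c * mono_eval s m)" if "m \<in> keys f" for m c
  proof -
    have "deg_le (\<Sum>i\<in>keys m. lookup m i * 1) (mono_eval s m)"
      unfolding mono_eval_def by (intro deg_le_prod deg_le_power assms)
    then have "deg_le (monom_degree m) (mono_eval s m)" by (simp add: monom_degree_def)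
    moreover have "monom_degree m \<le> d" using assms(2) that by (auto simp: deg_le_def)
    ultimately have "deg_le d (mono_eval s m)" by (auto simp: deg_le_def)
    then show ?thesis by (rule deg_le_Const_mult)
  qed
  then show ?thesis unfolding subst_poly_def monomial_sum_def by (intro deg_le_sum) auto
qed

lemma deg_less_subst:
  assumes "\<And>i. deg_le 1 (s i)" "deg_less d f"
  shows "deg_less d (subst_poly s f)"
proof (cases d)
  case 0
  then have "f = 0" using assms(2) poly_mapping_expand[of f] by (auto simp: deg_less_def)
  then show ?thesis by simp
next
  case (Suc e)
  then show ?thesis using assms deg_le_subst[of s e f] by (simp add: deg_less_Suc)
qed

definition transl :: "(nat \<Rightarrow> 'k::field) \<Rightarrow> 'k mpoly \<Rightarrow> 'k mpoly" where
  "transl p = subst_poly (\<lambda>i. Var i + Const (p i))"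

lemma transl_inverse: "transl (\<lambda>i. - p i) (transl p f) = f" "transl p (transl (\<lambda>i. - p i) f) = f"
proof -
  have "subst_poly (\<lambda>i. Var i + Const (q i)) (Var i + Const (- q i)) = Var i" for q :: "nat \<Rightarrow> 'a" and i
    unfolding subst_add subst_Var subst_Const by (simp add: Const_uminus)
  from this[of p] this[of "\<lambda>i. - p i"] show "transl (\<lambda>i. - p i) (transl p f) = f" "transl p (transl (\<lambda>i. - p i) f) = f"
    unfolding transl_def subst_comp by simp_all
qed

lemma deg_le_Var_Const: "deg_le 1 (Var i + Const c)"
  by (rule deg_le_add) (auto simp: deg_le_def Var_def Const_def)

lemma deg_le_transl: "deg_le d f \<Longrightarrow> deg_le d (transl p f)"
  unfolding transl_def by (rule deg_le_subst[OF deg_le_Var_Const])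
lemma deg_less_transl: "deg_less d f \<Longrightarrow> deg_less d (transl p f)"
  unfolding transl_def by (rule deg_less_subst[OF deg_le_Var_Const])

definition eval_poly :: "(nat \<Rightarrow> 'k::field) \<Rightarrow> 'k mpoly \<Rightarrow> 'k" where
  "eval_poly p = monomial_sum (\<lambda>m c. c * mono_eval p m)"

lemma eval_add: "eval_poly p (f + g) = eval_poly p f + eval_poly p g"
  unfolding eval_poly_def by (rule monomial_sum_add) (auto simp: algebra_simps)
lemma eval_single: "eval_poly p (single m c) = c * mono_eval p m"
  unfolding eval_poly_def by (rule monomial_sum_single) auto

lemma lookup_power_0: "lookup (f ^ e) 0 = lookup (f::'k::field mpoly) 0 ^ e"
  by (induction e) (auto simp: lookup_mult_0)
lemma lookup_prod_0: "lookup (prod f A) 0 = (\<Prod>x\<in>A. lookup (f x :: 'k::field mpoly) 0)"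
  by (induction A rule: infinite_finite_induct) (auto simp: lookup_mult_0)

lemma lookup_transl_0: "lookup (transl p f) 0 = eval_poly p f"
proof (induction f rule: poly_mapping_induct_single)
  case (single m c)
  have "lookup (Var i + Const a) 0 = a" for i and a :: 'a
    by (simp add: lookup_add Var_def Const_def lookup_single when_def flip: monom_degree_eq_0)
  then show ?case
    by (simp add: transl_def subst_single eval_single mono_eval_def lookup_prod_0 lookup_power_0)
next
  case zero then show ?case by (simp add: transl_def eval_poly_def)
next
  case (add f g) then show ?case by (simp add: transl_def subst_add eval_add lookup_add)
qed

text \<open>The variable \<open>x\<close> is replaced by the scalar \<open>c\<close>.\<close>

definition specialize :: "nat \<Rightarrow> 'k::field \<Rightarrow> 'k mpoly \<Rightarrow> 'k mpoly" where
  "specialize x c = monomial_sum (\<lambda>m a. single (restrict_mono (- {x}) m) (a * c ^ lookup m x))"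

lemma specialize_add: "specialize x c (f + g) = specialize x c f + specialize x c g"
  unfolding specialize_def by (rule monomial_sum_add) (auto simp: single_add algebra_simps)
lemma specialize_single: "specialize x c (single m a) = single (restrict_mono (- {x}) m) (a * c ^ lookup m x)"
  unfolding specialize_def by (rule monomial_sum_single) auto

lemma eval_specialize: "eval_poly p (specialize x c f) = eval_poly (p(x := c)) f"
proof (induction f rule: poly_mapping_induct_single)
  case (single m a)
  have "mono_eval (p(x := c)) (restrict_mono (- {x}) m) = mono_eval p (restrict_mono (- {x}) m)"
    unfolding mono_eval_def by (rule prod.cong) (auto simp: keys_restrict_mono)
  moreover have "m = restrict_mono (- {x}) m + single x (lookup m x)"
    by (rule poly_mapping_eqI) (auto simp: lookup_add lookup_restrict_mono lookup_single when_def)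
  then have "mono_eval (p(x := c)) m = mono_eval (p(x := c)) (restrict_mono (- {x}) m) * c ^ lookup m x"
    by (metis mono_eval_add mono_eval_single fun_upd_same)
  ultimately show ?case by (simp add: specialize_single eval_single mult_ac del: fun_upd_apply)
next
  case zero then show ?case by (simp add: specialize_def eval_poly_def)
next
  case (add f g) then show ?case by (simp add: specialize_add eval_add)
qed

lemma specialize_vars: "f \<in> vars_in (insert x V) \<Longrightarrow> specialize x c f \<in> vars_in V"
  unfolding specialize_def monomial_sum_def
  by (rule vars_in_sum) (auto simp: vars_in_single keys_restrict_mono vars_in_def)

lemma ex_specialize_nonzero:
  assumes inf: "infinite (UNIV :: 'k set)" and "(f::'k::field mpoly) \<noteq> 0"
  shows "\<exists>c. specialize x c f \<noteq> 0"
proof -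
  obtain m0 where m0: "m0 \<in> keys f"
    using assms(2) poly_mapping_expand[of f] by (metis ex_in_conv sum.empty)
  let ?r = "restrict_mono (- {x})"
  let ?M = "{m \<in> keys f. ?r m = ?r m0}"
  define q where "q = (\<Sum>m\<in>?M. Polynomial.monom (lookup f m) (lookup m x))"
  have lk: "lookup (specialize x c f) (?r m0) = poly q c" for c
  proof -
    have "lookup (specialize x c f) (?r m0)
      = (\<Sum>m\<in>keys f. if ?r m = ?r m0 then lookup f m * c ^ lookup m x else 0)"
      unfolding specialize_def monomial_sum_def lookup_sum by (rule sum.cong) (auto simp: lookup_single when_def)
    also have "\<dots> = poly q c"
      unfolding q_def poly_sum poly_monom by (subst sum.inter_filter) auto
    finally show ?thesis .
  qed
  have inj: "m = m0" if "?r m = ?r m0" "lookup m x = lookup m0 x" for m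
  proof (rule poly_mapping_eqI)
    fix i show "lookup m i = lookup m0 i"
      using that lookup_restrict_mono[of "- {x}" m i] lookup_restrict_mono[of "- {x}" m0 i] by (cases "i = x") auto
  qed
  have "coeff q (lookup m0 x) = (\<Sum>m\<in>?M. if m = m0 then lookup f m0 else 0)"
    unfolding q_def coeff_sum coeff_monom by (rule sum.cong) (auto dest: inj)
  also have "\<dots> = lookup f m0" using m0 by (simp add: sum.delta)
  finally have "q \<noteq> 0" using m0 by (auto simp: in_keys_iff)
  then have "finite {c. poly q c = 0}" by (rule poly_roots_finite)
  then obtain c where "poly q c \<noteq> 0" using inf by (metis (mono_tags, lifting) ex_new_if_finite mem_Collect_eq)
  then have "specialize x c f \<noteq> 0" using lk[of c] by force
  then show ?thesis by blast
qed

text \<open>Over an infinite field the variables can be specialized one after the other: the coefficient of a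
monomial of \<open>f\<close> in the other variables is a nonzero univariate polynomial in the specialized value, and
it has finitely many zeros.\<close>

lemma ex_eval_nonzero:
  assumes inf: "infinite (UNIV :: 'k set)" and "(f::'k::field mpoly) \<noteq> 0"
  shows "\<exists>p. eval_poly p f \<noteq> 0"
proof -
  have "\<exists>p. eval_poly p f \<noteq> 0" if "finite V" "f \<in> vars_in V" "f \<noteq> 0" for V and f :: "'k mpoly"
    using that
  proof (induction V arbitrary: f rule: finite_induct)
    case empty
    then have "keys f \<subseteq> {0}" by (auto simp: vars_in_def)
    then have "f = Const (lookup f 0)"
      by (intro poly_mapping_eqI) (auto simp: Const_def lookup_single when_def in_keys_iff)
    moreover from this empty have "lookup f 0 \<noteq> 0" by force
    ultimately have "eval_poly p f \<noteq> 0" for p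
      using eval_single[of p 0 "lookup f 0"] by (simp add: Const_def)
    then show ?case by blast
  next
    case (insert x V)
    obtain c where "specialize x c f \<noteq> 0" using ex_specialize_nonzero[OF inf insert.prems(2)] by blast
    then show ?case using insert.IH[OF specialize_vars[OF insert.prems(1)]] eval_specialize by metis
  qed
  moreover have "f \<in> vars_in (\<Union>m\<in>keys f. keys m)" by (auto simp: vars_in_def)
  moreover have "finite (\<Union>m\<in>keys f. keys m)" by simp
  ultimately show ?thesis using assms(2) by metis
qed

section \<open>Saturated submodules\<close>

text \<open>The modules of the proof are submodules \<open>R\<close> of a free module over \<open>k[V]\<close> with basis \<open>I\<close>, written as
functions with support in \<open>I\<close>.  The last clause says that the quotient of the free module by \<open>R\<close> is
torsion-free; it is what a prime ideal without nonzero elements of \<open>k[V]\<close> provides.  The elements of \<open>I\<close>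
are called columns.\<close>

definition saturated :: "nat set \<Rightarrow> 'i set \<Rightarrow> ('i \<Rightarrow> 'k::field mpoly) set \<Rightarrow> bool" where
  "saturated V I R \<longleftrightarrow>
     (\<forall>w\<in>R. \<forall>i. w i \<in> vars_in V \<and> (i \<notin> I \<longrightarrow> w i = 0)) \<and> (\<lambda>_. 0) \<in> R \<and>
     (\<forall>v\<in>R. \<forall>w\<in>R. (\<lambda>i. v i + w i) \<in> R) \<and>
     (\<forall>c\<in>vars_in V. \<forall>w\<in>R. (\<lambda>i. c * w i) \<in> R) \<and>
     (\<forall>c\<in>vars_in V. \<forall>w. c \<noteq> 0 \<longrightarrow> (\<forall>i. w i \<in> vars_in V \<and> (i \<notin> I \<longrightarrow> w i = 0)) \<longrightarrow> (\<lambda>i. c * w i) \<in> R \<longrightarrow> w \<in> R)"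

lemma saturatedD:
  assumes "saturated V I R"
  shows "\<And>w i. w \<in> R \<Longrightarrow> w i \<in> vars_in V" "\<And>w i. w \<in> R \<Longrightarrow> i \<notin> I \<Longrightarrow> w i = 0" "(\<lambda>_. 0) \<in> R"
    "\<And>v w. v \<in> R \<Longrightarrow> w \<in> R \<Longrightarrow> (\<lambda>i. v i + w i) \<in> R"
    "\<And>c w. c \<in> vars_in V \<Longrightarrow> w \<in> R \<Longrightarrow> (\<lambda>i. c * w i) \<in> R"
    "\<And>c w. c \<in> vars_in V \<Longrightarrow> c \<noteq> 0 \<Longrightarrow> (\<And>i. w i \<in> vars_in V) \<Longrightarrow> (\<And>i. i \<notin> I \<Longrightarrow> w i = 0) \<Longrightarrow> (\<lambda>i. c * w i) \<in> R \<Longrightarrow> w \<in> R"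
proof -
  note * = assms[unfolded saturated_def]
  note r1 = *[THEN conjunct1, rule_format] and r2 = *[THEN conjunct2, THEN conjunct1]
    and r3 = *[THEN conjunct2, THEN conjunct2, THEN conjunct1, rule_format]
    and r4 = *[THEN conjunct2, THEN conjunct2, THEN conjunct2, THEN conjunct1, rule_format]
    and r5 = *[THEN conjunct2, THEN conjunct2, THEN conjunct2, THEN conjunct2, rule_format]
  show "w i \<in> vars_in V" if "w \<in> R" for w i using r1[OF that] by blast
  show "w i = 0" if "w \<in> R" "i \<notin> I" for w i using r1[OF that(1)] that(2) by blast
  show "(\<lambda>_. 0) \<in> R" by (rule r2)
  show "(\<lambda>i. v i + w i) \<in> R" if "v \<in> R" "w \<in> R" for v w by (rule r3[OF that])
  show "(\<lambda>i. c * w i) \<in> R" if "c \<in> vars_in V" "w \<in> R" for c w by (rule r4[OF that])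
  show "w \<in> R" if "c \<in> vars_in V" "c \<noteq> 0" "\<And>i. w i \<in> vars_in V" "\<And>i. i \<notin> I \<Longrightarrow> w i = 0" "(\<lambda>i. c * w i) \<in> R" for c w
    by (rule r5[OF that(1,2) _ that(5)]) (use that(3,4) in blast)
qed

lemma saturated_sum:
  assumes "saturated V I R" "\<And>x. x \<in> A \<Longrightarrow> f x \<in> R"
  shows "(\<lambda>i. \<Sum>x\<in>A. f x i) \<in> R"
  using assms(2) by (induction A rule: infinite_finite_induct) (auto intro!: saturatedD(3,4)[OF assms(1)])

text \<open>A saturated module is cut out by linear equations.  Choose \<open>N\<close> maximal among the sets of columns
whose free module meets \<open>R\<close> in \<open>0\<close>.  Maximality gives, for each other column \<open>i\<close> (a pivot), an element of
\<open>R\<close> supported in \<open>N\<close> and \<open>i\<close> with nonzero entry at \<open>i\<close>; after scaling, all these entries are equal to one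
\<open>\<delta>\<close>.  So \<open>\<delta> w\<close> is determined by the entries of \<open>w\<close> at the pivots, and saturation allows division by
\<open>\<delta>\<close>.  Such equations make sense over every larger field and for more variables, and they can be solved
in power series at a point where \<open>\<delta>\<close> does not vanish.\<close>

lemma pivot_description:
  fixes R :: "('i \<Rightarrow> 'k::field mpoly) set"
  assumes R: "saturated V I R" and I: "finite I" "N0 \<subseteq> I"
    and N0: "\<And>w. w \<in> R \<Longrightarrow> (\<And>i. i \<notin> N0 \<Longrightarrow> w i = 0) \<Longrightarrow> w = (\<lambda>_. 0)"
  obtains N \<delta> \<beta> where "N0 \<subseteq> N" "N \<subseteq> I" "\<delta> \<noteq> 0" "\<delta> \<in> vars_in V" "\<And>i j. \<beta> i j \<in> vars_in V"
    "\<And>w. (\<And>i. w i \<in> vars_in V) \<Longrightarrow> (\<And>i. i \<notin> I \<Longrightarrow> w i = 0) \<Longrightarrow>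
        w \<in> R \<longleftrightarrow> (\<forall>j\<in>N. \<delta> * w j = (\<Sum>i\<in>I - N. w i * \<beta> i j))"
proof -
  define free where "free N \<longleftrightarrow> (\<forall>w\<in>R. (\<forall>i. i \<notin> N \<longrightarrow> w i = 0) \<longrightarrow> w = (\<lambda>_. 0))" for N
  have "finite {N. N0 \<subseteq> N \<and> N \<subseteq> I \<and> free N}" using I by simp
  moreover have "N0 \<in> {N. N0 \<subseteq> N \<and> N \<subseteq> I \<and> free N}" using I N0 by (auto simp: free_def)
  ultimately have "\<exists>N\<in>{N. N0 \<subseteq> N \<and> N \<subseteq> I \<and> free N}. N0 \<subseteq> N \<and>
      (\<forall>N'\<in>{N. N0 \<subseteq> N \<and> N \<subseteq> I \<and> free N}. N \<subseteq> N' \<longrightarrow> N = N')"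
    by (rule finite_has_maximal2)
  then obtain N where N: "N0 \<subseteq> N" "N \<subseteq> I" "free N"
    and max: "\<And>N'. N0 \<subseteq> N' \<Longrightarrow> N' \<subseteq> I \<Longrightarrow> free N' \<Longrightarrow> N \<subseteq> N' \<Longrightarrow> N' = N"
    by (elim bexE) (simp, metis)
  have "\<exists>w\<in>R. (\<forall>k. k \<notin> insert i N \<longrightarrow> w k = 0) \<and> w i \<noteq> 0" if "i \<in> I - N" for i
  proof -
    have "\<not> free (insert i N)" using max[of "insert i N"] N that by auto
    then obtain w where w: "w \<in> R" "\<forall>k. k \<notin> insert i N \<longrightarrow> w k = 0" "w \<noteq> (\<lambda>_. 0)"
      unfolding free_def by blast
    have "w i \<noteq> 0"
    proof
      assume "w i = 0"
      then have "\<forall>k. k \<notin> N \<longrightarrow> w k = 0" using w(2) by auto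
      then show False using N(3) w unfolding free_def by blast
    qed
    then show ?thesis using w by blast
  qed
  then obtain r where r: "\<And>i. i \<in> I - N \<Longrightarrow> r i \<in> R \<and> (\<forall>k. k \<notin> insert i N \<longrightarrow> r i k = 0) \<and> r i i \<noteq> 0"
    by metis
  define \<delta> where "\<delta> = (\<Prod>i\<in>I - N. r i i)"
  have \<delta>: "\<delta> \<noteq> 0" "\<delta> \<in> vars_in V"
    unfolding \<delta>_def using r I saturatedD(1)[OF R] by (auto intro: vars_in_prod)
  define c where "c i = (\<Prod>k\<in>I - N - {i}. r k k)" for i
  have c: "c i * r i i = \<delta>" if "i \<in> I - N" for i
    unfolding c_def \<delta>_def using prod.remove[of "I - N" i "\<lambda>k. r k k"] that I by (simp add: mult.commute)
  have c_in: "c i \<in> vars_in V" for i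
    unfolding c_def using r saturatedD(1)[OF R] by (auto intro!: vars_in_prod)
  define \<beta> where "\<beta> i j = (if i \<in> I - N then c i * r i j else 0)" for i j
  have \<beta>: "\<beta> i j \<in> vars_in V" for i j
    unfolding \<beta>_def using c_in r saturatedD(1)[OF R] by (auto intro!: vars_in_mult)
  have rR: "(\<lambda>k. x * (c i * r i k)) \<in> R" if "i \<in> I - N" "x \<in> vars_in V" for i x
    using that c_in r saturatedD(5)[OF R] by blast
  have key: "(\<Sum>i\<in>I - N. w i * (c i * r i k)) = (if k \<in> I - N then \<delta> * w k else if k \<in> N then (\<Sum>i\<in>I - N. w i * \<beta> i k) else 0)"
    for w :: "'i \<Rightarrow> 'k mpoly" and k
  proof -
    consider "k \<in> I - N" | "k \<in> N" | "k \<notin> I" using N by blast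
    then show ?thesis
    proof cases
      case 1
      have "(\<Sum>i\<in>I - N. w i * (c i * r i k)) = (\<Sum>i\<in>I - N. if i = k then \<delta> * w k else 0)"
        by (rule sum.cong) (use r 1 c in auto)
      then show ?thesis using 1 I by (simp add: sum.delta)
    next
      case 2
      then show ?thesis using N by (auto simp: \<beta>_def intro!: sum.cong)
    next
      case 3
      then have "r i k = 0" if "i \<in> I - N" for i using that r saturatedD(2)[OF R] by blast
      then show ?thesis using 3 N by (auto intro!: sum.neutral)
    qed
  qed
  have main: "w \<in> R \<longleftrightarrow> (\<forall>j\<in>N. \<delta> * w j = (\<Sum>i\<in>I - N. w i * \<beta> i j))"
    if wV: "\<And>i. w i \<in> vars_in V" and wI: "\<And>i. i \<notin> I \<Longrightarrow> w i = 0" for w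
  proof
    assume w: "w \<in> R"
    define z where "z = (\<lambda>k. \<delta> * w k + (-1) * (\<Sum>i\<in>I - N. w i * (c i * r i k)))"
    have "(\<lambda>k. \<Sum>i\<in>I - N. w i * (c i * r i k)) \<in> R"
      using rR wV by (intro saturated_sum[OF R]) auto
    then have "(\<lambda>k. (-1) * (\<Sum>i\<in>I - N. w i * (c i * r i k))) \<in> R"
      by (intro saturatedD(5)[OF R]) (auto intro: vars_in_uminus)
    then have "z \<in> R" unfolding z_def
      by (intro saturatedD(4)[OF R] saturatedD(5)[OF R \<delta>(2) w])
    moreover have "z k = 0" if "k \<notin> N" for k
      unfolding z_def key using that wI by auto
    ultimately have z0: "z = (\<lambda>_. 0)" using N(3) unfolding free_def by blast
    show "\<forall>j\<in>N. \<delta> * w j = (\<Sum>i\<in>I - N. w i * \<beta> i j)"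
    proof
      fix j assume "j \<in> N"
      then show "\<delta> * w j = (\<Sum>i\<in>I - N. w i * \<beta> i j)"
        using fun_cong[OF z0, of j] unfolding z_def key by auto
    qed
  next
    assume eq: "\<forall>j\<in>N. \<delta> * w j = (\<Sum>i\<in>I - N. w i * \<beta> i j)"
    have "(\<lambda>k. \<delta> * w k) = (\<lambda>k. \<Sum>i\<in>I - N. w i * (c i * r i k))"
      unfolding key using eq wI N by auto
    moreover have "(\<lambda>k. \<Sum>i\<in>I - N. w i * (c i * r i k)) \<in> R"
      using rR wV by (intro saturated_sum[OF R]) auto
    ultimately show "w \<in> R" using saturatedD(6)[OF R \<delta>(2,1) wV wI] by simp
  qed
  show thesis
  proof (rule that[of N \<delta> \<beta>])
    fix w :: "'i \<Rightarrow> 'k mpoly"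
    assume "\<And>i. w i \<in> vars_in V" "\<And>i. i \<notin> I \<Longrightarrow> w i = 0"
    then show "w \<in> R \<longleftrightarrow> (\<forall>j\<in>N. \<delta> * w j = (\<Sum>i\<in>I - N. w i * \<beta> i j))" by (rule main)
  qed (fact N(1) N(2) \<delta>(1) \<delta>(2) \<beta>)+
qed

section \<open>Codimension of the decomposable vectors\<close>

text \<open>Column \<open>i\<close> has a degree \<open>a i\<close>: admissible vectors have entries of degree at most \<open>a i\<close>, lower ones of
smaller degree.  The decomposable vectors are those generated, with coefficients of degree at most 1, by
the lower ones.  In the application, an admissible vector comes from a form of degree \<open>j\<close> in the ideal, and
a decomposable one contributes nothing to the minimal generators in degree \<open>j\<close>.\<close>

definition admissible :: "('i \<Rightarrow> 'k::field mpoly) set \<Rightarrow> ('i \<Rightarrow> nat) \<Rightarrow> ('i \<Rightarrow> 'k mpoly) set" where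
  "admissible R a = {w \<in> R. \<forall>i. deg_le (a i) (w i)}"

definition lower :: "('i \<Rightarrow> 'k::field mpoly) set \<Rightarrow> ('i \<Rightarrow> nat) \<Rightarrow> ('i \<Rightarrow> 'k mpoly) set" where
  "lower R a = {w \<in> R. \<forall>i. deg_less (a i) (w i)}"

inductive_set decomposable :: "('i \<Rightarrow> 'k::field mpoly) set \<Rightarrow> ('i \<Rightarrow> nat) \<Rightarrow> ('i \<Rightarrow> 'k mpoly) set" for R a where
  base: "v \<in> lower R a \<Longrightarrow> v \<in> decomposable R a"
| var: "v \<in> lower R a \<Longrightarrow> (\<lambda>i. Var l * v i) \<in> decomposable R a"
| add: "v \<in> decomposable R a \<Longrightarrow> w \<in> decomposable R a \<Longrightarrow> (\<lambda>i. v i + w i) \<in> decomposable R a"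

text \<open>\<open>U\<close> has codimension at most \<open>c\<close> in \<open>V\<close>, expressed by linear dependence: any more than \<open>c\<close> vectors of \<open>V\<close>
have a nontrivial linear combination in \<open>U\<close>.  In this form it passes easily along linear maps and field
extensions.\<close>

definition codim_le :: "nat \<Rightarrow> ('i \<Rightarrow> 'k::field mpoly) set \<Rightarrow> ('i \<Rightarrow> 'k mpoly) set \<Rightarrow> bool" where
  "codim_le c V U \<longleftrightarrow> (\<forall>(S::nat set) f. finite S \<longrightarrow> card S > c \<longrightarrow> (\<forall>x\<in>S. f x \<in> V) \<longrightarrow>
     (\<exists>lam. (\<exists>x\<in>S. lam x \<noteq> 0) \<and> (\<lambda>i. \<Sum>x\<in>S. Const (lam x) * f x i) \<in> U))"

lemma codim_leD:
  assumes "codim_le c V U" "finite (S::nat set)" "card S > c" "\<And>x. x \<in> S \<Longrightarrow> f x \<in> V"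
  obtains lam where "\<exists>x\<in>S. lam x \<noteq> 0" "(\<lambda>i. \<Sum>x\<in>S. Const (lam x) * f x i) \<in> U"
  using assms(1)[unfolded codim_le_def, rule_format, OF assms(2,3), of f] assms(4) that by auto

lemma codim_le_mono: "codim_le c V U \<Longrightarrow> c \<le> d \<Longrightarrow> codim_le d V U"
  unfolding codim_le_def by simp

definition lin_subspace :: "('i \<Rightarrow> 'k::field mpoly) set \<Rightarrow> bool" where
  "lin_subspace V \<longleftrightarrow> (\<lambda>_. 0) \<in> V \<and> (\<forall>v\<in>V. \<forall>w\<in>V. (\<lambda>i. v i + w i) \<in> V) \<and> (\<forall>c. \<forall>w\<in>V. (\<lambda>i. Const c * w i) \<in> V)"

lemma lin_subspaceD:
  assumes "lin_subspace V"
  shows "(\<lambda>_. 0) \<in> V" "v \<in> V \<Longrightarrow> w \<in> V \<Longrightarrow> (\<lambda>i. v i + w i) \<in> V" "w \<in> V \<Longrightarrow> (\<lambda>i. Const c * w i) \<in> V"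
  using assms unfolding lin_subspace_def by simp_all

lemma lin_subspace_comb:
  assumes "lin_subspace V" "\<And>x. x \<in> S \<Longrightarrow> f x \<in> V"
  shows "(\<lambda>i. \<Sum>x\<in>S. Const (lam x) * f x i) \<in> V"
  using assms(2) by (induction S rule: infinite_finite_induct) (auto intro!: lin_subspaceD[OF assms(1)])

lemma codim_transport:
  assumes "codim_le c V' U'" "lin_subspace V" "\<And>w. w \<in> V \<Longrightarrow> F w \<in> V'" "\<And>w. w \<in> V \<Longrightarrow> F w \<in> U' \<Longrightarrow> w \<in> U"
    "\<And>v w. F (\<lambda>i. v i + w i) = (\<lambda>i. F v i + F w i)" "\<And>c w. F (\<lambda>i. Const c * w i) = (\<lambda>i. Const c * F w i)"
  shows "codim_le c V U"
  unfolding codim_le_def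
proof (intro allI impI)
  fix S :: "nat set" and f assume S: "finite S" "c < card S" "\<forall>x\<in>S. f x \<in> V"
  obtain lam where lam: "\<exists>x\<in>S. lam x \<noteq> 0" "(\<lambda>i. \<Sum>x\<in>S. Const (lam x) * F (f x) i) \<in> U'"
    by (rule codim_leD[OF assms(1) S(1,2), of "\<lambda>x. F (f x)"]) (use S assms(3) in auto)
  have F0: "F (\<lambda>i. 0) = (\<lambda>i. 0)" using assms(6)[of 0] by simp
  have "F (\<lambda>i. \<Sum>x\<in>S. Const (lam x) * f x i) = (\<lambda>i. \<Sum>x\<in>S. Const (lam x) * F (f x) i)"
    using S(1) by (induction S) (auto simp: assms(5,6) F0)
  then have "(\<lambda>i. \<Sum>x\<in>S. Const (lam x) * f x i) \<in> U"
    using assms(4)[OF lin_subspace_comb[OF assms(2), of S f lam]] S lam by simp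
  then show "\<exists>lam. (\<exists>x\<in>S. lam x \<noteq> 0) \<and> (\<lambda>i. \<Sum>x\<in>S. Const (lam x) * f x i) \<in> U"
    using lam(1) by (intro exI[of _ lam] conjI)
qed

text \<open>The vanishing of one linear functional costs at most one dimension: a vector on which the functional does
not vanish is used to correct all others.\<close>

lemma codim_vanishing_constant:
  assumes "codim_le c {w \<in> V. lookup (w i0) 0 = 0} U" "lin_subspace V"
  shows "codim_le (Suc c) V U"
  unfolding codim_le_def
proof (intro allI impI)
  fix S :: "nat set" and f assume S: "finite S" "Suc c < card S" "\<forall>x\<in>S. f x \<in> V"
  define \<phi> where "\<phi> x = lookup (f x i0) 0" for x
  show "\<exists>lam. (\<exists>x\<in>S. lam x \<noteq> 0) \<and> (\<lambda>i. \<Sum>x\<in>S. Const (lam x) * f x i) \<in> U"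
  proof (cases "\<forall>x\<in>S. \<phi> x = 0")
    case True
    obtain lam where lam: "\<exists>x\<in>S. lam x \<noteq> 0" "(\<lambda>i. \<Sum>x\<in>S. Const (lam x) * f x i) \<in> U"
      by (rule codim_leD[OF assms(1) S(1), of f]) (use S True in \<open>auto simp: \<phi>_def\<close>)
    show ?thesis using lam by (intro exI[of _ lam] conjI)
  next
    case False
    then obtain y where y: "y \<in> S" "\<phi> y \<noteq> 0" by blast
    define g where "g x = (\<lambda>i. f x i + Const (- \<phi> x / \<phi> y) * f y i)" for x
    have g: "g x \<in> {w \<in> V. lookup (w i0) 0 = 0}" if "x \<in> S" for x
      using that S y unfolding g_def by (auto intro!: lin_subspaceD[OF assms(2)] simp: lookup_add \<phi>_def)
    have cardS: "card (S - {y}) > c" using S y by simp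
    obtain lam where lam: "\<exists>x\<in>S - {y}. lam x \<noteq> 0" "(\<lambda>i. \<Sum>x\<in>S - {y}. Const (lam x) * g x i) \<in> U"
      by (rule codim_leD[OF assms(1) _ cardS, of g]) (use S g in blast)+
    define mu where "mu x = (if x = y then \<Sum>x\<in>S - {y}. lam x * (- \<phi> x / \<phi> y) else lam x)" for x
    have Cs: "Const (sum h A) = (\<Sum>x\<in>A. Const (h x))" for h :: "nat \<Rightarrow> 'b" and A
      by (rule additive_sum) (auto simp: Const_add)
    have "(\<Sum>x\<in>S - {y}. Const (lam x) * g x i) = (\<Sum>x\<in>S. Const (mu x) * f x i)" for i
    proof -
      have "(\<Sum>x\<in>S. Const (mu x) * f x i) = Const (mu y) * f y i + (\<Sum>x\<in>S - {y}. Const (mu x) * f x i)"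
        using S(1) y(1) by (rule sum.remove)
      also have "(\<Sum>x\<in>S - {y}. Const (mu x) * f x i) = (\<Sum>x\<in>S - {y}. Const (lam x) * f x i)"
        by (rule sum.cong) (auto simp: mu_def)
      also have "Const (mu y) * f y i = (\<Sum>x\<in>S - {y}. Const (lam x) * (Const (- \<phi> x / \<phi> y) * f y i))"
        by (simp only: mu_def simp_thms Cs Const_mult if_True sum_distrib_right mult.assoc)
      also have "\<dots> + (\<Sum>x\<in>S - {y}. Const (lam x) * f x i) = (\<Sum>x\<in>S - {y}. Const (lam x) * g x i)"
        unfolding g_def distrib_left sum.distrib by (rule add.commute)
      finally show ?thesis by simp
    qed
    then have "(\<lambda>i. \<Sum>x\<in>S. Const (mu x) * f x i) \<in> U" using lam(2) by simp
    moreover obtain x where "x \<in> S - {y}" "lam x \<noteq> 0" using lam(1) by blast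
    then have "\<exists>x\<in>S. mu x \<noteq> 0" by (intro bexI[of _ x]) (simp_all add: mu_def)
    ultimately show ?thesis by (intro exI[of _ mu] conjI)
  qed
qed

lemma codim_vanishing_constants:
  assumes "finite A" "codim_le c {w \<in> V. \<forall>i\<in>A. lookup (w i) 0 = 0} U" "lin_subspace V"
  shows "codim_le (c + card A) V U"
  using assms
proof (induction A arbitrary: c rule: finite_induct)
  case (insert i0 A)
  have eq: "{w \<in> V. \<forall>i\<in>insert i0 A. lookup (w i) 0 = 0}
    = {w \<in> {w \<in> V. \<forall>i\<in>A. lookup (w i) 0 = 0}. lookup (w i0) 0 = 0}" by auto
  have "lin_subspace {w \<in> V. \<forall>i\<in>A. lookup (w i) 0 = 0}"
    using lin_subspaceD[OF insert.prems(2)] by (auto simp: lin_subspace_def lookup_add)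
  then have "codim_le (Suc c) {w \<in> V. \<forall>i\<in>A. lookup (w i) 0 = 0} U"
    using insert.prems(1) unfolding eq by (rule codim_vanishing_constant[rotated])
  from insert.IH[OF this insert.prems(2)] show ?case using insert.hyps by simp
qed auto

lemma lin_subspace_admissible: "saturated UNIV I R \<Longrightarrow> lin_subspace (admissible R a)"
  unfolding lin_subspace_def admissible_def
  by (auto intro!: saturatedD(3,4) saturatedD(5) deg_le_add deg_le_Const_mult)

lemma zero_lower: "saturated UNIV I R \<Longrightarrow> (\<lambda>_. 0) \<in> lower R a"
  by (auto simp: lower_def saturatedD(3))

section \<open>Graded expansion\<close>

text \<open>The polynomial \<open>f\<close> as a power series in an auxiliary variable \<open>s\<close> whose coefficient at \<open>s^u\<close> is the
component of degree \<open>u\<close>; this is the substitution of \<open>s y\<^sub>i\<close> for \<open>y\<^sub>i\<close>.  It turns polynomials with nonzero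
constant term into units.\<close>

definition graded_expansion :: "'k::field mpoly \<Rightarrow> 'k mpoly fps" where
  "graded_expansion f = Abs_fps (\<lambda>u. hcomp u f)"

lemma graded_expansion_nth [simp]: "fps_nth (graded_expansion f) u = hcomp u f" by (simp add: graded_expansion_def)

lemma graded_expansion_inj: "graded_expansion f = graded_expansion g \<Longrightarrow> f = g"
  by (rule hcomp_eqI) (metis graded_expansion_nth)

lemma graded_expansion_0: "graded_expansion 0 = 0" by (rule fps_ext) simp
lemma graded_expansion_add: "graded_expansion (f + g) = graded_expansion f + graded_expansion g" by (rule fps_ext) (simp add: hcomp_add)
lemma graded_expansion_sum: "graded_expansion (sum f A) = (\<Sum>x\<in>A. graded_expansion (f x))"
  by (rule additive_sum) (auto simp: graded_expansion_add graded_expansion_0)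

lemma graded_expansion_mult: "graded_expansion (f * g) = graded_expansion f * graded_expansion g"
proof (rule fps_ext)
  fix u
  obtain e where e: "deg_less e g" using ex_deg_less by blast
  define d where "d = max e (Suc u)"
  have d: "deg_less d g" using e by (auto simp: deg_less_def d_def)
  have "hcomp u (f * g) = (\<Sum>v<d. hcomp u (f * hcomp v g))"
    by (subst hcomp_expand[OF d]) (simp add: sum_distrib_left hcomp_sum)
  also have "\<dots> = (\<Sum>v<d. if v \<le> u then hcomp (u - v) f * hcomp v g else 0)"
    by (simp add: hcomp_homogeneous_mult[OF homogeneous_hcomp])
  also have "\<dots> = (\<Sum>v\<in>{0..u}. if v \<le> u then hcomp (u - v) f * hcomp v g else 0)"
    by (rule sum.mono_neutral_right) (auto simp: d_def)
  also have "\<dots> = (\<Sum>v\<in>{0..u}. hcomp v g * hcomp (u - v) f)"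
    by (rule sum.cong) (auto simp: mult.commute)
  finally show "fps_nth (graded_expansion (f * g)) u = fps_nth (graded_expansion f * graded_expansion g) u"
    by (subst mult.commute[of "graded_expansion f"]) (simp add: fps_mult_nth)
qed

definition graded_fps :: "'k::field mpoly fps \<Rightarrow> bool" where
  "graded_fps E \<longleftrightarrow> (\<forall>r. homogeneous r (fps_nth E r))"

lemma graded_fps_expansion: "graded_fps (graded_expansion f)" by (simp add: graded_fps_def homogeneous_hcomp)
lemma graded_fps_mult:
  assumes "graded_fps E" "graded_fps F"
  shows "graded_fps (E * F)"
  unfolding graded_fps_def fps_mult_nth
proof (intro allI homogeneous_sum)
  fix r i :: nat assume "i \<in> {0..r}"
  then show "homogeneous r (fps_nth E i * fps_nth F (r - i))"
    using homogeneous_mult[of i "fps_nth E i" "r - i" "fps_nth F (r - i)"] assms by (simp add: graded_fps_def)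
qed
lemma graded_fps_sum: "(\<And>x. x \<in> A \<Longrightarrow> graded_fps (E x)) \<Longrightarrow> graded_fps (sum E A)"
  unfolding graded_fps_def fps_sum_nth by (auto intro!: homogeneous_sum)

text \<open>The recursion for the coefficients of the inverse shows that they are again homogeneous of the right
degree.\<close>

lemma graded_expansion_inverse:
  assumes "lookup \<delta> 0 \<noteq> 0"
  obtains E where "graded_expansion \<delta> * E = 1" "graded_fps E"
proof -
  let ?d = "lookup \<delta> 0"
  define E where "E = fps_right_inverse (graded_expansion \<delta>) (Const (1 / ?d))"
  have E: "graded_expansion \<delta> * E = 1" unfolding E_def
    by (rule fps_right_inverse) (use assms in \<open>simp add: hcomp_0_Const flip: Const_mult\<close>)
  have "homogeneous r (fps_nth E r)" for r
  proof (induction r rule: less_induct)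
    case (less r)
    have "fps_nth (graded_expansion \<delta> * E) r = Const ?d * fps_nth E r + (\<Sum>i\<in>{1..r}. hcomp i \<delta> * fps_nth E (r - i))"
      unfolding fps_mult_nth by (subst sum.atLeast_Suc_atMost) (auto simp: hcomp_0_Const)
    then have "Const ?d * fps_nth E r = (if r = 0 then 1 else 0) + - (\<Sum>i\<in>{1..r}. hcomp i \<delta> * fps_nth E (r - i))"
      unfolding E fps_one_nth by (simp only: diff_conv_add_uminus[symmetric] eq_diff_eq)
    moreover have "homogeneous r ((if r = 0 then 1 else 0) + - (\<Sum>i\<in>{1..r}. hcomp i \<delta> * fps_nth E (r - i)))"
    proof (intro homogeneous_add homogeneous_uminus homogeneous_sum)
      show "homogeneous r (if r = 0 then 1 else 0)" by (simp add: homogeneous_def)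
      fix i assume "i \<in> {1..r}"
      then show "homogeneous r (hcomp i \<delta> * fps_nth E (r - i))"
        using homogeneous_mult[OF homogeneous_hcomp[of i \<delta>] less[of "r - i"]] by simp
    qed
    ultimately have "homogeneous r (Const (1 / ?d) * (Const ?d * fps_nth E r))"
      by (simp only: homogeneous_Const_mult)
    then show ?case using assms by (simp add: mult.assoc[symmetric] flip: Const_mult)
  qed
  then show thesis using that[OF E] by (simp add: graded_fps_def)
qed

section \<open>Expansion of a saturated module at a point\<close>

text \<open>The expansion of a module replaces a column by several new ones, one for each positive degree up to its
own.  A column records where it comes from and the list of these choices, the last one first, so that all
modules of an iterated expansion have columns of the same type.\<close>

datatype 'x col = Col (origin: 'x) (degs: "nat list")

definition child :: "'x col \<Rightarrow> nat \<Rightarrow> 'x col" where "child i u = Col (origin i) (u # degs i)"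
definition parent :: "'x col \<Rightarrow> 'x col" where "parent q = Col (origin q) (tl (degs q))"
definition col_degree :: "'x col \<Rightarrow> nat" where "col_degree q = hd (degs q)"

lemma child_simps [simp]: "parent (child i u) = i" "col_degree (child i u) = u" "child i u = child k v \<longleftrightarrow> i = k \<and> u = v"
  by (auto simp: child_def parent_def col_degree_def col.expand)

definition expansion_cols :: "'x col set \<Rightarrow> ('x col \<Rightarrow> nat) \<Rightarrow> 'x col set" where
  "expansion_cols J a = {child i u | i u. i \<in> J \<and> 1 \<le> u \<and> u \<le> a i}"

lemma child_in_cols [simp]: "child i u \<in> expansion_cols J a \<longleftrightarrow> i \<in> J \<and> 1 \<le> u \<and> u \<le> a i"
  by (auto simp: expansion_cols_def)

lemma expansion_colsE:
  assumes "q \<in> expansion_cols J a"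
  obtains i u where "q = child i u" "i \<in> J" "1 \<le> u" "u \<le> a i"
  using assms by (auto simp: expansion_cols_def)

text \<open>The module with the equations found by \<open>pivot_description\<close>.\<close>

definition solution_module :: "'i set \<Rightarrow> 'i set \<Rightarrow> 'k::field mpoly \<Rightarrow> ('i \<Rightarrow> 'i \<Rightarrow> 'k mpoly) \<Rightarrow> ('i \<Rightarrow> 'k mpoly) set" where
  "solution_module I N \<delta> \<beta> = {w. (\<forall>i. i \<notin> I \<longrightarrow> w i = 0) \<and> (\<forall>j\<in>N. \<delta> * w j = (\<Sum>i\<in>I - N. w i * \<beta> i j))}"

lemma solution_moduleD:
  assumes "w \<in> solution_module I N \<delta> \<beta>"
  shows "i \<notin> I \<Longrightarrow> w i = 0" "j \<in> N \<Longrightarrow> \<delta> * w j = (\<Sum>i\<in>I - N. w i * \<beta> i j)"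
  using assms by (auto simp: solution_module_def)

lemma solution_moduleI:
  assumes "\<And>i. i \<notin> I \<Longrightarrow> w i = 0" "\<And>j. j \<in> N \<Longrightarrow> \<delta> * w j = (\<Sum>i\<in>I - N. w i * \<beta> i j)"
  shows "w \<in> solution_module I N \<delta> \<beta>"
  using assms by (auto simp: solution_module_def)

lemma saturated_solution_module: "saturated UNIV I (solution_module I N \<delta> \<beta>)"
  unfolding saturated_def
proof (intro conjI ballI allI impI)
  fix w i assume "w \<in> solution_module I N \<delta> \<beta>"
  then show "w i \<in> vars_in UNIV" "i \<notin> I \<Longrightarrow> w i = 0" by (auto dest: solution_moduleD)
next
  show "(\<lambda>_. 0) \<in> solution_module I N \<delta> \<beta>" by (simp add: solution_module_def)
next
  fix v w assume v: "v \<in> solution_module I N \<delta> \<beta>" and w: "w \<in> solution_module I N \<delta> \<beta>"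
  show "(\<lambda>i. v i + w i) \<in> solution_module I N \<delta> \<beta>"
    by (rule solution_moduleI) (simp_all add: solution_moduleD[OF v] solution_moduleD[OF w] distrib_left distrib_right sum.distrib)
next
  fix c w assume w: "w \<in> solution_module I N \<delta> \<beta>"
  show "(\<lambda>i. c * w i) \<in> solution_module I N \<delta> \<beta>"
  proof (rule solution_moduleI)
    fix j assume "j \<in> N"
    then have "c * (\<delta> * w j) = (\<Sum>i\<in>I - N. c * w i * \<beta> i j)"
      by (simp add: solution_moduleD(2)[OF w] sum_distrib_left mult.assoc)
    then show "\<delta> * (c * w j) = (\<Sum>i\<in>I - N. c * w i * \<beta> i j)" by (simp add: mult.left_commute)
  qed (simp add: solution_moduleD[OF w])
next
  fix c w assume c: "c \<noteq> 0" and wI: "\<forall>i. w i \<in> vars_in UNIV \<and> (i \<notin> I \<longrightarrow> w i = 0)"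
    and w: "(\<lambda>i. c * w i) \<in> solution_module I N \<delta> \<beta>"
  show "w \<in> solution_module I N \<delta> \<beta>"
  proof (rule solution_moduleI)
    fix j assume "j \<in> N"
    then have "c * (\<delta> * w j) = c * (\<Sum>i\<in>I - N. w i * \<beta> i j)"
      using solution_moduleD(2)[OF w, of j] by (simp add: sum_distrib_left mult_ac)
    then show "\<delta> * w j = (\<Sum>i\<in>I - N. w i * \<beta> i j)" using c by simp
  qed (use wI in auto)
qed

definition col_series :: "('x col \<Rightarrow> nat) \<Rightarrow> ('x col \<Rightarrow> 'k::field mpoly) \<Rightarrow> 'x col \<Rightarrow> 'k mpoly fps" where
  "col_series a w i = Abs_fps (\<lambda>u. if 1 \<le> u \<and> u \<le> a i then w (child i u) else 0)"

lemma col_series_nth: "fps_nth (col_series a w i) u = (if 1 \<le> u \<and> u \<le> a i then w (child i u) else 0)"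
  by (simp add: col_series_def)

lemma col_series_add: "col_series a (\<lambda>q. v q + w q) i = col_series a v i + col_series a w i"
  by (rule fps_ext) (simp add: col_series_nth)
lemma col_series_mult: "col_series a (\<lambda>q. c * w q) i = fps_const c * col_series a w i"
  by (rule fps_ext) (simp add: col_series_nth)

text \<open>The series \<open>b i j\<close> stands for \<open>\<beta> i j / \<delta>\<close>, so that the sum is the series of the dependent entry \<open>j\<close>.  Its
vanishing beyond the degree \<open>a j\<close> is required, and nothing else is left of that entry.  These conditions
are linear over the polynomial ring, which acts on the coefficients; hence the module is saturated.\<close>

definition expansion_module :: "'x col set \<Rightarrow> 'x col set \<Rightarrow> ('x col \<Rightarrow> nat) \<Rightarrow> ('x col \<Rightarrow> 'x col \<Rightarrow> 'k::field mpoly fps) \<Rightarrow> ('x col \<Rightarrow> 'k mpoly) set" where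
  "expansion_module I N a b = {w. (\<forall>q. q \<notin> expansion_cols (I - N) a \<longrightarrow> w q = 0) \<and>
     (\<forall>j\<in>N. \<forall>t>a j. fps_nth (\<Sum>i\<in>I - N. col_series a w i * b i j) t = 0)}"

lemma saturated_expansion_module: "saturated UNIV (expansion_cols (I - N) a) (expansion_module I N a b)"
proof -
  have mult: "(\<Sum>i\<in>I - N. col_series a (\<lambda>q. c * w q) i * b i j) = fps_const c * (\<Sum>i\<in>I - N. col_series a w i * b i j)" for c w j
    by (simp add: col_series_mult sum_distrib_left mult.assoc)
  have z: "col_series a (\<lambda>_. 0) i = 0" for i by (rule fps_ext) (simp add: col_series_nth)
  show ?thesis
    unfolding saturated_def expansion_module_def
    by (auto simp: col_series_add distrib_right sum.distrib mult z)
qed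

text \<open>The central reduction.  An admissible vector whose pivot entries have no constant term is determined by
the homogeneous components, of degrees 1 up to \<open>a i\<close>, of its pivot entries.  The components range over an
admissible part of \<open>expansion_module\<close>, since the dependent entries \<open>w j = (\<Sum>i. w i \<beta> i j) / \<delta>\<close> are polynomials of
degree at most \<open>a j\<close> precisely if the series on the right stops there.  Conversely, summing up components
takes decomposable vectors of the new module to decomposable vectors of the old one.  Requiring the
constant terms of the pivot entries to vanish costs one dimension for each pivot.\<close>

lemma expand_at_origin:
  fixes I N :: "'x col set" and \<delta> :: "'k::field mpoly"
  assumes I: "finite I" "N \<subseteq> I" and \<delta>0: "lookup \<delta> 0 \<noteq> 0"
  obtains R' :: "('x col \<Rightarrow> 'k mpoly) set" where "saturated UNIV (expansion_cols (I - N) a) R'"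
    "\<And>c. codim_le c (admissible R' col_degree) (decomposable R' col_degree) \<Longrightarrow>
       codim_le (c + card (I - N)) (admissible (solution_module I N \<delta> \<beta>) a) (decomposable (solution_module I N \<delta> \<beta>) a)"
proof -
  let ?R = "solution_module I N \<delta> \<beta>"
  obtain E where E: "graded_expansion \<delta> * E = 1" "graded_fps E" using graded_expansion_inverse[OF \<delta>0] by blast
  define b where "b i j = E * graded_expansion (\<beta> i j)" for i j
  have hb: "graded_fps (b i j)" for i j unfolding b_def by (intro graded_fps_mult E graded_fps_expansion)
  define R' where "R' = expansion_module I N a b"
  have satR': "saturated UNIV (expansion_cols (I - N) a) R'" unfolding R'_def by (rule saturated_expansion_module)
  have satR: "saturated UNIV I ?R" by (rule saturated_solution_module)

  \<comment> \<open>\<open>\<Lambda>\<close> reassembles a vector from components.  Passing to the component of the degree of the column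
    first makes \<open>\<Lambda>\<close> vanish on lower vectors and keeps it additive.\<close>
  define W where "W w i = col_series a (\<lambda>q. hcomp (col_degree q) (w q)) i" for w :: "'x col \<Rightarrow> 'k mpoly" and i
  define B where "B w j = (\<Sum>i\<in>I - N. W w i * b i j)" for w j
  define \<Lambda> where "\<Lambda> w i = (if i \<in> N then \<Sum>t\<le>a i. fps_nth (B w i) t else if i \<in> I then \<Sum>u\<le>a i. fps_nth (W w i) u else 0)" for w i
  have W_add: "W (\<lambda>q. v q + w q) i = W v i + W w i" for v w i
    by (simp add: W_def hcomp_add col_series_add)
  have \<Lambda>_add: "\<Lambda> (\<lambda>q. v q + w q) = (\<lambda>i. \<Lambda> v i + \<Lambda> w i)" for v w
    by (rule ext) (simp add: \<Lambda>_def B_def W_add distrib_right sum.distrib)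

  have lower: "\<exists>v'\<in>lower ?R a. \<forall>l. \<Lambda> (\<lambda>q. Var l * v q) = (\<lambda>i. Var l * v' i)"
    if v: "v \<in> lower R' col_degree" for v
  proof -
    \<comment> \<open>A component of degree \<open>u\<close> of \<open>Var l * v\<close> comes from one of degree \<open>u - 1\<close> of \<open>v\<close>; \<open>U\<close> collects
      the latter, and \<open>D\<close> gives the dependent entries.\<close>
    define U where "U i = Abs_fps (\<lambda>s. if s < a i then hcomp s (v (child i (Suc s))) else 0)" for i
    have hU: "graded_fps (U i)" for i by (simp add: graded_fps_def U_def homogeneous_hcomp)
    define D where "D j = (\<Sum>i\<in>I - N. U i * b i j)" for j
    have hD: "graded_fps (D j)" for j unfolding D_def by (intro graded_fps_sum graded_fps_mult hU hb)
    define v' where "v' i = (if i \<in> N then \<Sum>t<a i. fps_nth (D i) t else if i \<in> I then \<Sum>t<a i. fps_nth (U i) t else 0)" for i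
    have D0: "fps_nth (D j) t = 0" if j: "j \<in> N" and t: "a j \<le> t" for j t
    proof -
      have "fps_nth (\<Sum>i\<in>I - N. col_series a v i * b i j) (Suc t) = 0"
        using v j t by (auto simp: lower_def R'_def expansion_module_def)
      then have "0 = hcomp t (\<Sum>i\<in>I - N. \<Sum>u=0..Suc t. fps_nth (col_series a v i) u * fps_nth (b i j) (Suc t - u))"
        by (simp add: fps_sum_nth fps_mult_nth)
      also have "\<dots> = (\<Sum>i\<in>I - N. \<Sum>u=0..Suc t. hcomp t (fps_nth (col_series a v i) u * fps_nth (b i j) (Suc t - u)))"
        by (simp only: hcomp_sum)
      also have "\<dots> = (\<Sum>i\<in>I - N. \<Sum>u=0..t. fps_nth (U i) u * fps_nth (b i j) (t - u))"
      proof (rule sum.cong[OF refl])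
        fix i assume "i \<in> I - N"
        have *: "hcomp t (fps_nth (col_series a v i) (Suc u) * fps_nth (b i j) (t - u)) = fps_nth (U i) u * fps_nth (b i j) (t - u)"
          if "u \<le> t" for u
          using that hcomp_homogeneous_mult[of "t - u" "fps_nth (b i j) (t - u)" t] hb[of i j]
          by (auto simp: graded_fps_def U_def col_series_nth)
        have "(\<Sum>u=0..Suc t. hcomp t (fps_nth (col_series a v i) u * fps_nth (b i j) (Suc t - u)))
          = (\<Sum>u=0..t. hcomp t (fps_nth (col_series a v i) (Suc u) * fps_nth (b i j) (Suc t - Suc u)))"
          unfolding sum.atLeast0_atMost_Suc_shift by (simp add: col_series_nth)
        also have "\<dots> = (\<Sum>u=0..t. fps_nth (U i) u * fps_nth (b i j) (t - u))"
          by (rule sum.cong) (use * in auto)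
        finally show "(\<Sum>u=0..Suc t. hcomp t (fps_nth (col_series a v i) u * fps_nth (b i j) (Suc t - u)))
          = (\<Sum>u=0..t. fps_nth (U i) u * fps_nth (b i j) (t - u))" .
      qed
      also have "\<dots> = fps_nth (D j) t" by (simp add: D_def fps_sum_nth fps_mult_nth)
      finally show ?thesis by simp
    qed
    have graded_expansion_hom: "graded_expansion (\<Sum>t<d. fps_nth F t) = F" if "graded_fps F" "\<And>t. d \<le> t \<Longrightarrow> fps_nth F t = 0" for F :: "'k mpoly fps" and d
    proof (rule fps_ext)
      fix u
      have "fps_nth (graded_expansion (\<Sum>t<d. fps_nth F t)) u = (\<Sum>t<d. if t = u then fps_nth F t else 0)"
      proof -
        have "hcomp u (fps_nth F t) = (if t = u then fps_nth F t else 0)" for t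
          using that(1) hcomp_homogeneous[of t "fps_nth F t" u] by (auto simp: graded_fps_def)
        then show ?thesis by (simp add: hcomp_sum)
      qed
      also have "\<dots> = fps_nth F u" using that(2)[of u] by (auto simp: sum.delta)
      finally show "fps_nth (graded_expansion (\<Sum>t<d. fps_nth F t)) u = fps_nth F u" .
    qed
    have gP: "graded_expansion (v' i) = U i" if "i \<in> I - N" for i
      using that graded_expansion_hom[OF hU, of "a i" i] by (simp add: v'_def U_def)
    have gN: "graded_expansion (v' j) = D j" if "j \<in> N" for j
      using that graded_expansion_hom[OF hD, of "a j" j] D0 by (simp add: v'_def)
    have "v' \<in> ?R"
    proof (rule solution_moduleI)
      fix i assume "i \<notin> I" then show "v' i = 0" using I(2) by (auto simp: v'_def)
    next
      fix j assume j: "j \<in> N"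
      have "graded_expansion (\<delta> * v' j) = graded_expansion \<delta> * (\<Sum>i\<in>I - N. graded_expansion (v' i) * (E * graded_expansion (\<beta> i j)))"
        unfolding graded_expansion_mult gN[OF j] D_def b_def by (simp add: gP)
      also have "\<dots> = (graded_expansion \<delta> * E) * (\<Sum>i\<in>I - N. graded_expansion (v' i) * graded_expansion (\<beta> i j))"
        by (simp add: sum_distrib_left mult_ac)
      also have "\<dots> = graded_expansion (\<Sum>i\<in>I - N. v' i * \<beta> i j)"
        by (simp add: E graded_expansion_sum graded_expansion_mult)
      finally show "\<delta> * v' j = (\<Sum>i\<in>I - N. v' i * \<beta> i j)" by (rule graded_expansion_inj)
    qed
    moreover have "deg_less (a i) (v' i)" for i
      using hU hD unfolding v'_def graded_fps_def
      by (auto intro!: deg_less_sum homogeneous_deg_less)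
    ultimately have "v' \<in> lower ?R a" by (simp add: lower_def)
    moreover have "\<Lambda> (\<lambda>q. Var l * v q) = (\<lambda>i. Var l * v' i)" for l
    proof -
      have WU: "W (\<lambda>q. Var l * v q) i = fps_const (Var l) * (fps_X * U i)" for i
      proof (rule fps_ext)
        fix u show "fps_nth (W (\<lambda>q. Var l * v q) i) u = fps_nth (fps_const (Var l) * (fps_X * U i)) u"
          by (cases u) (auto simp: W_def col_series_nth U_def hcomp_Var_mult)
      qed
      have BD: "B (\<lambda>q. Var l * v q) j = fps_const (Var l) * (fps_X * D j)" for j
        by (simp add: B_def WU D_def sum_distrib_left mult.assoc)
      have shift: "(\<Sum>u\<le>d. fps_nth (fps_const (Var l) * (fps_X * F)) u) = Var l * (\<Sum>u<d. fps_nth F u)" for d and F :: "'k mpoly fps"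
        by (cases d) (auto simp: sum.atMost_Suc_shift sum_distrib_left lessThan_Suc_atMost simp del: sum.atMost_Suc sum.lessThan_Suc)
      show ?thesis unfolding \<Lambda>_def v'_def WU BD shift by (rule ext) simp
    qed
    ultimately show ?thesis by blast
  qed

  have \<Lambda>_T: "\<Lambda> w \<in> decomposable ?R a" if "w \<in> decomposable R' col_degree" for w
    using that
  proof induction
    case (base v)
    have "hcomp (col_degree q) (v q) = 0" for q using base by (auto simp: lower_def intro: hcomp_deg_less)
    then have "W v i = 0" for i by (intro fps_ext) (simp add: W_def col_series_nth)
    then have "\<Lambda> v = (\<lambda>_. 0)" by (intro ext) (simp add: \<Lambda>_def B_def)
    then show ?case using decomposable.base[OF zero_lower[OF satR]] by simp
  next
    case (var v l)
    then obtain v' where v': "v' \<in> lower ?R a" "\<And>l. \<Lambda> (\<lambda>q. Var l * v q) = (\<lambda>i. Var l * v' i)"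
      using lower by blast
    then show ?case using decomposable.var[OF v'(1)] by simp
  next
    case (add v w)
    then show ?case unfolding \<Lambda>_add by (intro decomposable.add)
  qed

  \<comment> \<open>\<open>F\<close> takes the components of the pivot entries; it is inverted by \<open>\<Lambda>\<close> on \<open>VR\<close>.\<close>
  define F where "F w q = (if q \<in> expansion_cols (I - N) a then hcomp (col_degree q) (w (parent q)) else 0)" for w :: "'x col \<Rightarrow> 'k mpoly" and q
  define VR where "VR = {w \<in> admissible ?R a. \<forall>i\<in>I - N. lookup (w i) 0 = 0}"
  have colserF: "col_series a (F w) i = graded_expansion (w i)" "W (F w) i = graded_expansion (w i)" if "w \<in> VR" "i \<in> I - N" for w i
  proof -
    have d: "deg_less (Suc (a i)) (w i)" using that by (simp add: VR_def admissible_def deg_less_Suc)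
    have 0: "hcomp 0 (w i) = 0" using that by (simp add: VR_def hcomp_0_Const)
    have hh: "hcomp u (hcomp u f) = hcomp u f" for u and f :: "'k mpoly"
      by (simp add: hcomp_homogeneous[OF homogeneous_hcomp])
    show "col_series a (F w) i = graded_expansion (w i)" "W (F w) i = graded_expansion (w i)"
      by (rule fps_ext, use 0 hcomp_deg_less[OF d] that hh in
          \<open>auto simp: col_series_nth F_def W_def not_less_eq_eq Suc_le_eq\<close>)+
  qed
  have BF: "(\<Sum>i\<in>I - N. graded_expansion (w i) * b i j) = graded_expansion (w j)" if "w \<in> VR" "j \<in> N" for w j
  proof -
    have "w \<in> ?R" using that by (simp add: VR_def admissible_def)
    then have "graded_expansion \<delta> * graded_expansion (w j) = (\<Sum>i\<in>I - N. graded_expansion (w i) * graded_expansion (\<beta> i j))"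
      using solution_moduleD(2)[of w I N \<delta> \<beta> j] that(2) by (simp add: graded_expansion_sum flip: graded_expansion_mult)
    then have "E * (graded_expansion \<delta> * graded_expansion (w j)) = (\<Sum>i\<in>I - N. graded_expansion (w i) * b i j)"
      by (simp add: sum_distrib_left b_def mult_ac)
    moreover have "E * (graded_expansion \<delta> * graded_expansion (w j)) = (graded_expansion \<delta> * E) * graded_expansion (w j)" by (simp only: mult_ac)
    ultimately show ?thesis using E(1) by simp
  qed
  have F_V0: "F w \<in> admissible R' col_degree" if "w \<in> VR" for w
  proof -
    have "fps_nth (\<Sum>i\<in>I - N. col_series a (F w) i * b i j) t = 0" if "j \<in> N" "t > a j" for j t
    proof -
      have "(\<Sum>i\<in>I - N. col_series a (F w) i * b i j) = graded_expansion (w j)"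
        using BF[OF \<open>w \<in> VR\<close> that(1)] colserF(1)[OF \<open>w \<in> VR\<close>] by simp
      moreover have "deg_less (Suc (a j)) (w j)" using \<open>w \<in> VR\<close> by (simp add: VR_def admissible_def deg_less_Suc)
      ultimately show ?thesis using that(2) by (simp add: hcomp_deg_less Suc_le_eq)
    qed
    then show ?thesis
      by (auto simp: admissible_def R'_def expansion_module_def F_def intro!: homogeneous_deg_le[OF homogeneous_hcomp])
  qed
  have \<Lambda>F: "\<Lambda> (F w) = w" if w: "w \<in> VR" for w
  proof (rule ext)
    fix i
    have full: "(\<Sum>u\<le>a i. hcomp u (w i)) = w i"
      using hcomp_expand[of "Suc (a i)" "w i"] w by (simp add: VR_def admissible_def deg_less_Suc lessThan_Suc_atMost)
    consider "i \<in> N" | "i \<in> I - N" | "i \<notin> I" by blast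
    then show "\<Lambda> (F w) i = w i"
    proof cases
      case 1
      have "B (F w) i = graded_expansion (w i)" unfolding B_def using BF[OF w 1] colserF(2)[OF w] by simp
      then show ?thesis using 1 full by (simp add: \<Lambda>_def)
    next
      case 2
      then show ?thesis using full colserF(2)[OF w 2] by (simp add: \<Lambda>_def)
    next
      case 3
      then show ?thesis using I(2) w solution_moduleD(1)[of w I N \<delta> \<beta> i] by (auto simp: \<Lambda>_def VR_def admissible_def)
    qed
  qed
  show thesis
  proof (rule that[OF satR'])
    fix c assume c: "codim_le c (admissible R' col_degree) (decomposable R' col_degree)"
    have sV0: "lin_subspace (admissible ?R a)" by (rule lin_subspace_admissible[OF satR])
    have "lin_subspace VR"
      using lin_subspaceD[OF sV0] by (auto simp: lin_subspace_def VR_def lookup_add)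
    have "codim_le c VR (decomposable ?R a)"
    proof (rule codim_transport[OF c \<open>lin_subspace VR\<close>])
      show "F w \<in> admissible R' col_degree" if "w \<in> VR" for w by (rule F_V0[OF that])
      show "w \<in> decomposable ?R a" if "w \<in> VR" "F w \<in> decomposable R' col_degree" for w
        using \<Lambda>_T[OF that(2)] \<Lambda>F[OF that(1)] by simp
      show "F (\<lambda>i. v i + w i) = (\<lambda>i. F v i + F w i)" for v w by (rule ext) (simp add: F_def hcomp_add)
      show "F (\<lambda>i. Const c * w i) = (\<lambda>i. Const c * F w i)" for c w by (rule ext) (simp add: F_def hcomp_Const_mult)
    qed
    then show "codim_le (c + card (I - N)) (admissible ?R a) (decomposable ?R a)"
      unfolding VR_def using I sV0 by (intro codim_vanishing_constants) auto
  qed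
qed

definition unitv :: "'i \<Rightarrow> 'i \<Rightarrow> 'k::field mpoly" where
  "unitv j = (\<lambda>i. if i = j then 1 else 0)"

lemma decomposable_mono:
  assumes "R' \<subseteq> R" "w \<in> decomposable R' a"
  shows "w \<in> decomposable R a"
  using assms(2)
proof induction
  case (base v) then show ?case using assms(1) by (intro decomposable.base) (auto simp: lower_def)
next
  case (var v l) then show ?case using assms(1) by (intro decomposable.var) (auto simp: lower_def)
qed (rule decomposable.add)

lemma transl_add: "transl p (f + g) = transl p f + transl p g"
  and transl_mult: "transl p (f * g) = transl p f * transl p g"
  and transl_0: "transl p 0 = 0"
  and transl_sum: "transl p (sum h A) = (\<Sum>x\<in>A. transl p (h x))"
  and transl_Const: "transl p (Const c) = Const c"
  and transl_Var: "transl p (Var i) = Var i + Const (p i)"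
  by (simp_all add: transl_def subst_add subst_mult subst_sum subst_Const subst_Var)

lemma transl_solution_module:
  assumes "w \<in> solution_module I N \<delta> \<beta>"
  shows "(\<lambda>i. transl p (w i)) \<in> solution_module I N (transl p \<delta>) (\<lambda>i j. transl p (\<beta> i j))"
proof (rule solution_moduleI)
  fix j assume "j \<in> N"
  then show "transl p \<delta> * transl p (w j) = (\<Sum>i\<in>I - N. transl p (w i) * transl p (\<beta> i j))"
    using solution_moduleD(2)[OF assms, of j] by (simp add: transl_sum flip: transl_mult)
qed (simp add: solution_moduleD(1)[OF assms] transl_0)

text \<open>Over an infinite field there is a point where \<open>\<delta>\<close> does not vanish, and a translation moves it to the
origin.  Translations preserve degree bounds.  They do not preserve the linear forms \<open>Var l\<close>, but change them
by constants only, and a constant multiple of a lower vector is decomposable.  The column \<open>j0\<close>, whose unit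
vector does not lie in \<open>R\<close>, is put among the dependent columns, so that it leaves no new columns.\<close>

lemma expand_at_general_point:
  fixes R :: "('x col \<Rightarrow> 'k::field mpoly) set"
  assumes inf: "infinite (UNIV :: 'k set)" and I: "finite I" and R: "saturated UNIV I R"
    and j0: "j0 \<in> I" "unitv j0 \<notin> R"
  obtains J and R' :: "('x col \<Rightarrow> 'k mpoly) set" where "J \<subseteq> I - {j0}" "saturated UNIV (expansion_cols J a) R'"
    "\<And>c. codim_le c (admissible R' col_degree) (decomposable R' col_degree) \<Longrightarrow> codim_le (c + card J) (admissible R a) (decomposable R a)"
proof -
  have indep: "w = (\<lambda>_. 0)" if w: "w \<in> R" "\<And>i. i \<notin> {j0} \<Longrightarrow> w i = 0" for w
  proof (rule ccontr)
    assume "w \<noteq> (\<lambda>_. 0)"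
    then obtain i where "w i \<noteq> 0" by blast
    then have nz: "w j0 \<noteq> 0" using w(2)[of i] by auto
    have eq: "(\<lambda>i. w j0 * unitv j0 i) = w" using w(2) by (auto simp: unitv_def)
    have wj: "(\<lambda>i. w j0 * unitv j0 i) \<in> R" unfolding eq by (rule w(1))
    have "unitv j0 \<in> R"
      by (rule saturatedD(6)[OF R _ nz _ _ wj]) (use j0(1) in \<open>auto simp: unitv_def\<close>)
    then show False using j0(2) by simp
  qed
  obtain N \<delta> \<beta> where N: "{j0} \<subseteq> N" "N \<subseteq> I" "\<delta> \<noteq> 0"
    and eq: "\<And>w. (\<And>i. w i \<in> vars_in UNIV) \<Longrightarrow> (\<And>i. i \<notin> I \<Longrightarrow> w i = 0) \<Longrightarrow>
        w \<in> R \<longleftrightarrow> (\<forall>j\<in>N. \<delta> * w j = (\<Sum>i\<in>I - N. w i * \<beta> i j))"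
    by (rule pivot_description[OF R I(1), of "{j0}"]) (use j0 indep in auto)
  have Req: "R = solution_module I N \<delta> \<beta>"
    using eq saturatedD(2)[OF R] by (auto simp: solution_module_def)
  obtain p where p: "eval_poly p \<delta> \<noteq> 0" using ex_eval_nonzero[OF inf N(3)] by blast
  define R2 where "R2 = solution_module I N (transl p \<delta>) (\<lambda>i j. transl p (\<beta> i j))"
  obtain R' :: "('x col \<Rightarrow> 'k mpoly) set" where R': "saturated UNIV (expansion_cols (I - N) a) R'"
    "\<And>c. codim_le c (admissible R' col_degree) (decomposable R' col_degree) \<Longrightarrow> codim_le (c + card (I - N)) (admissible R2 a) (decomposable R2 a)"
    using expand_at_origin[OF I(1) N(2), of "transl p \<delta>" a "\<lambda>i j. transl p (\<beta> i j)"] p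
    unfolding R2_def lookup_transl_0 by metis
  define bk where "bk = transl (\<lambda>i. - p i)"
  have backR: "(\<lambda>i. bk (w i)) \<in> R" if "w \<in> R2" for w
    using transl_solution_module[OF that[unfolded R2_def], of "\<lambda>i. - p i"]
    by (simp add: Req bk_def transl_inverse)
  have back1: "(\<lambda>i. bk (v i)) \<in> lower R a" if "v \<in> lower R2 a" for v
    using that backR[of v] by (auto simp: lower_def bk_def deg_less_transl)
  have backT: "(\<lambda>i. bk (w i)) \<in> decomposable R a" if "w \<in> decomposable R2 a" for w
    using that
  proof induction
    case (base v) then show ?case by (intro decomposable.base back1)
  next
    case (var v l)
    have "(\<lambda>i. Const (- p l) * bk (v i)) \<in> lower R a"
      using back1[OF var] saturatedD(5)[OF R] by (auto simp: lower_def deg_less_Const_mult)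
    moreover have "(\<lambda>i. Var l * bk (v i)) \<in> decomposable R a" by (rule decomposable.var[OF back1[OF var]])
    ultimately have "(\<lambda>i. Var l * bk (v i) + Const (- p l) * bk (v i)) \<in> decomposable R a"
      by (rule decomposable.add[OF _ decomposable.base, rotated])
    then show ?case by (simp add: bk_def transl_mult transl_Var distrib_right)
  next
    case (add v w)
    then show ?case unfolding bk_def transl_add by (intro decomposable.add)
  qed
  show thesis
  proof (rule that[OF _ R'(1)])
    show "I - N \<subseteq> I - {j0}" using N(1) by auto
    fix c assume "codim_le c (admissible R' col_degree) (decomposable R' col_degree)"
    then have "codim_le (c + card (I - N)) (admissible R2 a) (decomposable R2 a)" by (rule R'(2))
    then show "codim_le (c + card (I - N)) (admissible R a) (decomposable R a)"
    proof (rule codim_transport[where F = "\<lambda>w i. transl p (w i)"])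
      show "lin_subspace (admissible R a)" by (rule lin_subspace_admissible[OF R])
      show "(\<lambda>i. transl p (w i)) \<in> admissible R2 a" if "w \<in> admissible R a" for w
        using that transl_solution_module[of w I N \<delta> \<beta> p] by (auto simp: admissible_def R2_def Req deg_le_transl)
      show "w \<in> decomposable R a" if "(\<lambda>i. transl p (w i)) \<in> decomposable R2 a" for w
        using backT[OF that] by (simp add: bk_def transl_inverse)
    qed (simp_all add: transl_add transl_mult transl_Const)
  qed
qed

text \<open>If the unit vector of a column of positive degree lies in \<open>R\<close>, then the entry at this column is arbitrary
and decomposable on its own: each of its monomials of positive degree is a variable times a monomial of
smaller degree.\<close>

lemma delete_column:
  fixes R :: "('i \<Rightarrow> 'k::field mpoly) set"
  assumes R: "saturated UNIV I R" and j0: "unitv j0 \<in> R" "1 \<le> a j0"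
  obtains R' :: "('i \<Rightarrow> 'k mpoly) set" where "saturated UNIV (I - {j0}) R'"
    "\<And>c. codim_le c (admissible R' a) (decomposable R' a) \<Longrightarrow> codim_le c (admissible R a) (decomposable R a)"
proof -
  define R' where "R' = {w \<in> R. w j0 = 0}"
  have fe: "(\<lambda>i. f * unitv j0 i) \<in> R" for f by (rule saturatedD(5)[OF R _ j0(1)]) simp
  have satR': "saturated UNIV (I - {j0}) R'"
    unfolding saturated_def
  proof (intro conjI ballI allI impI)
    fix w i assume "w \<in> R'"
    then show "w i \<in> vars_in UNIV" "i \<notin> I - {j0} \<Longrightarrow> w i = 0" using saturatedD(2)[OF R] by (auto simp: R'_def)
  next
    fix c w assume c: "c \<noteq> 0" and w: "\<forall>i. w i \<in> vars_in UNIV \<and> (i \<notin> I - {j0} \<longrightarrow> w i = 0)" "(\<lambda>i. c * w i) \<in> R'"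
    have "w \<in> R" by (rule saturatedD(6)[OF R _ c]) (use w in \<open>simp_all add: R'_def\<close>)
    then show "w \<in> R'" using w(1) by (simp add: R'_def)
  qed (use saturatedD(3-5)[OF R] in \<open>simp_all add: R'_def\<close>)
  have feT: "(\<lambda>i. f * unitv j0 i) \<in> decomposable R a" if "deg_le (a j0) f" for f
  proof (induction f rule: poly_mapping_induct_single)
    case zero then show ?case using decomposable.base[OF zero_lower[OF R]] by simp
  next
    case (single m c)
    have m: "monom_degree m \<le> a j0" using single that by (auto simp: deg_le_def)
    show ?case
    proof (cases "m = 0")
      case True
      then show ?thesis using j0 fe by (intro decomposable.base) (auto simp: lower_def unitv_def deg_less_def)
    next
      case False
      then obtain l m' where mm: "m = single l 1 + m'" by (rule monomial_factor)
      have eq: "single m c = Var l * single m' c"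
        by (simp add: mm Var_def mult_single)
      have "(\<lambda>i. single m' c * unitv j0 i) \<in> lower R a"
        using fe m by (auto simp: lower_def unitv_def deg_less_def mm)
      then show ?thesis using decomposable.var[of _ R a l] by (simp add: eq mult.assoc)
    qed
  next
    case (add p q)
    then show ?case unfolding distrib_right by (intro decomposable.add) 
  qed
  show thesis
  proof (rule that[OF satR'])
    fix c assume "codim_le c (admissible R' a) (decomposable R' a)"
    then show "codim_le c (admissible R a) (decomposable R a)"
    proof (rule codim_transport[where F = "\<lambda>w i. if i = j0 then 0 else w i"])
      show "lin_subspace (admissible R a)" by (rule lin_subspace_admissible[OF R])
      show "(\<lambda>i. if i = j0 then 0 else w i) \<in> admissible R' a" if "w \<in> admissible R a" for w
      proof -
        have "(\<lambda>i. w i + (- w j0) * unitv j0 i) \<in> R"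
          by (rule saturatedD(4)[OF R _ fe]) (use that in \<open>simp add: admissible_def\<close>)
        moreover have "(\<lambda>i. w i + (- w j0) * unitv j0 i) = (\<lambda>i. if i = j0 then 0 else w i)"
          by (auto simp: unitv_def)
        ultimately show ?thesis using that by (auto simp: admissible_def R'_def)
      qed
      show "w \<in> decomposable R a" if "w \<in> admissible R a" "(\<lambda>i. if i = j0 then 0 else w i) \<in> decomposable R' a" for w
      proof -
        have "(\<lambda>i. if i = j0 then 0 else w i) \<in> decomposable R a"
          by (rule decomposable_mono[OF _ that(2)]) (auto simp: R'_def)
        moreover have "(\<lambda>i. w j0 * unitv j0 i) \<in> decomposable R a"
          using that(1) by (intro feT) (auto simp: admissible_def)
        ultimately have "(\<lambda>i. (if i = j0 then 0 else w i) + w j0 * unitv j0 i) \<in> decomposable R a" by (rule decomposable.add)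
        moreover have "(\<lambda>i. (if i = j0 then 0 else w i) + w j0 * unitv j0 i) = w"
          by (auto simp: unitv_def)
        ultimately show ?thesis by simp
      qed
    qed auto
  qed
qed

section \<open>Counting columns\<close>

definition col_count :: "'i set \<Rightarrow> ('i \<Rightarrow> nat) \<Rightarrow> nat \<Rightarrow> nat" where
  "col_count I a u = card {i \<in> I. a i = u}"

lemma col_count_mono: "finite I \<Longrightarrow> J \<subseteq> I \<Longrightarrow> col_count J a u \<le> col_count I a u"
  unfolding col_count_def by (rule card_mono) auto

lemma card_col_count:
  assumes "finite I" "\<And>i. i \<in> I \<Longrightarrow> a i \<le> D" "s \<le> D"
  shows "card {i \<in> I. D - s \<le> a i} = (\<Sum>l\<le>s. col_count I a (D - l))"
proof -
  have "{i \<in> I. D - s \<le> a i} = (\<Union>l\<in>{..s}. {i \<in> I. a i = D - l})"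
  proof (intro equalityI subsetI)
    fix i assume "i \<in> {i \<in> I. D - s \<le> a i}"
    then have "i \<in> I" "D - a i \<le> s" "a i = D - (D - a i)" using assms(2)[of i] by auto
    then show "i \<in> (\<Union>l\<in>{..s}. {i \<in> I. a i = D - l})" by blast
  qed auto
  then show ?thesis unfolding col_count_def
    by (simp, subst card_UN_disjoint) (use assms in auto)
qed

lemma col_count_cols:
  assumes "finite J" "1 \<le> u"
  shows "col_count (expansion_cols J a) col_degree u = card {i \<in> J. u \<le> a i}"
proof -
  have "{q \<in> expansion_cols J a. col_degree q = u} = (\<lambda>i. child i u) ` {i \<in> J. u \<le> a i}"
    using assms by (auto elim!: expansion_colsE)
  moreover have "inj_on (\<lambda>i. child i u) {i \<in> J. u \<le> a i}" by (auto simp: inj_on_def)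
  ultimately show ?thesis by (simp add: col_count_def card_image)
qed

lemma finite_expansion_cols: "finite J \<Longrightarrow> finite (expansion_cols J a)"
proof -
  assume "finite J"
  moreover have "expansion_cols J a = (\<Union>i\<in>J. child i ` {1..a i})" by (auto simp: expansion_cols_def)
  ultimately show ?thesis by simp
qed

text \<open>\<open>D\<close> is the largest degree of a column and \<open>t\<close> bounds the number of columns of that degree.  The columns of
degree \<open>D\<close> disappear in at most \<open>t\<close> steps of cost at most \<open>\<Sum>s. t * (2 * t) ^ s\<close>, and then at most \<open>2 * t\<^sup>2\<close>
columns of the next degree are present.  The squaring is the source of the double exponential.\<close>

fun phase_bound :: "nat \<Rightarrow> nat \<Rightarrow> nat" where
  "phase_bound 0 t = 0"
| "phase_bound (Suc D) t = t * (\<Sum>s\<le>D. t * (2 * t) ^ s) + phase_bound D (2 * t\<^sup>2)"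

lemma sum_power_le: "(\<Sum>l\<le>s. x ^ l) \<le> (x + 1 :: nat) ^ s"
proof (induction s)
  case (Suc s)
  have "x ^ Suc s \<le> x * (x + 1) ^ s" by (simp add: power_mono)
  moreover have "(x + 1) ^ Suc s = (x + 1) ^ s + x * (x + 1) ^ s" by simp
  ultimately show ?case using Suc by (simp del: power_Suc)
qed simp

text \<open>Every step removes a column of top degree \<open>D\<close>, by deletion or as a dependent column of an expansion.  An
expansion turns a pivot of degree \<open>a\<close> into one column in each degree up to \<open>a\<close>, so the new number of columns of
degree \<open>D - s\<close> is at most the old number of those of degree at least \<open>D - s\<close>.  By \<open>sum_power_le\<close> the
bound \<open>t * (t + k) ^ s\<close> on the number of columns of degree \<open>D - s\<close> therefore becomes \<open>t * (t + k + 1) ^ s\<close>.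
At most \<open>t\<close> steps are possible; at the end \<open>t * (2 * t) ^ (s + 1) \<le> 2 * t\<^sup>2 * (2 * t\<^sup>2) ^ s\<close> is the hypothesis for \<open>D - 1\<close>.\<close>

lemma codim_phases:
  assumes inf: "infinite (UNIV :: 'k::field set)"
  shows "finite (I :: 'x col set) \<Longrightarrow> saturated UNIV I (R :: ('x col \<Rightarrow> 'k mpoly) set) \<Longrightarrow> (\<And>i. i \<in> I \<Longrightarrow> 1 \<le> a i \<and> a i \<le> D) \<Longrightarrow>
    (\<And>s. s < D \<Longrightarrow> col_count I a (D - s) \<le> t * t ^ s) \<Longrightarrow> codim_le (phase_bound D t) (admissible R a) (decomposable R a)"
proof (induction D arbitrary: t I a R)
  case 0
  then have "I = {}" by force
  have "codim_le 0 (admissible R a) (decomposable R a)"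
    unfolding codim_le_def
  proof (intro allI impI)
    fix S :: "nat set" and f assume S: "finite S" "0 < card S" "\<forall>x\<in>S. f x \<in> admissible R a"
    have "f x i = 0" if "x \<in> S" for x i
      using S(3) that saturatedD(2)[OF "0.prems"(2)] \<open>I = {}\<close> by (auto simp: admissible_def)
    then have "(\<lambda>i. \<Sum>x\<in>S. Const 1 * f x i) = (\<lambda>_. 0)" by simp
    then have "(\<lambda>i. \<Sum>x\<in>S. Const 1 * f x i) \<in> decomposable R a"
      using decomposable.base[OF zero_lower[OF "0.prems"(2)]] by simp
    moreover have "S \<noteq> {}" using S(2) by auto
    ultimately show "\<exists>lam. (\<exists>x\<in>S. lam x \<noteq> 0) \<and> (\<lambda>i. \<Sum>x\<in>S. Const (lam x) * f x i) \<in> decomposable R a"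
      by (intro exI[of _ "\<lambda>_. 1"]) auto
  qed
  then show ?case by simp
next
  case (Suc D)
  define C where "C = (\<Sum>s\<le>D. t * (2 * t) ^ s)"
  \<comment> \<open>\<open>k\<close> is the number of steps done in this phase and \<open>n\<close> bounds the number of those to come.\<close>
  have inner: "codim_le (n * C + phase_bound D (2 * t\<^sup>2)) (admissible R a) (decomposable R a)"
    if "n + k = t" "finite (I :: 'x col set)" "saturated UNIV I (R :: ('x col \<Rightarrow> 'k mpoly) set)"
      "\<And>i. i \<in> I \<Longrightarrow> 1 \<le> a i \<and> a i \<le> Suc D" "col_count I a (Suc D) \<le> n"
      "\<And>s. s \<le> D \<Longrightarrow> col_count I a (Suc D - s) \<le> t * (t + k) ^ s" for n k I a R
    using that
  proof (induction n arbitrary: k I a R)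
    case 0
    have D: "1 \<le> a i \<and> a i \<le> D" if "i \<in> I" for i
    proof -
      have "{i \<in> I. a i = Suc D} = {}" using 0 by (simp add: col_count_def)
      then show ?thesis using that 0(4)[OF that] le_SucE by blast
    qed
    have "col_count I a (D - s) \<le> 2 * t\<^sup>2 * (2 * t\<^sup>2) ^ s" if "s < D" for s
    proof -
      have "col_count I a (D - s) = col_count I a (Suc D - Suc s)" by simp
      also have "\<dots> \<le> t * (2 * t) ^ Suc s" using 0(6)[of "Suc s"] 0(1) that by (simp add: mult_2)
      also have "\<dots> = 2 * t\<^sup>2 * (2 * t) ^ s" by (simp add: power2_eq_square)
      also have "\<dots> \<le> 2 * t\<^sup>2 * (2 * t\<^sup>2) ^ s"
        by (intro mult_left_mono power_mono) (auto simp: power2_eq_square)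
      finally show ?thesis .
    qed
    then show ?case using Suc.IH[OF 0(2,3) D, where t = "2 * t\<^sup>2"] by simp
  next
    case (Suc n)
    note IH = Suc.IH and k = Suc.prems(1) and fin = Suc.prems(2) and sat = Suc.prems(3)
      and deg = Suc.prems(4) and topc = Suc.prems(5) and low = Suc.prems(6)
    have mono: "t * (t + k) ^ s \<le> t * (t + Suc k) ^ s" for s
      by (intro mult_left_mono power_mono) auto
    have extend_scalars: "codim_le (Suc n * C + phase_bound D (2 * t\<^sup>2)) (admissible R a) (decomposable R a)"
      if "codim_le (n * C + phase_bound D (2 * t\<^sup>2)) (admissible R a) (decomposable R a)"
      using that by (rule codim_le_mono) simp
    have k': "n + Suc k = t" using k by simp
    show ?case
    proof (cases "\<exists>j0\<in>I. a j0 = Suc D")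
      case False
      then have "{i \<in> I. a i = Suc D} = {}" by blast
      then have *: "col_count I a (Suc D) \<le> n" by (simp only: col_count_def card.empty le0)
      have "codim_le (n * C + phase_bound D (2 * t\<^sup>2)) (admissible R a) (decomposable R a)"
      proof (rule IH[OF k' fin sat deg *])
        show "col_count I a (Suc D - s) \<le> t * (t + Suc k) ^ s" if "s \<le> D" for s
          by (rule le_trans[OF low[OF that] mono])
      qed
      then show ?thesis by (rule extend_scalars)
    next
      case True
      then obtain j0 where j0: "j0 \<in> I" "a j0 = Suc D" by blast
      have topJ: "col_count J a (Suc D) \<le> n" if "J \<subseteq> I - {j0}" for J
      proof -
        have "{i \<in> J. a i = Suc D} \<subset> {i \<in> I. a i = Suc D}" using that j0 by blast
        then have "col_count J a (Suc D) < col_count I a (Suc D)"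
          unfolding col_count_def using fin by (intro psubset_card_mono) auto
        then show ?thesis using topc by simp
      qed
      show ?thesis
      proof (cases "unitv j0 \<in> R")
        case True
        obtain R' :: "('x col \<Rightarrow> 'k mpoly) set" where R': "saturated UNIV (I - {j0}) R'"
          "\<And>c. codim_le c (admissible R' a) (decomposable R' a) \<Longrightarrow> codim_le c (admissible R a) (decomposable R a)"
          by (rule delete_column[OF sat True, of a]) (use j0 in auto)
        have "finite (I - {j0})" using fin by simp
        have "codim_le (n * C + phase_bound D (2 * t\<^sup>2)) (admissible R' a) (decomposable R' a)"
        proof (rule IH[OF k' \<open>finite (I - {j0})\<close> R'(1)])
          show "col_count (I - {j0}) a (Suc D) \<le> n" by (rule topJ) simp
          show "col_count (I - {j0}) a (Suc D - s) \<le> t * (t + Suc k) ^ s" if "s \<le> D" for s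
            by (rule le_trans[OF col_count_mono[OF fin] le_trans[OF low[OF that] mono]]) auto
        qed (use deg in auto)
        then show ?thesis by (intro extend_scalars R'(2))
      next
        case False
        obtain J and R' :: "('x col \<Rightarrow> 'k mpoly) set" where J: "J \<subseteq> I - {j0}"
          and R': "saturated UNIV (expansion_cols J a) R'"
            "\<And>c. codim_le c (admissible R' col_degree) (decomposable R' col_degree) \<Longrightarrow> codim_le (c + card J) (admissible R a) (decomposable R a)"
          using expand_at_general_point[OF inf fin sat j0(1) False] by metis
        have finJ: "finite J" using J fin by (meson finite_Diff finite_subset)
        have degJ: "a i \<le> Suc D" if "i \<in> J" for i using that J deg by auto
        have cJ: "card {i \<in> J. Suc D - s \<le> a i} \<le> t * (\<Sum>l\<le>s. (t + k) ^ l)" if "s \<le> D" for s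
        proof -
          have "card {i \<in> J. Suc D - s \<le> a i} = (\<Sum>l\<le>s. col_count J a (Suc D - l))"
            using degJ that by (intro card_col_count[OF finJ]) auto
          also have "\<dots> \<le> (\<Sum>l\<le>s. t * (t + k) ^ l)"
          proof (rule sum_mono)
            fix l assume "l \<in> {..s}"
            then have "l \<le> D" using that by simp
            have "col_count J a (Suc D - l) \<le> col_count I a (Suc D - l)" using J fin by (intro col_count_mono) auto
            then show "col_count J a (Suc D - l) \<le> t * (t + k) ^ l" using low[OF \<open>l \<le> D\<close>] by simp
          qed
          finally show ?thesis by (simp add: sum_distrib_left)
        qed
        have "codim_le (n * C + phase_bound D (2 * t\<^sup>2)) (admissible R' col_degree) (decomposable R' col_degree)"
        proof (rule IH[OF k' finite_expansion_cols[OF finJ] R'(1)])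
          show "1 \<le> col_degree q \<and> col_degree q \<le> Suc D" if "q \<in> expansion_cols J a" for q
            using that degJ by (auto elim!: expansion_colsE intro: le_trans)
          have "{i \<in> J. Suc D \<le> a i} = {i \<in> J. a i = Suc D}" using degJ by (auto intro: le_antisym)
          then have "col_count (expansion_cols J a) col_degree (Suc D) = col_count J a (Suc D)"
            by (subst col_count_cols[OF finJ]) (simp_all add: col_count_def)
          then show "col_count (expansion_cols J a) col_degree (Suc D) \<le> n" using topJ[OF J] by simp
          show "col_count (expansion_cols J a) col_degree (Suc D - s) \<le> t * (t + Suc k) ^ s" if "s \<le> D" for s
          proof -
            have "col_count (expansion_cols J a) col_degree (Suc D - s) = card {i \<in> J. Suc D - s \<le> a i}"
              using that by (intro col_count_cols[OF finJ]) simp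
            also have "\<dots> \<le> t * (\<Sum>l\<le>s. (t + k) ^ l)" by (rule cJ[OF that])
            also have "\<dots> \<le> t * (t + Suc k) ^ s"
              using sum_power_le[where x = "t + k"] by (intro mult_left_mono) auto
            finally show ?thesis .
          qed
        qed
        then have "codim_le (n * C + phase_bound D (2 * t\<^sup>2) + card J) (admissible R a) (decomposable R a)" by (rule R'(2))
        moreover have "card J \<le> C"
        proof -
          have "J = {i \<in> J. Suc D - D \<le> a i}" using deg J by auto
          then have "card J = card {i \<in> J. Suc D - D \<le> a i}" by simp
          also have "\<dots> \<le> t * (\<Sum>l\<le>D. (t + k) ^ l)" by (rule cJ) simp
          also have "\<dots> \<le> t * (\<Sum>l\<le>D. (2 * t) ^ l)"
            using k by (intro mult_left_mono sum_mono power_mono) auto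
          also have "\<dots> = C" by (simp add: C_def sum_distrib_left)
          finally show ?thesis .
        qed
        ultimately show ?thesis using codim_le_mono[of _ "admissible R a" "decomposable R a"] by auto
      qed
    qed
  qed
  have "codim_le (t * C + phase_bound D (2 * t\<^sup>2)) (admissible R a) (decomposable R a)"
  proof (rule inner[where k = 0 and I = I])
    show "col_count I a (Suc D) \<le> t" using Suc.prems(4)[of 0] by simp
    show "col_count I a (Suc D - s) \<le> t * (t + 0) ^ s" if "s \<le> D" for s
      using Suc.prems(4)[of s] that by simp
  qed (use Suc.prems in auto)
  then show ?case by (simp add: C_def)
qed

text \<open>In the application the columns of degree \<open>j - s\<close> are the monomials of degree \<open>s\<close> in \<open>h\<close> variables, and the
constant monomial, being the only column of degree \<open>j\<close>, is the dependent column of the first expansion.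
Columns of degree 0 are present only in this step; afterwards all degrees lie between 1 and \<open>j - 1\<close>.\<close>

lemma codim_first_expansion:
  fixes I :: "'x col set" and R :: "('x col \<Rightarrow> 'k::field mpoly) set"
  assumes inf: "infinite (UNIV :: 'k set)" and fin: "finite I" and sat: "saturated UNIV I R"
    and j0: "j0 \<in> I" "unitv j0 \<notin> R" and less: "\<And>i. i \<in> I - {j0} \<Longrightarrow> a i < j"
    and c: "\<And>s. 1 \<le> s \<Longrightarrow> s \<le> j \<Longrightarrow> col_count (I - {j0}) a (j - s) \<le> h ^ s"
  shows "codim_le ((\<Sum>s=1..j. h ^ s) + phase_bound (j - 1) (h + 1)) (admissible R a) (decomposable R a)"
proof -
  obtain J and R' :: "('x col \<Rightarrow> 'k mpoly) set" where J: "J \<subseteq> I - {j0}"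
    and R': "saturated UNIV (expansion_cols J a) R'"
      "\<And>c. codim_le c (admissible R' col_degree) (decomposable R' col_degree) \<Longrightarrow> codim_le (c + card J) (admissible R a) (decomposable R a)"
    using expand_at_general_point[OF inf fin sat j0] by metis
  have finJ: "finite J" using J fin by (meson finite_Diff finite_subset)
  have cJ: "card {i \<in> J. j - s \<le> a i} \<le> (\<Sum>l=1..s. h ^ l)" if "s \<le> j" for s
  proof -
    have "card {i \<in> J. j - s \<le> a i} = (\<Sum>l\<le>s. col_count J a (j - l))"
      using less J that by (intro card_col_count[OF finJ]) (auto intro: less_imp_le)
    also have "\<dots> = (\<Sum>l=1..s. col_count J a (j - l))"
    proof -
      have "a i \<noteq> j" if "i \<in> J" for i using less[of i] J that by auto
      then have "{i \<in> J. a i = j} = {}" by blast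
      then have "col_count J a j = 0" by (simp only: col_count_def card.empty)
      then show ?thesis unfolding One_nat_def sum.atLeast1_atMost_eq sum.atMost_shift by simp
    qed
    also have "\<dots> \<le> (\<Sum>l=1..s. h ^ l)"
    proof (rule sum_mono)
      fix l assume "l \<in> {1..s}"
      then have "col_count (I - {j0}) a (j - l) \<le> h ^ l" using c that by auto
      moreover have "col_count J a (j - l) \<le> col_count (I - {j0}) a (j - l)" using J fin by (intro col_count_mono) auto
      ultimately show "col_count J a (j - l) \<le> h ^ l" by simp
    qed
    finally show ?thesis .
  qed
  have geo: "(\<Sum>l=1..s. h ^ l) \<le> (h + 1) ^ s" for s
  proof -
    have "(\<Sum>l=1..s. h ^ l) \<le> (\<Sum>l\<le>s. h ^ l)" by (rule sum_mono2) auto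
    then show ?thesis using sum_power_le[of h s] by simp
  qed
  have "codim_le (phase_bound (j - 1) (h + 1)) (admissible R' col_degree) (decomposable R' col_degree)"
  proof (rule codim_phases[OF inf finite_expansion_cols[OF finJ] R'(1)])
    show "1 \<le> col_degree q \<and> col_degree q \<le> j - 1" if "q \<in> expansion_cols J a" for q
      using that less J by (fastforce elim!: expansion_colsE)
    show "col_count (expansion_cols J a) col_degree (j - 1 - s) \<le> (h + 1) * (h + 1) ^ s" if "s < j - 1" for s
    proof -
      have "col_count (expansion_cols J a) col_degree (j - 1 - s) = card {i \<in> J. j - 1 - s \<le> a i}"
        using that by (intro col_count_cols[OF finJ]) simp
      also have "\<dots> \<le> (\<Sum>l=1..Suc s. h ^ l)" using cJ[of "Suc s"] that by simp
      also have "\<dots> \<le> (h + 1) ^ Suc s" by (rule geo)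
      finally show ?thesis by simp
    qed
  qed
  then have "codim_le (phase_bound (j - 1) (h + 1) + card J) (admissible R a) (decomposable R a)" by (rule R'(2))
  moreover have "card J \<le> (\<Sum>l=1..j. h ^ l)" using cJ[of j] by simp
  ultimately show ?thesis using codim_le_mono[of _ "admissible R a" "decomposable R a"] by auto
qed

section \<open>Polynomials as polynomials in some of their variables\<close>

text \<open>The polynomial \<open>f\<close> as a polynomial in the variables of \<open>Z\<close> with coefficients in the polynomial ring in the
other variables.\<close>

definition split_vars :: "nat set \<Rightarrow> 'k::field mpoly \<Rightarrow> (nat \<Rightarrow>\<^sub>0 nat) \<Rightarrow>\<^sub>0 'k mpoly" where
  "split_vars Z = monomial_sum (\<lambda>m c. single (restrict_mono Z m) (single (restrict_mono (- Z) m) c))"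

lemma split_vars_0 [simp]: "split_vars Z 0 = 0" by (simp add: split_vars_def)
lemma split_vars_add: "split_vars Z (f + g) = split_vars Z f + split_vars Z g"
  unfolding split_vars_def by (rule monomial_sum_add) (auto simp: single_add)
lemma split_vars_single: "split_vars Z (single m c) = single (restrict_mono Z m) (single (restrict_mono (- Z) m) c)"
  unfolding split_vars_def by (rule monomial_sum_single) auto
lemma split_vars_mult: "split_vars Z (f * g) = split_vars Z f * split_vars Z g"
  unfolding split_vars_def by (rule monomial_sum_mult) (auto simp: single_add mult_single restrict_mono_add)
lemma split_vars_sum: "split_vars Z (sum f A) = (\<Sum>x\<in>A. split_vars Z (f x))"
  by (rule additive_sum) (auto simp: split_vars_add)

lemma split_vars_free:
  assumes "f \<in> vars_in V" "V \<inter> Z = {}"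
  shows "split_vars Z f = single 0 f"
proof (induction f rule: poly_mapping_induct_single)
  case (single m c)
  then have "keys m \<subseteq> V" using assms(1) by (auto simp: vars_in_def)
  then have "keys m \<inter> Z = {}" "keys m \<subseteq> - Z" using assms(2) by auto
  then show ?case by (simp add: split_vars_single restrict_mono_id restrict_mono_0)
qed (auto simp: split_vars_add single_add)

lemma split_vars_coeff_vars: "f \<in> vars_in V \<Longrightarrow> lookup (split_vars Z f) \<mu> \<in> vars_in (V - Z)"
  unfolding split_vars_def monomial_sum_def lookup_sum
  by (intro vars_in_sum) (auto simp: lookup_single when_def vars_in_def keys_restrict_mono)

lemma split_vars_keys:
  assumes "f \<in> vars_in V" "\<mu> \<in> keys (split_vars Z f)"
  shows "keys \<mu> \<subseteq> V \<inter> Z"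
proof -
  obtain m where "m \<in> keys f" "\<mu> \<in> keys (single (restrict_mono Z m) (single (restrict_mono (- Z) m) (lookup f m)))"
    using assms(2) keys_sum[of "\<lambda>m. single (restrict_mono Z m) (single (restrict_mono (- Z) m) (lookup f m))"]
    unfolding split_vars_def monomial_sum_def by blast
  then have "m \<in> keys f" "\<mu> = restrict_mono Z m" by (auto split: if_splits)
  then show ?thesis using assms(1) by (auto simp: vars_in_def keys_restrict_mono)
qed

lemma split_vars_reconstruct:
  "f = (\<Sum>\<mu>\<in>keys (split_vars Z f). single \<mu> 1 * lookup (split_vars Z f) \<mu>)"
proof -
  define un :: "_ \<Rightarrow> 'a mpoly" where "un = monomial_sum (\<lambda>\<mu> g. single \<mu> 1 * g)"
  have un_add: "un (F + G) = un F + un G" for F G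
    unfolding un_def by (rule monomial_sum_add) (auto simp: distrib_left)
  have un_single: "un (single \<mu> g) = single \<mu> 1 * g" for \<mu> g
    unfolding un_def by (rule monomial_sum_single) auto
  have "un (split_vars Z f) = f"
  proof (induction f rule: poly_mapping_induct_single)
    case zero then show ?case by (simp add: un_def)
  next
    case (single m c) then show ?case by (simp add: split_vars_single un_single mult_single restrict_mono_split)
  qed (simp add: split_vars_add un_add)
  then show ?thesis by (simp add: un_def monomial_sum_def)
qed

lemma split_vars_inj: "split_vars Z f = 0 \<longleftrightarrow> f = 0"
  using split_vars_reconstruct[of f Z] by auto

section \<open>Prime ideals and height\<close>

text \<open>A prime ideal of \<open>k[V]\<close>, in terms of the operations of the type of all polynomials.\<close>

definition prime_in :: "nat set \<Rightarrow> 'k::field mpoly set \<Rightarrow> bool" where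
  "prime_in V P \<longleftrightarrow> P \<subseteq> vars_in V \<and> 0 \<in> P \<and> (\<forall>f\<in>P. \<forall>g\<in>P. f + g \<in> P) \<and>
     (\<forall>f\<in>P. \<forall>c\<in>vars_in V. c * f \<in> P) \<and> 1 \<notin> P \<and>
     (\<forall>f\<in>vars_in V. \<forall>g\<in>vars_in V. f * g \<in> P \<longrightarrow> f \<in> P \<or> g \<in> P)"

lemma prime_inD:
  assumes "prime_in V P"
  shows "f \<in> P \<Longrightarrow> f \<in> vars_in V" "0 \<in> P" "f \<in> P \<Longrightarrow> g \<in> P \<Longrightarrow> f + g \<in> P"
    "f \<in> P \<Longrightarrow> c \<in> vars_in V \<Longrightarrow> c * f \<in> P" "1 \<notin> P"
    "f \<in> vars_in V \<Longrightarrow> g \<in> vars_in V \<Longrightarrow> f * g \<in> P \<Longrightarrow> f \<in> P \<or> g \<in> P"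
  using assms unfolding prime_in_def by auto

lemma prime_in_diff:
  assumes P: "prime_in V P" and "f \<in> P" "g \<in> P"
  shows "f - g \<in> P"
proof -
  have "(-1) * g \<in> P" using assms(3) by (intro prime_inD(4)[OF P]) (auto intro: vars_in_uminus)
  then show ?thesis using prime_inD(3)[OF P assms(2)] by force
qed

lemma prime_in_sum: "prime_in V P \<Longrightarrow> (\<And>x. x \<in> A \<Longrightarrow> f x \<in> P) \<Longrightarrow> sum f A \<in> P"
  by (induction A rule: infinite_finite_induct) (auto intro: prime_inD)

lemma mpoly_ring_simps [simp]:
  "carrier (mpoly_ring n) = vars_in {..<n}" "f \<otimes>\<^bsub>mpoly_ring n\<^esub> g = f * g" "f \<oplus>\<^bsub>mpoly_ring n\<^esub> g = f + g"
  "\<zero>\<^bsub>mpoly_ring n\<^esub> = 0" "\<one>\<^bsub>mpoly_ring n\<^esub> = 1"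
  by (simp_all add: mpoly_ring_def vars_in_def)

lemma cring_mpoly_ring: "cring (mpoly_ring n :: 'k::field mpoly ring)"
proof (intro cringI abelian_groupI comm_monoidI)
  fix x :: "'k mpoly" assume "x \<in> carrier (mpoly_ring n)"
  then show "\<exists>y\<in>carrier (mpoly_ring n). y \<oplus>\<^bsub>mpoly_ring n\<^esub> x = \<zero>\<^bsub>mpoly_ring n\<^esub>"
    by (intro bexI[of _ "- x"]) (auto intro: vars_in_uminus)
qed (auto simp: vars_in_add vars_in_mult algebra_simps)

lemma prime_in_primeideal:
  assumes "primeideal P (mpoly_ring n)"
  shows "prime_in {..<n} P"
proof -
  interpret primeideal P "mpoly_ring n :: 'a mpoly ring" by (rule assms)
  have "1 \<notin> P"
    using I_notcarr one_imp_carrier by auto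
  then show ?thesis
    unfolding prime_in_def
    using a_subset additive_subgroup.zero_closed[OF is_additive_subgroup]
      additive_subgroup.a_closed[OF is_additive_subgroup] I_l_closed I_prime by auto
qed

lemma mpoly_ring_a_inv:
  fixes f :: "'k::field mpoly"
  assumes "f \<in> vars_in {..<n}"
  shows "\<ominus>\<^bsub>mpoly_ring n\<^esub> f = - f"
proof -
  interpret cring "mpoly_ring n :: 'k mpoly ring" by (rule cring_mpoly_ring)
  have "\<ominus>\<^bsub>mpoly_ring n\<^esub> f \<oplus>\<^bsub>mpoly_ring n\<^esub> f = \<zero>\<^bsub>mpoly_ring n\<^esub>"
    using assms by (intro l_neg) simp
  then show ?thesis by (simp add: eq_neg_iff_add_eq_0)
qed

lemma ideal_mpoly_ringI:
  fixes J :: "'k::field mpoly set"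
  assumes "J \<subseteq> vars_in {..<n}" "0 \<in> J" "\<And>f g. f \<in> J \<Longrightarrow> g \<in> J \<Longrightarrow> f + g \<in> J"
    "\<And>c f. c \<in> vars_in {..<n} \<Longrightarrow> f \<in> J \<Longrightarrow> c * f \<in> J"
  shows "ideal J (mpoly_ring n)"
proof -
  interpret cring "mpoly_ring n :: 'k mpoly ring" by (rule cring_mpoly_ring)
  show ?thesis
  proof (rule idealI)
    show "subgroup J (add_monoid (mpoly_ring n))"
    proof (rule add.subgroupI)
      show "J \<subseteq> carrier (mpoly_ring n)" using assms(1) by simp
      show "J \<noteq> {}" using assms(2) by auto
      show "\<ominus>\<^bsub>mpoly_ring n\<^esub> f \<in> J" if "f \<in> J" for f
      proof -
        have "(-1) * f \<in> J" by (intro assms(4) that vars_in_uminus vars_in_1)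
        then show ?thesis using mpoly_ring_a_inv[of f n] assms(1) that by auto
      qed
      show "f \<oplus>\<^bsub>mpoly_ring n\<^esub> g \<in> J" if "f \<in> J" "g \<in> J" for f g using assms(3) that by simp
    qed
    show "f \<otimes>\<^bsub>mpoly_ring n\<^esub> c \<in> J" if "f \<in> J" "c \<in> carrier (mpoly_ring n)" for f c
      using assms(4)[of c f] that by (simp add: mult.commute)
  qed (use assms(4) in \<open>auto simp: ring_axioms\<close>)
qed

lemma primeideal_prime_in:
  assumes "prime_in {..<n} P"
  shows "primeideal P (mpoly_ring n)"
proof (rule primeidealI)
  note D = prime_inD[OF assms]
  show "cring (mpoly_ring n :: 'a mpoly ring)" by (rule cring_mpoly_ring)
  show "ideal P (mpoly_ring n)" by (rule ideal_mpoly_ringI) (use D(1-4) in auto)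
  show "carrier (mpoly_ring n) \<noteq> P" using D(5) by auto
  show "a \<in> P \<or> b \<in> P" if "a \<in> carrier (mpoly_ring n)" "b \<in> carrier (mpoly_ring n)" "a \<otimes>\<^bsub>mpoly_ring n\<^esub> b \<in> P" for a b
    using D(6)[of a b] that by simp
qed

lemma lookup_mult_sum:
  "lookup (F * G) k =
     (\<Sum>(a, b)\<in>keys F \<times> keys G.
        if a + b = k then lookup F a * lookup G b else 0)"
proof -
  have "F * G = (\<Sum>a\<in>keys F. \<Sum>b\<in>keys G.
      single (a + b) (lookup F a * lookup G b))"
    by (subst poly_mapping_expand[of F], subst poly_mapping_expand[of G])
      (simp add: sum_distrib_left sum_distrib_right mult_single sum.swap[of _ "keys G"])
  then have "lookup (F * G) k = (\<Sum>a\<in>keys F. \<Sum>b\<in>keys G.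
      if a + b = k then lookup F a * lookup G b else 0)"
    by (simp add: lookup_sum lookup_single when_def)
  then show ?thesis by (simp add: sum.cartesian_product)
qed

text \<open>The extension of a prime ideal to a polynomial ring is prime: the product of the coefficients at the
largest monomials of \<open>F\<close> and \<open>G\<close> whose coefficients lie outside of \<open>P\<close> is, modulo \<open>P\<close>, a coefficient of
\<open>F * G\<close>.\<close>

lemma prime_coeffs:
  fixes F G :: "'a::{ordered_cancel_comm_monoid_add, linorder} \<Rightarrow>\<^sub>0 'k::field mpoly"
  assumes P: "prime_in V P"
    and F: "\<And>\<mu>. lookup F \<mu> \<in> vars_in V" and G: "\<And>\<mu>. lookup G \<mu> \<in> vars_in V"
    and FG: "\<And>\<mu>. lookup (F * G) \<mu> \<in> P"
  shows "(\<forall>\<mu>. lookup F \<mu> \<in> P) \<or> (\<forall>\<mu>. lookup G \<mu> \<in> P)"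
proof (rule ccontr)
  assume neg: "\<not> ?thesis"
  define A where "A = {a. lookup F a \<notin> P}"
  define B where "B = {b. lookup G b \<notin> P}"
  have AB: "A \<noteq> {}" "B \<noteq> {}" using neg by (auto simp: A_def B_def)
  have "A \<subseteq> keys F" "B \<subseteq> keys G"
    using prime_inD(2)[OF P] by (auto simp: A_def B_def in_keys_iff)
  then have fin: "finite A" "finite B" by (auto intro: finite_subset)
  define a0 where "a0 = Max A"
  define b0 where "b0 = Max B"
  have a0: "a0 \<in> A" and b0: "b0 \<in> B" unfolding a0_def b0_def using AB fin by auto
  have ab: "(a0, b0) \<in> keys F \<times> keys G"
    using a0 b0 \<open>A \<subseteq> _\<close> \<open>B \<subseteq> _\<close> by auto
  define t where "t = (\<lambda>(a, b). if a + b = a0 + b0 then lookup F a * lookup G b else 0)"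
  let ?K = "keys F \<times> keys G"
  have "sum t ?K = t (a0, b0) + sum t (?K - {(a0, b0)})"
    using ab by (intro sum.remove) auto
  moreover have "sum t ?K \<in> P" using FG[of "a0 + b0"] unfolding lookup_mult_sum t_def by simp
  moreover have "sum t (?K - {(a0, b0)}) \<in> P"
  proof (rule prime_in_sum[OF P])
    fix x assume x: "x \<in> ?K - {(a0, b0)}"
    obtain a b where [simp]: "x = (a, b)" by force
    show "t x \<in> P"
    proof (cases "a + b = a0 + b0")
      case True
      have "a \<notin> A \<or> b \<notin> B"
      proof (rule ccontr)
        assume "\<not> ?thesis"
        then have le: "a \<le> a0" "b \<le> b0" using fin by (auto simp: a0_def b0_def)
        have "a = a0"
        proof (rule ccontr)
          assume "a \<noteq> a0"
          then have "a + b < a0 + b0" using le by (intro add_less_le_mono) auto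
          then show False using True by simp
        qed
        then show False using True x by simp
      qed
      moreover have "lookup G b * lookup F a \<in> P" if "a \<notin> A"
        using that prime_inD(4)[OF P _ G] by (simp add: A_def)
      moreover have "lookup F a * lookup G b \<in> P" if "b \<notin> B"
        using that prime_inD(4)[OF P _ F] by (simp add: B_def)
      ultimately show ?thesis using True by (auto simp: t_def mult.commute)
    qed (simp add: t_def prime_inD(2)[OF P])
  qed
  ultimately have "t (a0, b0) \<in> P"
    using prime_in_diff[OF P, of "sum t ?K" "sum t (?K - {(a0, b0)})"] by simp
  then show False using prime_inD(6)[OF P F G, of a0 b0] a0 b0 by (auto simp: t_def A_def B_def)
qed

text \<open>The ideal generated by \<open>P \<inter> k[V - Z]\<close>: the polynomials whose coefficients with respect to the variables
\<open>Z\<close> lie in \<open>P\<close>.\<close>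

definition coeff_ideal :: "nat set \<Rightarrow> nat set \<Rightarrow> 'k::field mpoly set \<Rightarrow> 'k mpoly set" where
  "coeff_ideal V Z P = {f \<in> vars_in V. \<forall>\<mu>. lookup (split_vars Z f) \<mu> \<in> P}"

lemma coeff_ideal_prime:
  assumes P: "prime_in V P"
  shows "prime_in V (coeff_ideal V Z P)"
proof -
  have cV: "lookup (split_vars Z f) \<mu> \<in> vars_in V" if "f \<in> vars_in V" for f :: "'a mpoly" and \<mu>
    using split_vars_coeff_vars[OF that, of Z \<mu>] vars_in_mono[of "V - Z" V] by auto
  have one: "split_vars Z (1 :: 'a mpoly) = 1"
    using split_vars_single[of Z 0 "1::'a"] by (simp add: restrict_mono_0)
  have mult: "c * f \<in> coeff_ideal V Z P" if "f \<in> coeff_ideal V Z P" "c \<in> vars_in V" for c f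
  proof -
    have "lookup (split_vars Z c) a * lookup (split_vars Z f) b \<in> P" for a b
      using that cV by (intro prime_inD(4)[OF P]) (simp_all add: coeff_ideal_def)
    then have "lookup (split_vars Z c * split_vars Z f) \<mu> \<in> P" for \<mu>
      unfolding lookup_mult_sum using prime_inD(2)[OF P] by (intro prime_in_sum[OF P]) (simp split: prod.split)
    then show ?thesis using that by (auto simp: coeff_ideal_def split_vars_mult vars_in_mult)
  qed
  have pr: "f \<in> coeff_ideal V Z P \<or> g \<in> coeff_ideal V Z P"
    if "f \<in> vars_in V" "g \<in> vars_in V" "f * g \<in> coeff_ideal V Z P" for f g
    using prime_coeffs[OF P, of "split_vars Z f" "split_vars Z g"] that cV
    by (auto simp: coeff_ideal_def split_vars_mult)
  have "1 \<notin> coeff_ideal V Z P"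
    using prime_inD(5)[OF P] by (auto simp: coeff_ideal_def one intro!: exI[of _ 0])
  then show ?thesis
    unfolding prime_in_def using mult pr prime_inD(2,3)[OF P]
    by (auto simp: coeff_ideal_def split_vars_add lookup_add vars_in_add)
qed

text \<open>A polynomial is the combination of its coefficients with respect to \<open>Z\<close> with the monomials in \<open>Z\<close>; the
coefficients involve no variable of \<open>Z\<close>, so that only the monomials change when \<open>Z\<close> shrinks.\<close>

lemma coeff_ideal_mono:
  assumes P: "prime_in V P" and Z: "Z' \<subseteq> Z"
  shows "coeff_ideal V Z P \<subseteq> coeff_ideal V Z' P"
proof
  fix f assume f: "f \<in> coeff_ideal V Z P"
  let ?K = "keys (split_vars Z f)" and ?c = "lookup (split_vars Z f)"
  have fV: "f \<in> vars_in V" and cP: "\<And>\<mu>. ?c \<mu> \<in> P" using f by (auto simp: coeff_ideal_def)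
  have free: "split_vars Z' (?c \<mu>) = single 0 (?c \<mu>)" for \<mu>
    by (rule split_vars_free[OF split_vars_coeff_vars[OF fV]]) (use Z in auto)
  have "split_vars Z' f = (\<Sum>\<mu>\<in>?K. split_vars Z' (single \<mu> 1 * ?c \<mu>))"
    by (subst split_vars_reconstruct[of f Z]) (rule split_vars_sum)
  also have "\<dots> = (\<Sum>\<mu>\<in>?K. single (restrict_mono Z' \<mu>) (single (restrict_mono (- Z') \<mu>) 1 * ?c \<mu>))"
    by (simp add: split_vars_mult split_vars_single free mult_single)
  finally have eq: "split_vars Z' f = \<dots>" .
  have "lookup (split_vars Z' f) \<nu> \<in> P" for \<nu>
    unfolding eq lookup_sum
  proof (rule prime_in_sum[OF P])
    fix \<mu> assume "\<mu> \<in> ?K"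
    then have "keys \<mu> \<subseteq> V" using split_vars_keys[OF fV] by blast
    then have "single (restrict_mono (- Z') \<mu>) 1 \<in> vars_in V" by (auto simp: vars_in_single keys_restrict_mono)
    then have "single (restrict_mono (- Z') \<mu>) 1 * ?c \<mu> \<in> P" using prime_inD(4)[OF P cP] by blast
    then show "lookup (single (restrict_mono Z' \<mu>) (single (restrict_mono (- Z') \<mu>) 1 * ?c \<mu>)) \<nu> \<in> P"
      using prime_inD(2)[OF P] by (simp add: lookup_single when_def)
  qed
  then show "f \<in> coeff_ideal V Z' P" using fV by (simp add: coeff_ideal_def)
qed

text \<open>Let \<open>Y\<close> be a maximal set of variables that are algebraically independent modulo \<open>P\<close>, and let \<open>Z\<close> run through
a decreasing chain from the set of the other variables to the empty set.  The ideals generated by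
\<open>P \<inter> k[V - Z]\<close> form a chain of primes from \<open>0\<close> to \<open>P\<close>.  It is strict because, by maximality of \<open>Y\<close>, every
other variable \<open>x\<close> admits a nonzero \<open>f \<in> P\<close> in \<open>Y\<close> and \<open>x\<close> only: its coefficients with respect to \<open>x\<close> are
polynomials in \<open>Y\<close>, so they do not all lie in \<open>P\<close>.  The length of the chain bounds the number of other variables
by the height.\<close>

lemma independent_variables:
  fixes P :: "'k::field mpoly set"
  assumes P: "primeideal P (mpoly_ring n)" and h: "prime_height (mpoly_ring n) P = enat h"
  obtains Y where "Y \<subseteq> {..<n}" "\<And>f. f \<in> P \<Longrightarrow> f \<in> vars_in Y \<Longrightarrow> f = 0" "card ({..<n} - Y) \<le> h"
proof -
  note pr = prime_in_primeideal[OF P]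
  let ?V = "{..<n}"
  define ind where "ind Y \<longleftrightarrow> Y \<subseteq> ?V \<and> (\<forall>f\<in>P. f \<in> vars_in Y \<longrightarrow> f = 0)" for Y
  have "finite {Y. ind Y}" by (rule finite_subset[of _ "Pow ?V"]) (auto simp: ind_def)
  moreover have "ind {}"
  proof -
    have "f = 0" if f: "f \<in> P" "f \<in> vars_in {}" for f
    proof (rule ccontr)
      assume "f \<noteq> 0"
      have "homogeneous 0 f" using f(2) by (auto simp: vars_in_def homogeneous_def)
      then obtain c where c: "f = Const c" using homogeneous_0_Const by blast
      then have "c \<noteq> 0" using \<open>f \<noteq> 0\<close> by auto
      then have "Const (1 / c) * f = 1" using c by (simp flip: Const_mult)
      then show False using prime_inD(4,5)[OF pr] f(1) vars_in_Const by metis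
    qed
    then show ?thesis by (auto simp: ind_def)
  qed
  ultimately obtain Y where Y: "ind Y" and max: "\<And>Y'. ind Y' \<Longrightarrow> Y \<subseteq> Y' \<Longrightarrow> Y' = Y"
    using finite_has_maximal2[of "{Y. ind Y}" "{}"] by auto
  define X where "X = ?V - Y"
  have finX: "finite X" by (simp add: X_def)
  obtain g where g: "bij_betw g {..<card X} X"
    using ex_bij_betw_nat_finite[OF finX] by (auto simp: atLeast0LessThan)
  define Z where "Z i = g ` {i..<card X}" for i
  define Q where "Q i = coeff_ideal ?V (Z i) P" for i
  have ZX: "Z i \<subseteq> X" for i using g by (auto simp: Z_def bij_betw_def)
  have Zlast: "Z (card X) = {}" by (simp add: Z_def)
  have "split_vars {} f = single 0 f" for f :: "'k mpoly"
    by (rule split_vars_free[of _ UNIV]) auto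
  then have "f \<in> Q (card X) \<longleftrightarrow> f \<in> P" for f
    using prime_inD(1,2)[OF pr] by (auto simp: Q_def coeff_ideal_def Zlast lookup_single when_def)
  then have "Q (card X) = P" by blast
  moreover have "\<forall>i\<le>card X. primeideal (Q i) (mpoly_ring n)"
    using coeff_ideal_prime[OF pr] by (auto simp: Q_def intro: primeideal_prime_in)
  moreover have "\<forall>i<card X. Q i \<subset> Q (Suc i)"
  proof (intro allI impI)
    fix i assume i: "i < card X"
    have giX: "g i \<in> X" using g i by (auto simp: bij_betw_def)
    have sub: "Z (Suc i) \<subseteq> Z i" by (auto simp: Z_def)
    have gi: "g i \<in> Z i" "g i \<notin> Z (Suc i)"
    proof -
      show "g i \<in> Z i" using i by (simp add: Z_def)
      have inj: "inj_on g {..<card X}" using g by (simp add: bij_betw_def)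
      show "g i \<notin> Z (Suc i)" using inj_onD[OF inj, of i] i by (force simp: Z_def)
    qed
    have "\<not> ind (insert (g i) Y)" using max[of "insert (g i) Y"] giX by (auto simp: X_def)
    then obtain f where f: "f \<in> P" "f \<in> vars_in (insert (g i) Y)" "f \<noteq> 0"
      using Y giX by (auto simp: ind_def X_def)
    have fV: "f \<in> vars_in ?V" using prime_inD(1)[OF pr f(1)] .
    have "split_vars (Z (Suc i)) f = single 0 f"
      by (rule split_vars_free[OF f(2)]) (use gi ZX in \<open>auto simp: X_def\<close>)
    then have "f \<in> Q (Suc i)"
      using f(1) fV prime_inD(2)[OF pr] by (simp add: Q_def coeff_ideal_def lookup_single when_def)
    moreover have "f \<notin> Q i"
    proof
      assume "f \<in> Q i"
      then have cP: "lookup (split_vars (Z i) f) \<mu> \<in> P" for \<mu> by (simp add: Q_def coeff_ideal_def)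
      have "lookup (split_vars (Z i) f) \<mu> \<in> vars_in Y" for \<mu>
        using split_vars_coeff_vars[OF f(2), of "Z i" \<mu>] vars_in_mono[of "insert (g i) Y - Z i" Y] gi(1) by auto
      then have "lookup (split_vars (Z i) f) \<mu> = 0" for \<mu> using cP Y by (simp add: ind_def)
      then have "split_vars (Z i) f = 0" by (intro poly_mapping_eqI) simp
      then show False using f(3) by (simp add: split_vars_inj)
    qed
    ultimately show "Q i \<subset> Q (Suc i)" using coeff_ideal_mono[OF pr sub] by (auto simp: Q_def)
  qed
  ultimately have "enat (card X) \<le> prime_height (mpoly_ring n) P"
    unfolding prime_height_def by (intro Sup_upper) blast
  then show thesis using that[of Y] Y h by (auto simp: ind_def X_def)
qed

section \<open>Extension of scalars\<close>

text \<open>General points exist over infinite fields only.  The rational functions over \<open>k\<close> are an infinite extension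
of \<open>k\<close>.\<close>

definition const_fract :: "'k::field \<Rightarrow> 'k poly fract" where "const_fract c = Fract [:c:] 1"

lemma const_fract_simps: "const_fract 0 = 0" "const_fract 1 = 1" "const_fract (a + b) = const_fract a + const_fract b" "const_fract (a * b) = const_fract a * const_fract b"
  by (simp_all add: const_fract_def Zero_fract_def One_fract_def one_pCons mult.commute)

lemma infinite_poly_fract: "infinite (UNIV :: 'k::field poly fract set)"
proof
  assume fin: "finite (UNIV :: 'k poly fract set)"
  have "inj (\<lambda>n. Fract (Polynomial.monom (1::'k) n) 1)"
    by (rule injI) (simp add: eq_fract monom_eq_iff')
  then have "infinite (range (\<lambda>n. Fract (Polynomial.monom (1::'k) n) 1))" by (rule range_inj_infinite)
  then show False using finite_subset[OF subset_UNIV fin] by blast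
qed

text \<open>The linear forms on the rational functions over the field of constants.\<close>

definition lin_form :: "('k::field poly fract \<Rightarrow> 'k) \<Rightarrow> bool" where
  "lin_form \<psi> \<longleftrightarrow> (\<forall>z w. \<psi> (z + w) = \<psi> z + \<psi> w) \<and> (\<forall>c z. \<psi> (const_fract c * z) = c * \<psi> z)"

lemma ex_lin_form:
  assumes "z \<noteq> 0"
  obtains \<psi> :: "'k::field poly fract \<Rightarrow> 'k" where "lin_form \<psi>" "\<psi> z = 1"
proof -
  interpret vector_space_pair "\<lambda>c z. const_fract c * z" "(*) :: 'k \<Rightarrow> 'k \<Rightarrow> 'k"
    by unfold_locales (simp_all add: const_fract_simps algebra_simps)
  have "vs1.independent {z}" using assms by simp
  then obtain g where g: "Vector_Spaces.linear (\<lambda>c z. const_fract c * z) (*) g" "\<forall>x\<in>{z}. g x = 1"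
    using linear_independent_extend[of "{z}" "\<lambda>_. 1"] by blast
  interpret g: Vector_Spaces.linear "\<lambda>c z. const_fract c * z" "(*) :: 'k \<Rightarrow> 'k \<Rightarrow> 'k" g by (rule g(1))
  show thesis using that[of g] g(2) g.add g.scale by (auto simp: lin_form_def)
qed

definition extend_scalars :: "'k::field mpoly \<Rightarrow> 'k poly fract mpoly" where
  "extend_scalars = monomial_sum (\<lambda>m c. single m (const_fract c))"

lemma extend_scalars_0 [simp]: "extend_scalars 0 = 0" by (simp add: extend_scalars_def)
lemma extend_scalars_add: "extend_scalars (f + g) = extend_scalars f + extend_scalars g"
  unfolding extend_scalars_def by (rule monomial_sum_add) (auto simp: const_fract_simps single_add)
lemma extend_scalars_mult: "extend_scalars (f * g) = extend_scalars f * extend_scalars g"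
  unfolding extend_scalars_def by (rule monomial_sum_mult) (auto simp: const_fract_simps single_add mult_single)
lemma extend_scalars_single: "extend_scalars (single m c) = single m (const_fract c)"
  unfolding extend_scalars_def by (rule monomial_sum_single) (auto simp: const_fract_simps)
lemma extend_scalars_sum: "extend_scalars (sum f A) = (\<Sum>x\<in>A. extend_scalars (f x))"
  by (rule additive_sum) (auto simp: extend_scalars_add)
lemma deg_le_extend_scalars: "deg_le d f \<Longrightarrow> deg_le d (extend_scalars f)"
  unfolding extend_scalars_def monomial_sum_def by (rule deg_le_sum) (auto simp: deg_le_def)

text \<open>A linear form on the extension field, applied to the coefficients, leads back to polynomials over \<open>k\<close>;
monomials with variables outside of \<open>Y\<close> are dropped.  The result is linear over \<open>k[Y]\<close>, which is why it
preserves the solutions of equations with coefficients in \<open>k[Y]\<close>.\<close>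

definition apply_form :: "('k::field poly fract \<Rightarrow> 'k) \<Rightarrow> nat set \<Rightarrow> 'k poly fract mpoly \<Rightarrow> 'k mpoly" where
  "apply_form \<psi> Y = monomial_sum (\<lambda>m z. if keys m \<subseteq> Y then single m (\<psi> z) else 0)"

context
  fixes \<psi> :: "'k::field poly fract \<Rightarrow> 'k" and Y :: "nat set"
  assumes \<psi>: "lin_form \<psi>"
begin

lemma lin_form_0: "\<psi> 0 = 0"
  using \<psi> by (auto simp: lin_form_def) (metis mult_zero_left const_fract_simps(1))

lemma apply_form_0 [simp]: "apply_form \<psi> Y 0 = 0" by (simp add: apply_form_def)
lemma apply_form_add: "apply_form \<psi> Y (f + g) = apply_form \<psi> Y f + apply_form \<psi> Y g"
  unfolding apply_form_def using \<psi> by (intro monomial_sum_add) (auto simp: lin_form_0 lin_form_def single_add)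
lemma apply_form_single: "apply_form \<psi> Y (single m z) = (if keys m \<subseteq> Y then single m (\<psi> z) else 0)"
  unfolding apply_form_def by (rule monomial_sum_single) (auto simp: lin_form_0)
lemma apply_form_sum: "apply_form \<psi> Y (sum f A) = (\<Sum>x\<in>A. apply_form \<psi> Y (f x))"
  by (rule additive_sum) (auto simp: apply_form_add)
lemma apply_form_vars: "apply_form \<psi> Y f \<in> vars_in Y"
  unfolding apply_form_def monomial_sum_def by (rule vars_in_sum) (auto simp: vars_in_single)
lemma deg_less_apply_form: "deg_less d f \<Longrightarrow> deg_less d (apply_form \<psi> Y f)"
  unfolding apply_form_def monomial_sum_def by (rule deg_less_sum) (auto simp: deg_less_def)

lemma apply_form_extend_mult:
  assumes "g \<in> vars_in Y"
  shows "apply_form \<psi> Y (extend_scalars g * f) = g * apply_form \<psi> Y f"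
proof (induction g rule: poly_mapping_induct_single)
  case (single m c)
  then have m: "keys m \<subseteq> Y" using assms by (auto simp: vars_in_def)
  show ?case
  proof (induction f rule: poly_mapping_induct_single)
    case (single m' z)
    then show ?case using m \<psi> by (auto simp: extend_scalars_single mult_single apply_form_single keys_add_nat lin_form_def)
  qed (auto simp: distrib_left apply_form_add)
qed (auto simp: extend_scalars_add distrib_right apply_form_add)

lemma apply_form_mult_extend: "g \<in> vars_in Y \<Longrightarrow> apply_form \<psi> Y (f * extend_scalars g) = apply_form \<psi> Y f * g"
  using apply_form_extend_mult[of g f] by (simp add: mult.commute[of f] mult.commute[of _ g])

lemma apply_form_Const_extend: "g \<in> vars_in Y \<Longrightarrow> apply_form \<psi> Y (Const z * extend_scalars g) = Const (\<psi> z) * g"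
  using apply_form_extend_mult[of g "Const z"] apply_form_single[of 0 z] by (simp add: mult.commute Const_def)

lemma apply_form_Var: "apply_form \<psi> Y (Var l * f) = (if l \<in> Y then Var l * apply_form \<psi> Y f else 0)"
proof (induction f rule: poly_mapping_induct_single)
  case (single m z)
  then show ?case by (auto simp: Var_def mult_single apply_form_single keys_add_nat)
qed (auto simp: distrib_left apply_form_add)

end

section \<open>Generators of a prime ideal\<close>

lemma card_monomials_le:
  assumes "finite X"
  shows "card {m. keys m \<subseteq> X \<and> monom_degree m = s} \<le> card X ^ s"
proof (induction s)
  case 0
  have "{m. keys m \<subseteq> X \<and> monom_degree m = 0} = {0}" by (auto simp: monom_degree_eq_0)
  then show ?case by simp
next
  case (Suc s)
  let ?M = "\<lambda>s. {m. keys m \<subseteq> X \<and> monom_degree m = s}"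
  have fin: "finite (?M s)" by (rule finite_subset[OF _ finite_monomials[OF assms, of s]]) auto
  have "?M (Suc s) \<subseteq> (\<lambda>(x, m). single x 1 + m) ` (X \<times> ?M s)"
  proof
    fix m assume m: "m \<in> ?M (Suc s)"
    then have "m \<noteq> 0" by auto
    then obtain x m' where x: "x \<in> keys m" and mm: "m = single x 1 + m'" by (rule monomial_factor)
    have "m' \<in> ?M s" using m by (simp add: mm keys_add_nat)
    moreover have "x \<in> X" using m x by auto
    ultimately show "m \<in> (\<lambda>(x, m). single x 1 + m) ` (X \<times> ?M s)" using mm by force
  qed
  then have "card (?M (Suc s)) \<le> card ((\<lambda>(x, m). single x 1 + m) ` (X \<times> ?M s))"
    using assms fin by (intro card_mono) auto
  also have "\<dots> \<le> card (X \<times> ?M s)" using assms fin by (intro card_image_le) auto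
  also have "\<dots> \<le> card X * card X ^ s" using Suc by (simp add: card_cartesian_product)
  finally show ?case by simp
qed

text \<open>The product of \<open>P\<close> with the ideal generated by the variables \<open>V\<close>.\<close>

definition max_ideal_times :: "nat set \<Rightarrow> 'k::field mpoly set \<Rightarrow> 'k mpoly set" where
  "max_ideal_times V P = {\<Sum>l\<in>V. Var l * g l | g. \<forall>l\<in>V. g l \<in> P}"

lemma max_ideal_times_add:
  assumes "prime_in V P" "f \<in> max_ideal_times V P" "g \<in> max_ideal_times V P"
  shows "f + g \<in> max_ideal_times V P"
proof -
  obtain f' g' where "f = (\<Sum>l\<in>V. Var l * f' l)" "\<forall>l\<in>V. f' l \<in> P" "g = (\<Sum>l\<in>V. Var l * g' l)" "\<forall>l\<in>V. g' l \<in> P"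
    using assms(2,3) by (auto simp: max_ideal_times_def)
  then show ?thesis unfolding max_ideal_times_def
    by (intro CollectI exI[of _ "\<lambda>l. f' l + g' l"]) (auto simp: distrib_left sum.distrib prime_inD(3)[OF assms(1)])
qed

lemma max_ideal_times_Var:
  assumes "prime_in V P" "finite V" "l \<in> V" "f \<in> P"
  shows "Var l * f \<in> max_ideal_times V P"
proof -
  have "(\<Sum>i\<in>V. Var i * (if i = l then f else 0)) = (\<Sum>i\<in>V. if i = l then Var l * f else 0)"
    by (rule sum.cong) auto
  also have "\<dots> = Var l * f" using assms(2,3) by simp
  finally show ?thesis unfolding max_ideal_times_def using assms(4) prime_inD(2)[OF assms(1)]
    by (intro CollectI exI[of _ "\<lambda>i. if i = l then f else 0"]) auto
qed

lemma max_ideal_times_0: "prime_in V P \<Longrightarrow> 0 \<in> max_ideal_times V P"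
  unfolding max_ideal_times_def by (intro CollectI exI[of _ "\<lambda>_. 0"]) (auto simp: prime_inD(2))

text \<open>At most \<open>c\<close> minimal generators of degree \<open>j\<close>, expressed by linear dependence as in \<open>codim_le\<close>.\<close>

definition gens_le :: "nat \<Rightarrow> nat set \<Rightarrow> 'k::field mpoly set \<Rightarrow> nat \<Rightarrow> bool" where
  "gens_le c V P j \<longleftrightarrow> (\<forall>(S::nat set) f. finite S \<longrightarrow> card S > c \<longrightarrow> (\<forall>x\<in>S. f x \<in> P \<and> homogeneous j (f x)) \<longrightarrow>
     (\<exists>lam. (\<exists>x\<in>S. lam x \<noteq> 0) \<and> (\<Sum>x\<in>S. Const (lam x) * f x) \<in> max_ideal_times V P))"

text \<open>Let \<open>X = V - Y\<close>.  A form \<open>f \<in> P\<close> of degree \<open>j\<close> is \<open>\<Sum>\<alpha>. x^\<alpha> w\<^sub>\<alpha>\<close> with monomials \<open>x^\<alpha>\<close> in \<open>X\<close> and \<open>w\<^sub>\<alpha> \<in> k[Y]\<close>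
of degree \<open>j - |\<alpha>|\<close>.  The vectors \<open>w\<close> with \<open>\<Sum>\<alpha>. x^\<alpha> w\<^sub>\<alpha> \<in> P\<close> form a saturated module, because \<open>P\<close> is prime
and contains no nonzero polynomial in \<open>Y\<close>.  Its equations define a module over the rational functions, to
which \<open>codim_first_expansion\<close> applies: the unit vector of \<open>\<alpha> = 0\<close> does not belong to it, as \<open>1 \<notin> P\<close>.  A
dependence modulo decomposable vectors over the extension field is brought back to \<open>k\<close> by a linear form that
does not vanish on one of its coefficients.  The component of degree \<open>j\<close> of the polynomial of a decomposable
vector is a combination of elements of \<open>P\<close> with variables as coefficients.\<close>

lemma gens_le_general:
  fixes P :: "'k::field mpoly set"
  assumes P: "prime_in V P" and V: "finite V" and hom: "\<And>f u. f \<in> P \<Longrightarrow> hcomp u f \<in> P"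
    and Y: "Y \<subseteq> V" "\<And>f. f \<in> P \<Longrightarrow> f \<in> vars_in Y \<Longrightarrow> f = 0" and j: "1 \<le> j"
  defines "h \<equiv> card (V - Y)"
  shows "gens_le ((\<Sum>s=1..j. h ^ s) + phase_bound (j - 1) (h + 1)) V P j"
proof -
  define X where "X = V - Y"
  have finX: "finite X" using V by (simp add: X_def)
  define A where "A = {\<alpha>. keys \<alpha> \<subseteq> X \<and> monom_degree \<alpha> \<le> j}"
  have finA: "finite A" unfolding A_def by (rule finite_monomials[OF finX])
  define I where "I = (\<lambda>\<alpha>. Col \<alpha> []) ` A"
  \<comment> \<open>The coefficient of \<open>x^\<alpha>\<close> in a form of degree \<open>j\<close> has degree \<open>j - |\<alpha>|\<close>.\<close>
  define a :: "(nat \<Rightarrow>\<^sub>0 nat) col \<Rightarrow> nat" where "a i = j - monom_degree (origin i)" for i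
  have finI: "finite I" using finA by (simp add: I_def)
  have YV: "vars_in Y \<subseteq> vars_in V" by (rule vars_in_mono[OF Y(1)])
  define \<Phi> :: "((nat \<Rightarrow>\<^sub>0 nat) col \<Rightarrow> 'k mpoly) \<Rightarrow> 'k mpoly"
    where "\<Phi> w = (\<Sum>\<alpha>\<in>A. single \<alpha> 1 * w (Col \<alpha> []))" for w
  have \<Phi>_add: "\<Phi> (\<lambda>i. v i + w i) = \<Phi> v + \<Phi> w" for v w by (simp add: \<Phi>_def distrib_left sum.distrib)
  have \<Phi>_mult: "\<Phi> (\<lambda>i. c * w i) = c * \<Phi> w" for c w by (simp add: \<Phi>_def sum_distrib_left mult.left_commute)
  have \<Phi>_V: "\<Phi> w \<in> vars_in V" if "\<And>i. w i \<in> vars_in Y" for w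
    unfolding \<Phi>_def using that YV
    by (intro vars_in_sum vars_in_mult) (auto simp: vars_in_single A_def X_def)
  define R where "R = {w. (\<forall>i. w i \<in> vars_in Y \<and> (i \<notin> I \<longrightarrow> w i = 0)) \<and> \<Phi> w \<in> P}"
  have RI: "w \<in> R" if "\<And>i. w i \<in> vars_in Y" "\<And>i. i \<notin> I \<Longrightarrow> w i = 0" "\<Phi> w \<in> P" for w
    using that by (simp add: R_def)
  have satR: "saturated Y I R"
    unfolding saturated_def
  proof (intro conjI ballI allI impI)
    fix w i assume "w \<in> R" then show "w i \<in> vars_in Y" "i \<notin> I \<Longrightarrow> w i = 0" by (auto simp: R_def)
  next
    show "(\<lambda>_. 0) \<in> R" by (rule RI) (auto simp: \<Phi>_def prime_inD(2)[OF P])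
  next
    fix v w assume "v \<in> R" "w \<in> R"
    then show "(\<lambda>i. v i + w i) \<in> R"
      by (intro RI) (auto simp: R_def \<Phi>_add vars_in_add prime_inD(3)[OF P])
  next
    fix c :: "'k mpoly" and w assume "c \<in> vars_in Y" "w \<in> R"
    then show "(\<lambda>i. c * w i) \<in> R"
      using YV by (intro RI) (auto simp: R_def \<Phi>_mult vars_in_mult prime_inD(4)[OF P])
  next
    fix c :: "'k mpoly" and w assume c: "c \<in> vars_in Y" "c \<noteq> 0" and w: "\<forall>i. w i \<in> vars_in Y \<and> (i \<notin> I \<longrightarrow> w i = 0)"
      and cw: "(\<lambda>i. c * w i) \<in> R"
    have "c * \<Phi> w \<in> P" using cw by (simp add: R_def \<Phi>_mult)
    moreover have "c \<in> vars_in V" "\<Phi> w \<in> vars_in V" using c YV \<Phi>_V w by auto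
    ultimately have "c \<in> P \<or> \<Phi> w \<in> P" using prime_inD(6)[OF P] by blast
    then show "w \<in> R" using Y(2) c w by (auto simp: R_def)
  qed
  obtain N \<delta> \<beta> where N: "N \<subseteq> I" "\<delta> \<noteq> 0" "\<delta> \<in> vars_in Y" "\<And>i k. \<beta> i k \<in> vars_in Y"
    and eq: "\<And>w. (\<And>i. w i \<in> vars_in Y) \<Longrightarrow> (\<And>i. i \<notin> I \<Longrightarrow> w i = 0) \<Longrightarrow>
        w \<in> R \<longleftrightarrow> (\<forall>k\<in>N. \<delta> * w k = (\<Sum>i\<in>I - N. w i * \<beta> i k))"
    by (rule pivot_description[OF satR finI, of "{}"]) auto
  \<comment> \<open>\<open>RK\<close> is a module over all variables; those outside of \<open>Y\<close> are removed by \<open>apply_form\<close> later.\<close>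
  define RK where "RK = solution_module I N (extend_scalars \<delta>) (\<lambda>i k. extend_scalars (\<beta> i k))"
  have satRK: "saturated UNIV I RK" unfolding RK_def by (rule saturated_solution_module)
  have extend_scalars_R: "(\<lambda>i. extend_scalars (w i)) \<in> RK" if "w \<in> R" for w
    unfolding RK_def
  proof (rule solution_moduleI)
    show "extend_scalars (w i) = 0" if "i \<notin> I" for i using \<open>w \<in> R\<close> that by (simp add: R_def)
    fix k assume "k \<in> N"
    then have "\<delta> * w k = (\<Sum>i\<in>I - N. w i * \<beta> i k)" using eq[of w] that by (auto simp: R_def)
    then show "extend_scalars \<delta> * extend_scalars (w k) = (\<Sum>i\<in>I - N. extend_scalars (w i) * extend_scalars (\<beta> i k))"
      by (simp add: extend_scalars_sum flip: extend_scalars_mult)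
  qed
  have apply_form_R: "(\<lambda>i. apply_form \<psi> Y (w i)) \<in> R" if \<psi>: "lin_form \<psi>" and w: "w \<in> RK" for \<psi> w
  proof -
    have "\<delta> * apply_form \<psi> Y (w k) = (\<Sum>i\<in>I - N. apply_form \<psi> Y (w i) * \<beta> i k)" if "k \<in> N" for k
    proof -
      have "\<delta> * apply_form \<psi> Y (w k) = apply_form \<psi> Y (extend_scalars \<delta> * w k)" by (simp add: apply_form_extend_mult[OF \<psi> N(3)])
      also have "\<dots> = apply_form \<psi> Y (\<Sum>i\<in>I - N. w i * extend_scalars (\<beta> i k))"
        using solution_moduleD(2)[OF w[unfolded RK_def] that] by simp
      also have "\<dots> = (\<Sum>i\<in>I - N. apply_form \<psi> Y (w i) * \<beta> i k)"
        by (simp add: apply_form_sum[OF \<psi>] apply_form_mult_extend[OF \<psi> N(4)])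
      finally show ?thesis .
    qed
    then show ?thesis
      using eq[of "\<lambda>i. apply_form \<psi> Y (w i)"] apply_form_vars[OF \<psi>] solution_moduleD(1)[OF w[unfolded RK_def]]
      by (auto simp: apply_form_0[OF \<psi>])
  qed
  have zeroA: "0 \<in> A" by (simp add: A_def)
  have unit: "unitv (Col 0 []) \<notin> RK"
  proof
    assume u: "unitv (Col 0 []) \<in> RK"
    obtain \<psi> :: "'k poly fract \<Rightarrow> 'k" where \<psi>: "lin_form \<psi>" "\<psi> 1 = 1" using ex_lin_form[of 1] by auto
    have "apply_form \<psi> Y 1 = 1" using apply_form_single[OF \<psi>(1), of Y 0 1] \<psi>(2) by simp
    then have unit_eq: "unitv (Col 0 []) = (\<lambda>i. apply_form \<psi> Y (unitv (Col 0 []) i))"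
      by (auto simp: unitv_def apply_form_0[OF \<psi>(1)])
    have "(unitv (Col 0 []) :: _ \<Rightarrow> 'k mpoly) \<in> R" unfolding unit_eq by (rule apply_form_R[OF \<psi>(1) u])
    then have "\<Phi> (unitv (Col 0 [])) \<in> P" unfolding R_def by blast
    then have "(\<Sum>\<alpha>\<in>A. single \<alpha> 1 * unitv (Col 0 []) (Col \<alpha> [])) \<in> P" unfolding \<Phi>_def .
    moreover have "(\<Sum>\<alpha>\<in>A. single \<alpha> 1 * unitv (Col 0 []) (Col \<alpha> [])) = (\<Sum>\<alpha>\<in>A. if \<alpha> = 0 then 1 else (0::'k mpoly))"
      by (rule sum.cong) (auto simp: unitv_def)
    ultimately show False using prime_inD(5)[OF P] zeroA finA by simp
  qed
  have codim: "codim_le ((\<Sum>s=1..j. h ^ s) + phase_bound (j - 1) (h + 1)) (admissible RK a) (decomposable RK a)"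
  proof (rule codim_first_expansion[OF infinite_poly_fract finI satRK _ unit])
    show "Col 0 [] \<in> I" using zeroA by (simp add: I_def)
    show "a i < j" if "i \<in> I - {Col 0 []}" for i
      using that j by (auto simp: I_def a_def monom_degree_eq_0[symmetric] simp del: monom_degree_eq_0)
    fix s assume s: "1 \<le> s" "s \<le> j"
    have "{i \<in> I - {Col 0 []}. a i = j - s} \<subseteq> (\<lambda>\<alpha>. Col \<alpha> []) ` {m. keys m \<subseteq> X \<and> monom_degree m = s}"
      using s by (auto simp: I_def A_def a_def)
    moreover have fin: "finite {m. keys m \<subseteq> X \<and> monom_degree m = s}"
      by (rule finite_subset[OF _ finite_monomials[OF finX, of s]]) auto
    ultimately have "col_count (I - {Col 0 []}) a (j - s) \<le> card ((\<lambda>\<alpha>. Col \<alpha> []) ` {m. keys m \<subseteq> X \<and> monom_degree m = s} :: (nat \<Rightarrow>\<^sub>0 nat) col set)"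
      unfolding col_count_def by (intro card_mono) auto
    also have "\<dots> \<le> card {m. keys m \<subseteq> X \<and> monom_degree m = s}" by (rule card_image_le[OF fin])
    also have "\<dots> \<le> h ^ s" unfolding h_def X_def[symmetric] by (rule card_monomials_le[OF finX])
    finally show "col_count (I - {Col 0 []}) a (j - s) \<le> h ^ s" .
  qed
  have apply_form_T: "hcomp j (\<Phi> (\<lambda>i. apply_form \<psi> Y (w i))) \<in> max_ideal_times V P" if \<psi>: "lin_form \<psi>" and w: "w \<in> decomposable RK a" for \<psi> w
    using w
  proof induction
    case (base v)
    have "deg_less j (\<Phi> (\<lambda>i. apply_form \<psi> Y (v i)))"
      unfolding \<Phi>_def
    proof (rule deg_less_sum)
      fix \<alpha> assume \<alpha>: "\<alpha> \<in> A"
      have "deg_less (a (Col \<alpha> [])) (apply_form \<psi> Y (v (Col \<alpha> [])))"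
        using base by (intro deg_less_apply_form[OF \<psi>]) (auto simp: lower_def)
      then show "deg_less j (single \<alpha> 1 * apply_form \<psi> Y (v (Col \<alpha> [])))"
        using keys_mult[of "single \<alpha> 1" "apply_form \<psi> Y (v (Col \<alpha> []))"] \<alpha>
        by (fastforce simp: deg_less_def a_def A_def)
    qed
    then show ?case using max_ideal_times_0[OF P] by (simp add: hcomp_deg_less)
  next
    case (var v l)
    have "v \<in> RK" using var by (simp add: lower_def)
    then have vP: "\<Phi> (\<lambda>i. apply_form \<psi> Y (v i)) \<in> P" using apply_form_R[OF \<psi>] by (auto simp: R_def)
    show ?case
    proof (cases "l \<in> Y")
      case True
      obtain j' where j': "j = Suc j'" using j by (cases j) auto
      have "hcomp j (\<Phi> (\<lambda>i. apply_form \<psi> Y (Var l * v i))) = Var l * hcomp j' (\<Phi> (\<lambda>i. apply_form \<psi> Y (v i)))"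
        using True by (simp add: apply_form_Var[OF \<psi>] \<Phi>_mult j' hcomp_Var_mult)
      then show ?thesis using max_ideal_times_Var[OF P V _ hom[OF vP]] True Y(1) by auto
    next
      case False
      then show ?thesis using max_ideal_times_0[OF P] by (simp add: apply_form_Var[OF \<psi>] \<Phi>_def)
    qed
  next
    case (add v w)
    then show ?case using max_ideal_times_add[OF P] by (simp add: apply_form_add[OF \<psi>] \<Phi>_add hcomp_add)
  qed
  show ?thesis
    unfolding gens_le_def
  proof (intro allI impI)
    fix S :: "nat set" and f
    assume S: "finite S" "(\<Sum>s=1..j. h ^ s) + phase_bound (j - 1) (h + 1) < card S" "\<forall>x\<in>S. f x \<in> P \<and> homogeneous j (f x)"
    define w where "w x i = (if i \<in> I then lookup (split_vars X (f x)) (origin i) else 0)" for x i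
    have wY: "w x i \<in> vars_in Y" if "x \<in> S" for x i
      using split_vars_coeff_vars[of "f x" V X] that S(3) prime_inD(1)[OF P] vars_in_mono[of "V - X" Y]
      by (auto simp: w_def X_def)
    have supp: "\<mu> + m \<in> keys g" if "m \<in> keys (lookup (split_vars X g) \<mu>)" for \<mu> m and g :: "'k mpoly"
    proof -
      have "lookup (split_vars X g) \<mu> = (\<Sum>m\<in>keys g. if restrict_mono X m = \<mu> then single (restrict_mono (- X) m) (lookup g m) else 0)"
        unfolding split_vars_def monomial_sum_def lookup_sum by (rule sum.cong) (auto simp: lookup_single)
      then have "m \<in> (\<Union>m\<in>keys g. keys (if restrict_mono X m = \<mu> then single (restrict_mono (- X) m) (lookup g m) else 0))"
        using that keys_sum[of "\<lambda>m. if restrict_mono X m = \<mu> then single (restrict_mono (- X) m) (lookup g m) else 0" "keys g"] by (simp only:) blast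
      then obtain m' where "m' \<in> keys g" "m \<in> keys (if restrict_mono X m' = \<mu> then single (restrict_mono (- X) m') (lookup g m') else 0)"
        by blast
      then show ?thesis using restrict_mono_split[of X m'] by (auto split: if_splits)
    qed
    have wa: "homogeneous (j - monom_degree \<mu>) (lookup (split_vars X (f x)) \<mu>)" "lookup (split_vars X (f x)) \<mu> \<noteq> 0 \<Longrightarrow> monom_degree \<mu> \<le> j" if "x \<in> S" for x \<mu>
    proof -
      have *: "monom_degree \<mu> + monom_degree m = j" if "m \<in> keys (lookup (split_vars X (f x)) \<mu>)" for m
        using supp[OF that] S(3) \<open>x \<in> S\<close> by (auto simp: homogeneous_def simp flip: monom_degree_add)
      show "homogeneous (j - monom_degree \<mu>) (lookup (split_vars X (f x)) \<mu>)"
        using * by (fastforce simp: homogeneous_def)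
      assume "lookup (split_vars X (f x)) \<mu> \<noteq> 0"
      then obtain m where "m \<in> keys (lookup (split_vars X (f x)) \<mu>)" by (metis ex_in_conv keys_eq_empty)
      then show "monom_degree \<mu> \<le> j" using * by fastforce
    qed
    have w\<Phi>: "\<Phi> (w x) = f x" if "x \<in> S" for x
    proof -
      have fV: "f x \<in> vars_in V" using S(3) that prime_inD(1)[OF P] by blast
      have "f x = (\<Sum>\<mu>\<in>keys (split_vars X (f x)). single \<mu> 1 * lookup (split_vars X (f x)) \<mu>)"
        by (rule split_vars_reconstruct)
      also have "\<dots> = (\<Sum>\<mu>\<in>A. single \<mu> 1 * lookup (split_vars X (f x)) \<mu>)"
      proof (rule sum.mono_neutral_left[OF finA])
        show "keys (split_vars X (f x)) \<subseteq> A"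
        proof
          fix \<mu> assume "\<mu> \<in> keys (split_vars X (f x))"
          then show "\<mu> \<in> A" using split_vars_keys[OF fV] wa(2)[OF that] by (fastforce simp: A_def in_keys_iff)
        qed
      qed (auto simp: in_keys_iff)
      also have "\<dots> = \<Phi> (w x)" unfolding \<Phi>_def by (rule sum.cong) (auto simp: w_def I_def)
      finally show ?thesis by simp
    qed
    have wR: "w x \<in> R" if "x \<in> S" for x
      using that wY w\<Phi> S(3) by (intro RI) (auto simp: w_def)
    have "(\<lambda>i. extend_scalars (w x i)) \<in> admissible RK a" if "x \<in> S" for x
      using extend_scalars_R[OF wR[OF that]] wa(1)[OF that]
      by (auto simp: admissible_def w_def a_def intro!: deg_le_extend_scalars homogeneous_deg_le)
    then obtain lam where lam: "\<exists>x\<in>S. lam x \<noteq> 0" "(\<lambda>i. \<Sum>x\<in>S. Const (lam x) * extend_scalars (w x i)) \<in> decomposable RK a"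
      using codim_leD[OF codim S(1,2), of "\<lambda>x i. extend_scalars (w x i)"] by blast
    then obtain x0 where x0: "x0 \<in> S" "lam x0 \<noteq> 0" by blast
    obtain \<psi> :: "'k poly fract \<Rightarrow> 'k" where \<psi>: "lin_form \<psi>" "\<psi> (lam x0) = 1" by (rule ex_lin_form[OF x0(2)])
    have "\<Phi> (\<lambda>i. apply_form \<psi> Y (\<Sum>x\<in>S. Const (lam x) * extend_scalars (w x i))) = \<Phi> (\<lambda>i. \<Sum>x\<in>S. Const (\<psi> (lam x)) * w x i)"
      using wY by (simp add: apply_form_sum[OF \<psi>(1)] apply_form_Const_extend[OF \<psi>(1)])
    also have "\<dots> = (\<Sum>x\<in>S. Const (\<psi> (lam x)) * \<Phi> (w x))"
      unfolding \<Phi>_def sum_distrib_left by (subst sum.swap) (simp add: mult.left_commute)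
    also have "\<dots> = (\<Sum>x\<in>S. Const (\<psi> (lam x)) * f x)" using w\<Phi> by simp
    finally have "hcomp j (\<Sum>x\<in>S. Const (\<psi> (lam x)) * f x) \<in> max_ideal_times V P"
      using apply_form_T[OF \<psi>(1) lam(2)] by simp
    moreover have "homogeneous j (\<Sum>x\<in>S. Const (\<psi> (lam x)) * f x)"
      using S(3) by (intro homogeneous_sum homogeneous_Const_mult) auto
    ultimately have "(\<Sum>x\<in>S. Const (\<psi> (lam x)) * f x) \<in> max_ideal_times V P" by (simp add: hcomp_homogeneous)
    then show "\<exists>lam. (\<exists>x\<in>S. lam x \<noteq> 0) \<and> (\<Sum>x\<in>S. Const (lam x) * f x) \<in> max_ideal_times V P"
      using x0(1) \<psi>(2) by (intro exI[of _ "\<lambda>x. \<psi> (lam x)"] conjI bexI[of _ x0]) auto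
  qed
qed

section \<open>Unique factorization\<close>

text \<open>The polynomial \<open>f\<close> as a univariate polynomial in the variable \<open>x\<close>, for access to degrees and leading
coefficients.\<close>

definition univ_in :: "nat \<Rightarrow> 'k::field mpoly \<Rightarrow> 'k mpoly poly" where
  "univ_in x = monomial_sum (\<lambda>m c. Polynomial.monom (single (restrict_mono (- {x}) m) c) (lookup m x))"

lemma univ_in_0 [simp]: "univ_in x 0 = 0" by (simp add: univ_in_def)
lemma univ_in_add: "univ_in x (f + g) = univ_in x f + univ_in x g"
  unfolding univ_in_def by (rule monomial_sum_add) (auto simp: single_add add_monom)
lemma univ_in_mult: "univ_in x (f * g) = univ_in x f * univ_in x g"
  unfolding univ_in_def
  by (rule monomial_sum_mult) (auto simp: single_add mult_single add_monom mult_monom restrict_mono_add lookup_add)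
lemma univ_in_single: "univ_in x (single m c) = Polynomial.monom (single (restrict_mono (- {x}) m) c) (lookup m x)"
  unfolding univ_in_def by (rule monomial_sum_single) auto
lemma univ_in_minus: "univ_in x (f - g) = univ_in x f - univ_in x g"
  by (metis add_diff_cancel_right' diff_add_cancel univ_in_add)

lemma poly_univ_in: "poly (univ_in x f) (Var x) = f"
proof (induction f rule: poly_mapping_induct_single)
  case (single m c)
  have "restrict_mono (- {x}) m + single x (lookup m x) = m"
    by (rule poly_mapping_eqI) (auto simp: lookup_add lookup_restrict_mono lookup_single when_def)
  then show ?case by (simp add: univ_in_single poly_monom Var_power mult_single)
qed (auto simp: univ_in_add)

lemma univ_in_eq_0 [simp]: "univ_in x f = 0 \<longleftrightarrow> f = 0"
  using poly_univ_in[of x f] by auto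

lemma univ_in_free: "f \<in> vars_in V \<Longrightarrow> x \<notin> V \<Longrightarrow> univ_in x f = [:f:]"
proof -
  assume f: "f \<in> vars_in V" and x: "x \<notin> V"
  have "univ_in x f = [:f:]"
  proof (induction f rule: poly_mapping_induct_single)
    case (single m c)
    then have "keys m \<subseteq> - {x}" "x \<notin> keys m" using f x by (auto simp: vars_in_def)
    then show ?case by (simp add: univ_in_single restrict_mono_id in_keys_iff monom_0)
  qed (auto simp: univ_in_add)
  then show ?thesis .
qed

lemma univ_in_coeff_vars: "f \<in> vars_in V \<Longrightarrow> coeff (univ_in x f) i \<in> vars_in (V - {x})"
  unfolding univ_in_def monomial_sum_def coeff_sum
  by (rule vars_in_sum) (auto simp: coeff_monom vars_in_def keys_restrict_mono)

definition deg_in :: "nat \<Rightarrow> 'k::field mpoly \<Rightarrow> nat" where "deg_in x f = Polynomial.degree (univ_in x f)"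

lemma deg_in_mult: "f \<noteq> 0 \<Longrightarrow> g \<noteq> 0 \<Longrightarrow> deg_in x (f * g) = deg_in x f + deg_in x g"
  by (simp add: deg_in_def univ_in_mult degree_mult_eq)

lemma deg_in_0: "f \<in> vars_in V \<Longrightarrow> x \<notin> V \<Longrightarrow> deg_in x f = 0"
  by (simp add: deg_in_def univ_in_free)

lemma deg_in_0_vars:
  assumes "f \<in> vars_in V" "deg_in x f = 0"
  shows "f \<in> vars_in (V - {x})"
proof -
  obtain c where c: "univ_in x f = [:c:]" using assms(2) unfolding deg_in_def by (rule degree_eq_zeroE)
  then have "f = c" using poly_univ_in[of x f] by simp
  then show ?thesis using univ_in_coeff_vars[OF assms(1), of x 0] c by simp
qed

text \<open>Degrees in a single variable are additive, so a divisor cannot contain further variables.\<close>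

lemma dvd_vars:
  assumes "g dvd f" "f \<noteq> 0" "f \<in> vars_in V"
  shows "g \<in> vars_in V"
proof -
  obtain q where q: "f = g * q" using assms(1) by blast
  then have nz: "g \<noteq> 0" "q \<noteq> 0" using assms(2) by auto
  have "g \<in> vars_in (- {x})" if "x \<notin> V" for x
  proof -
    have "deg_in x g = 0" using deg_in_0[OF assms(3) that] deg_in_mult[OF nz, of x] q by simp
    then show ?thesis using deg_in_0_vars[of g UNIV x] by (simp add: Compl_eq_Diff_UNIV)
  qed
  then show ?thesis unfolding vars_in_def by blast
qed

lemma vars_in_empty: "f \<in> vars_in {} \<Longrightarrow> f = Const (lookup f 0)"
  by (rule homogeneous_0_Const) (auto simp: vars_in_def homogeneous_def)

text \<open>A measure that is additive on products and vanishes, among nonzero polynomials in \<open>V\<close>, on the constants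
only; inductions on factorizations use it.\<close>

definition var_degree_sum :: "nat set \<Rightarrow> 'k::field mpoly \<Rightarrow> nat" where "var_degree_sum V f = (\<Sum>x\<in>V. deg_in x f)"

lemma var_degree_sum_mult: "f \<noteq> 0 \<Longrightarrow> g \<noteq> 0 \<Longrightarrow> var_degree_sum V (f * g) = var_degree_sum V f + var_degree_sum V g"
  by (simp add: var_degree_sum_def deg_in_mult sum.distrib)

lemma var_degree_sum_pos:
  assumes "finite V" "f \<in> vars_in V" "f \<notin> vars_in {}"
  shows "0 < var_degree_sum V f"
proof (rule ccontr)
  assume "\<not> 0 < var_degree_sum V f"
  then have z: "deg_in x f = 0" if "x \<in> V" for x using that assms(1) by (simp add: var_degree_sum_def)
  have "f \<in> vars_in (V - {x})" if "x \<in> V" for x using deg_in_0_vars[OF assms(2) z[OF that]] .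
  then have "f \<in> vars_in {}" using assms(2) unfolding vars_in_def by blast
  then show False using assms(3) by simp
qed

lemma prime_elem_nonconst: "prime_elem (p :: 'k::field mpoly) \<Longrightarrow> p \<notin> vars_in {}"
proof
  assume p: "prime_elem p" "p \<in> vars_in {}"
  then obtain c where c: "p = Const c" using vars_in_empty by blast
  then have "c \<noteq> 0" using p by (auto simp: prime_elem_def)
  then have "1 = p * Const (1 / c)" using c by (simp flip: Const_mult)
  then have "p dvd 1" by (rule dvdI)
  then show False using p by (simp add: prime_elem_def)
qed

lemma lookup_single_0_mult: "lookup (single 0 a * F) \<mu> = a * lookup F \<mu>"
  for F :: "'a::comm_monoid_add \<Rightarrow>\<^sub>0 'b::comm_semiring_0"
proof (induction F rule: poly_mapping_induct_single)
  case (single m c) then show ?case by (simp add: mult_single lookup_single when_def)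
qed (auto simp: distrib_left lookup_add)

text \<open>A polynomial in \<open>W\<close> divides another polynomial if and only if it divides its coefficients with respect to the
variables outside of \<open>W\<close>.  So primality in \<open>k[W]\<close> passes to more variables by \<open>prime_coeffs\<close>.\<close>

lemma prime_elem_lift:
  fixes p :: "'k::field mpoly"
  assumes p: "p \<in> vars_in W" "p \<noteq> 0" "p \<notin> vars_in {}"
    and prm: "\<And>g h. g \<in> vars_in W \<Longrightarrow> h \<in> vars_in W \<Longrightarrow> p dvd g * h \<Longrightarrow> p dvd g \<or> p dvd h"
  shows "prime_elem p"
proof -
  have n1: "\<not> p dvd 1" using dvd_vars[of p 1 "{}"] p by auto
  define P where "P = {f \<in> vars_in W. p dvd f}"
  have P: "prime_in W P"
    unfolding prime_in_def P_def using n1 prm by (auto simp: vars_in_add vars_in_mult)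
  have cW: "lookup (split_vars (- W) f) \<mu> \<in> vars_in W" for f :: "'k mpoly" and \<mu>
    using split_vars_coeff_vars[of f UNIV "- W" \<mu>] by (simp add: Compl_eq_Diff_UNIV double_diff)
  have bk: "p dvd f" if "\<forall>\<mu>. lookup (split_vars (- W) f) \<mu> \<in> P" for f
    by (subst split_vars_reconstruct[of f "- W"]) (use that in \<open>auto intro!: dvd_sum simp: P_def\<close>)
  have "p dvd a \<or> p dvd b" if ab: "p dvd a * b" for a b
  proof -
    obtain q where q: "a * b = p * q" using ab by blast
    have "split_vars (- W) (a * b) = single 0 p * split_vars (- W) q"
      unfolding q split_vars_mult by (subst split_vars_free[OF p(1)]) auto
    then have "lookup (split_vars (- W) a * split_vars (- W) b) \<mu> \<in> P" for \<mu>
      using cW p(1) by (simp add: split_vars_mult lookup_single_0_mult P_def vars_in_mult)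
    then show ?thesis using prime_coeffs[OF P cW cW] bk by blast
  qed
  then show ?thesis using p n1 by (simp add: prime_elem_def)
qed

text \<open>Every nonconstant polynomial in \<open>V\<close> has a prime factor.  The second argument only fixes the coefficient
field.\<close>

definition has_primes :: "nat set \<Rightarrow> 'k::field itself \<Rightarrow> bool" where
  "has_primes V (_ :: 'k itself) \<longleftrightarrow> (\<forall>c\<in>vars_in V. c \<noteq> (0 :: 'k mpoly) \<longrightarrow> c \<notin> vars_in {} \<longrightarrow> (\<exists>p. prime_elem p \<and> p dvd c))"

text \<open>The prime factors of \<open>c\<close> can be cancelled one by one; none of them divides \<open>f\<close>, hence each divides \<open>q\<close>.\<close>

lemma cancel_factor:
  fixes f g c :: "'k::field mpoly"
  assumes V: "finite V" "has_primes V TYPE('k)" and c: "c \<in> vars_in V" "c \<noteq> 0" and eq: "c * g = q * f"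
    and f: "\<And>p. prime_elem p \<Longrightarrow> p \<in> vars_in V \<Longrightarrow> \<not> p dvd f"
  shows "f dvd g"
  using c eq
proof (induction "var_degree_sum V c" arbitrary: c q rule: less_induct)
  case less
  show ?case
  proof (cases "c \<in> vars_in {}")
    case True
    then obtain a where a: "c = Const a" using vars_in_empty by blast
    have "Const (1 / a) * (c * g) = g" using a less.prems(2) by (simp flip: Const_mult add: mult.assoc[symmetric])
    then have "g = f * (Const (1 / a) * q)" unfolding less.prems(3) by (simp add: mult_ac)
    then show ?thesis by (rule dvdI)
  next
    case False
    then obtain p where p: "prime_elem p" "p dvd c" using V(2) less.prems by (auto simp: has_primes_def)
    have pV: "p \<in> vars_in V" by (rule dvd_vars[OF p(2) less.prems(2,1)])
    obtain c' where c': "c = p * c'" using p(2) by blast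
    have nz: "p \<noteq> 0" "c' \<noteq> 0" using c' less.prems(2) by auto
    have "p dvd q * f" using less.prems(3) c' by (metis dvd_triv_left mult.assoc)
    then have "p dvd q" using prime_elem_dvd_multD[OF p(1)] f[OF p(1) pV] by blast
    then obtain q' where q': "q = p * q'" by blast
    have "p * (c' * g) = p * (q' * f)" using less.prems(3) c' q' by (simp add: mult.assoc)
    then have eq': "c' * g = q' * f" using nz by simp
    have c'V: "c' \<in> vars_in V" by (rule dvd_vars[of c' c]) (use c' less.prems in auto)
    have "var_degree_sum V c' < var_degree_sum V c"
      using var_degree_sum_mult[OF nz, of V] var_degree_sum_pos[OF V(1) pV prime_elem_nonconst[OF p(1)]] c' by simp
    then show ?thesis using less.hyps c'V nz(2) eq' by blast
  qed
qed

text \<open>The prime factors of \<open>c\<close> are distributed among \<open>q\<close> and \<open>e\<close>: this clears the denominators in a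
factorization of \<open>f\<close> over the field of fractions of \<open>k[V]\<close>, without changing \<open>e\<close> up to a factor from
\<open>k[V]\<close>.\<close>

lemma distribute_factor:
  fixes f q e c :: "'k::field mpoly"
  assumes V: "finite V" "has_primes V TYPE('k)" and c: "c \<in> vars_in V" "c \<noteq> 0" and eq: "c * f = q * e"
  shows "\<exists>q' e' c1. c1 \<in> vars_in V \<and> c1 \<noteq> 0 \<and> f = q' * e' \<and> e = c1 * e'"
  using c eq
proof (induction "var_degree_sum V c" arbitrary: c q e rule: less_induct)
  case less
  show ?case
  proof (cases "c \<in> vars_in {}")
    case True
    then obtain a where a: "c = Const a" using vars_in_empty by blast
    have "Const (1 / a) * (c * f) = f" using a less.prems(2) by (simp flip: Const_mult add: mult.assoc[symmetric])
    then have "f = (Const (1 / a) * q) * e" unfolding less.prems(3) by (simp add: mult_ac)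
    then show ?thesis by (intro exI[of _ "Const (1 / a) * q"] exI[of _ e] exI[of _ 1]) simp
  next
    case False
    then obtain p where p: "prime_elem p" "p dvd c" using V(2) less.prems by (auto simp: has_primes_def)
    have pV: "p \<in> vars_in V" by (rule dvd_vars[OF p(2) less.prems(2,1)])
    obtain c' where c': "c = p * c'" using p(2) by blast
    have nz: "p \<noteq> 0" "c' \<noteq> 0" using c' less.prems(2) by auto
    have c'V: "c' \<in> vars_in V" by (rule dvd_vars[of c' c]) (use c' less.prems in auto)
    have lt: "var_degree_sum V c' < var_degree_sum V c"
      using var_degree_sum_mult[OF nz, of V] var_degree_sum_pos[OF V(1) pV prime_elem_nonconst[OF p(1)]] c' by simp
    have "p dvd q * e" using less.prems(3) c' by (metis dvd_triv_left mult.assoc)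
    then have "p dvd q \<or> p dvd e" by (rule prime_elem_dvd_multD[OF p(1)])
    then show ?thesis
    proof
      assume "p dvd q"
      then obtain q' where q': "q = p * q'" by blast
      have "p * (c' * f) = p * (q' * e)" using less.prems(3) c' q' by (simp add: mult.assoc)
      then have "c' * f = q' * e" using nz by simp
      then show ?thesis using less.hyps[OF lt c'V nz(2)] by blast
    next
      assume "p dvd e"
      then obtain e1 where e1: "e = p * e1" by blast
      have "p * (c' * f) = p * (q * e1)" using less.prems(3) c' e1 by (simp add: mult_ac)
      then have "c' * f = q * e1" using nz by simp
      then obtain q' e' c1 where *: "c1 \<in> vars_in V" "c1 \<noteq> 0" "f = q' * e'" "e1 = c1 * e'"
        using less.hyps[OF lt c'V nz(2)] by blast
      then show ?thesis using e1 pV nz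
        by (intro exI[of _ q'] exI[of _ e'] exI[of _ "p * c1"]) (auto simp: vars_in_mult mult.assoc)
    qed
  qed
qed

text \<open>Division with remainder over the field of fractions of \<open>k[V]\<close>, with cleared denominators: an ideal is
generated there by its elements of minimal degree in \<open>x\<close>.  The leading term of \<open>a\<close> is removed repeatedly.\<close>

lemma pseudo_division:
  fixes J :: "'k::field mpoly set"
  assumes x: "x \<notin> V" and J: "J \<subseteq> vars_in (insert x V)"
    "\<And>a b c d. a \<in> J \<Longrightarrow> b \<in> J \<Longrightarrow> c \<in> vars_in (insert x V) \<Longrightarrow> d \<in> vars_in (insert x V) \<Longrightarrow> c * a - d * b \<in> J"
    and e: "e \<in> J" "e \<noteq> 0" "\<And>a. a \<in> J \<Longrightarrow> a \<noteq> 0 \<Longrightarrow> deg_in x e \<le> deg_in x a"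
    and "a \<in> J"
  shows "\<exists>c q. c \<in> vars_in V \<and> c \<noteq> 0 \<and> c * a = q * e"
  using assms(7)
proof (induction "if a = 0 then 0 else Suc (deg_in x a)" arbitrary: a rule: less_induct)
  case less
  show ?case
  proof (cases "a = 0")
    case True
    then show ?thesis by (intro exI[of _ 1] exI[of _ 0]) auto
  next
    case False
    have le: "deg_in x e \<le> deg_in x a" using e(3)[OF less.prems False] .
    define la where "la = lead_coeff (univ_in x a)"
    define le' where "le' = lead_coeff (univ_in x e)"
    define k where "k = deg_in x a - deg_in x e"
    have Vx: "insert x V - {x} = V" using x by auto
    have laV: "la \<in> vars_in V" "le' \<in> vars_in V"
      using univ_in_coeff_vars[of a "insert x V" x] univ_in_coeff_vars[of e "insert x V" x] J(1) less.prems e(1)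
      by (auto simp: la_def le'_def Vx)
    have le'nz: "le' \<noteq> 0" using e(2) by (simp add: le'_def)
    have sub: "vars_in V \<subseteq> vars_in (insert x V)" by (rule vars_in_mono) auto
    have xk: "(Var x :: 'k mpoly) ^ k \<in> vars_in (insert x V)"
      by (simp add: Var_power vars_in_single)
    \<comment> \<open>The leading terms cancel.\<close>
    define a' where "a' = le' * a - (la * Var x ^ k) * e"
    have a'J: "a' \<in> J" unfolding a'_def
      by (rule J(2)[OF less.prems e(1)]) (use laV sub xk in \<open>auto intro: vars_in_mult\<close>)
    have pa': "univ_in x a' = smult le' (univ_in x a) - smult la (Polynomial.monom 1 k * univ_in x e)"
    proof -
      have "univ_in x ((Var x :: 'k mpoly) ^ k) = Polynomial.monom 1 k"
        by (simp add: Var_power univ_in_single restrict_mono_0 keys_single)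
      then show ?thesis
        by (simp add: a'_def univ_in_minus univ_in_mult univ_in_free[OF laV(1) x] univ_in_free[OF laV(2) x] mult.assoc)
    qed
    have smaller: "deg_in x a' < deg_in x a" if "a' \<noteq> 0"
    proof -
      have "Polynomial.degree (smult la (Polynomial.monom 1 k * univ_in x e)) \<le> deg_in x a"
        using degree_mult_le[of "Polynomial.monom 1 k" "univ_in x e"] degree_monom_le[of "1 :: 'k mpoly" k] le
          degree_smult_le[of la "Polynomial.monom 1 k * univ_in x e"]
        unfolding k_def deg_in_def by linarith
      moreover have "Polynomial.degree (smult le' (univ_in x a)) \<le> deg_in x a"
        using degree_smult_le[of le' "univ_in x a"] by (simp add: deg_in_def)
      ultimately have d: "Polynomial.degree (univ_in x a') \<le> deg_in x a"
        unfolding pa' by (intro degree_diff_le)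
      have "coeff (univ_in x a') (deg_in x a) = le' * la - la * coeff (Polynomial.monom 1 k * univ_in x e) (k + deg_in x e)"
        using le unfolding pa' by (simp add: la_def k_def deg_in_def)
      also have "coeff (Polynomial.monom 1 k * univ_in x e) (k + deg_in x e) = le'"
        by (simp add: coeff_monom_mult le'_def deg_in_def)
      also have "le' * la - la * le' = 0" by (simp add: mult.commute)
      finally have "coeff (univ_in x a') (deg_in x a) = 0" .
      then have "Polynomial.degree (univ_in x a') \<noteq> deg_in x a"
        using that by (metis leading_coeff_0_iff univ_in_eq_0)
      then show ?thesis using d by (simp add: deg_in_def)
    qed
    have "(if a' = 0 then 0 else Suc (deg_in x a')) < (if a = 0 then 0 else Suc (deg_in x a))"
      using smaller False by auto
    then obtain c q where cq: "c \<in> vars_in V" "c \<noteq> 0" "c * a' = q * e"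
      using less.hyps[OF _ a'J] by blast
    have "(c * le') * a = (q + c * (la * Var x ^ k)) * e"
      using cq(3) by (simp add: a'_def algebra_simps)
    then show ?thesis using cq laV le'nz
      by (intro exI[of _ "c * le'"] exI[of _ "q + c * (la * Var x ^ k)"]) (auto simp: vars_in_mult)
  qed
qed

lemma ex_min_deg_in:
  assumes "a \<in> J" "a \<noteq> 0"
  obtains e where "e \<in> J" "e \<noteq> 0" "\<And>b. b \<in> J \<Longrightarrow> b \<noteq> 0 \<Longrightarrow> deg_in x e \<le> deg_in x b"
proof -
  have "\<exists>e. (e \<in> J \<and> e \<noteq> 0) \<and> (\<forall>b. b \<in> J \<and> b \<noteq> 0 \<longrightarrow> deg_in x e \<le> deg_in x b)"
    using assms by (intro ex_has_least_nat) auto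
  then show thesis using that by blast
qed

text \<open>
Gauss's lemma, by induction on the number of variables.  A nonconstant divisor \<open>f\<close> of \<open>c\<close> with minimal
degree sum is irreducible.  If it involves the new variable \<open>x\<close> and divides \<open>g * h\<close> but not \<open>g\<close>, let \<open>e\<close>
generate the ideal of \<open>f\<close> and \<open>g\<close> over the field of fractions.  By \<open>distribute_factor\<close> irreducibility makes
\<open>e\<close>, up to factors without \<open>x\<close>, either \<open>f\<close> or 1.  In the first case \<open>f\<close> divides \<open>g\<close>; in the second one
\<open>e h\<close> is a multiple of \<open>f\<close>, so that \<open>f\<close> divides \<open>h\<close> by \<open>cancel_factor\<close>.\<close>

lemma has_primes: "finite V \<Longrightarrow> has_primes V TYPE('k::field)"
proof (induction V rule: finite_induct)
  case empty then show ?case by (simp add: has_primes_def)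
next
  case (insert x V)
  note IH = insert.IH and fin = insert.hyps(1) and x = insert.hyps(2)
  let ?W = "insert x V"
  have sub: "vars_in V \<subseteq> vars_in ?W" by (rule vars_in_mono) auto
  show ?case
    unfolding has_primes_def
  proof (intro ballI impI)
    fix c :: "'k mpoly" assume c: "c \<in> vars_in ?W" "c \<noteq> 0" "c \<notin> vars_in {}"
    have "\<exists>f. (f dvd c \<and> f \<notin> vars_in {}) \<and> (\<forall>g. g dvd c \<and> g \<notin> vars_in {} \<longrightarrow> var_degree_sum ?W f \<le> var_degree_sum ?W g)"
      using c(3) by (intro ex_has_least_nat[where k = c]) auto
    then obtain f where f: "f dvd c" "f \<notin> vars_in {}"
      and min: "\<And>g. g dvd c \<Longrightarrow> g \<notin> vars_in {} \<Longrightarrow> var_degree_sum ?W f \<le> var_degree_sum ?W g" by blast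
    have f0: "f \<noteq> 0" using f(1) c(2) by auto
    have fW: "f \<in> vars_in ?W" by (rule dvd_vars[OF f(1) c(2,1)])
    have irr: "a \<in> vars_in {} \<or> b \<in> vars_in {}" if ab: "f = a * b" for a b
    proof (rule ccontr)
      assume neg: "\<not> ?thesis"
      have nz: "a \<noteq> 0" "b \<noteq> 0" using f0 ab by auto
      have "b \<in> vars_in ?W" by (rule dvd_vars[of b f]) (use ab f0 fW in auto)
      then have "0 < var_degree_sum ?W b" using neg fin by (intro var_degree_sum_pos) auto
      moreover have "var_degree_sum ?W f \<le> var_degree_sum ?W a" using ab f(1) neg by (intro min) (auto intro: dvd_mult_left)
      ultimately show False using var_degree_sum_mult[OF nz, of ?W] ab by simp
    qed
    show "\<exists>p. prime_elem p \<and> p dvd c"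
    proof (cases "f \<in> vars_in V")
      case True
      then show ?thesis using IH f f0 unfolding has_primes_def by (meson dvd_trans)
    next
      case fV: False
      have noprime: "\<not> p dvd f" if p: "prime_elem p" "p \<in> vars_in V" for p
      proof
        assume "p dvd f"
        then obtain b where b: "f = p * b" by blast
        then have "b \<in> vars_in {}" using irr prime_elem_nonconst[OF p(1)] by blast
        then have "b \<in> vars_in V" using vars_in_mono[of "{}" V] by auto
        then show False using fV b p(2) vars_in_mult by blast
      qed
      have L1: "f dvd g" if "c \<in> vars_in V" "c \<noteq> 0" "c * g = q * f" for c g q
        by (rule cancel_factor[OF fin IH that]) (rule noprime)
      have "prime_elem f"
      proof (rule prime_elem_lift[OF fW f0 f(2)])
        fix g h :: "'k mpoly" assume gh: "g \<in> vars_in ?W" "h \<in> vars_in ?W" "f dvd g * h"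
        show "f dvd g \<or> f dvd h"
        proof (cases "f dvd g")
          case ng: False
          define J where "J = {a * f + b * g | a b. a \<in> vars_in ?W \<and> b \<in> vars_in ?W}"
          have fJ: "f \<in> J" unfolding J_def by (intro CollectI exI[of _ 1] exI[of _ 0]) auto
          have gJ: "g \<in> J" unfolding J_def by (intro CollectI exI[of _ 0] exI[of _ 1]) auto
          have JW: "J \<subseteq> vars_in ?W" unfolding J_def using fW gh by (auto intro!: vars_in_add vars_in_mult)
          have Jc: "c * a - d * b \<in> J" if ab: "a \<in> J" "b \<in> J" and cd: "c \<in> vars_in ?W" "d \<in> vars_in ?W" for a b c d
          proof -
            obtain a1 a2 b1 b2 where *: "a = a1 * f + a2 * g" "b = b1 * f + b2 * g"
              "a1 \<in> vars_in ?W" "a2 \<in> vars_in ?W" "b1 \<in> vars_in ?W" "b2 \<in> vars_in ?W"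
              using ab by (auto simp: J_def)
            have "c * a - d * b = (c * a1 - d * b1) * f + (c * a2 - d * b2) * g" by (simp add: * algebra_simps)
            then show ?thesis unfolding J_def using * cd
              by (intro CollectI exI[of _ "c * a1 - d * b1"] exI[of _ "c * a2 - d * b2"]) (auto intro!: vars_in_diff vars_in_mult)
          qed
          obtain e where e: "e \<in> J" "e \<noteq> 0" "\<And>b. b \<in> J \<Longrightarrow> b \<noteq> 0 \<Longrightarrow> deg_in x e \<le> deg_in x b"
            using ex_min_deg_in[OF fJ f0] by blast
          have PD: "\<exists>c q. c \<in> vars_in V \<and> c \<noteq> 0 \<and> c * a = q * e" if "a \<in> J" for a
            by (rule pseudo_division[OF x JW _ e(1,2) _ that]) (fact Jc e(3))+
          obtain c1 q1 where 1: "c1 \<in> vars_in V" "c1 \<noteq> 0" "c1 * f = q1 * e" using PD[OF fJ] by blast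
          obtain c2 q2 where 2: "c2 \<in> vars_in V" "c2 \<noteq> 0" "c2 * g = q2 * e" using PD[OF gJ] by blast
          obtain q' e' c3 where 3: "c3 \<in> vars_in V" "c3 \<noteq> 0" "f = q' * e'" "e = c3 * e'"
            using distribute_factor[OF fin IH 1] by blast
          consider "q' \<in> vars_in {}" | "e' \<in> vars_in {}" using irr[OF 3(3)] by blast
          then show ?thesis
          proof cases
            case 1
            then obtain t where t: "q' = Const t" using vars_in_empty by blast
            then have t0: "t \<noteq> 0" using 3(3) f0 by auto
            have "Const (1 / t) * f = e'" using t t0 3(3) by (simp flip: Const_mult add: mult.assoc[symmetric])
            then have "c2 * g = (q2 * c3 * Const (1 / t)) * f" using 2(3) 3(4) by (simp add: mult.assoc)
            then have "f dvd g" by (rule L1[OF 2(1,2)])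
            then show ?thesis using ng by simp
          next
            case 2
            then have "e' \<in> vars_in V" using vars_in_mono[of "{}" V] by auto
            then have eV: "e \<in> vars_in V" using 3 by (simp add: vars_in_mult)
            obtain a b where ab: "e = a * f + b * g" using e(1) by (auto simp: J_def)
            obtain r where r: "g * h = f * r" using gh(3) by blast
            have "e * h = a * h * f + b * (g * h)" by (simp add: ab algebra_simps)
            also have "\<dots> = (a * h + b * r) * f" by (simp add: r algebra_simps)
            finally have "f dvd h" by (rule L1[OF eV e(2)])
            then show ?thesis by simp
          qed
        qed simp
      qed
      then show ?thesis using f(1) by blast
    qed
  qed
qed

text \<open>With only one variable \<open>x\<close> outside of \<open>Y\<close>, the prime ideal \<open>P\<close> generates a principal ideal over the field of
fractions of \<open>k[Y]\<close>.  A nonzero element of \<open>P\<close> of minimal degree sum has a prime factor in \<open>P\<close>, and this prime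
divides every element: the denominators lie in \<open>k[Y]\<close>, and multiples of the prime do not.\<close>

lemma prime_principal:
  fixes P :: "'k::field mpoly set"
  assumes V: "finite Y" "x \<notin> Y" and P: "prime_in (insert x Y) P"
    and PY: "\<And>f. f \<in> P \<Longrightarrow> f \<in> vars_in Y \<Longrightarrow> f = 0"
  obtains p where "p \<in> P" "\<And>g. g \<in> P \<Longrightarrow> p dvd g"
proof (cases "P = {0}")
  case True
  then show ?thesis using that[of 0] by auto
next
  case False
  let ?V = "insert x Y"
  obtain f1 where "f1 \<in> P" "f1 \<noteq> 0" using False prime_inD(2)[OF P] by auto
  then have "\<exists>f. (f \<in> P \<and> f \<noteq> 0) \<and> (\<forall>g. g \<in> P \<and> g \<noteq> 0 \<longrightarrow> var_degree_sum ?V f \<le> var_degree_sum ?V g)"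
    by (intro ex_has_least_nat) auto
  then obtain f where f: "f \<in> P" "f \<noteq> 0" and min: "\<And>g. g \<in> P \<Longrightarrow> g \<noteq> 0 \<Longrightarrow> var_degree_sum ?V f \<le> var_degree_sum ?V g" by blast
  have fV: "f \<in> vars_in ?V" using prime_inD(1)[OF P f(1)] .
  have "f \<notin> vars_in {}" using PY[OF f(1)] f(2) vars_in_mono[of "{}" Y] by auto
  then obtain p where p: "prime_elem p" "p dvd f"
    using has_primes[of ?V, where 'k = 'k] V fV f(2) by (auto simp: has_primes_def)
  obtain b where b: "f = p * b" using p(2) by blast
  have nz: "p \<noteq> 0" "b \<noteq> 0" using b f(2) by auto
  have pV: "p \<in> vars_in ?V" by (rule dvd_vars[OF p(2) f(2) fV])
  have bV: "b \<in> vars_in ?V" by (rule dvd_vars[of b f]) (use b f fV in auto)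
  have "b \<notin> P"
  proof
    assume "b \<in> P"
    then have "var_degree_sum ?V f \<le> var_degree_sum ?V b" using nz by (intro min)
    then show False
      using var_degree_sum_mult[OF nz, of ?V] var_degree_sum_pos[OF _ pV prime_elem_nonconst[OF p(1)]] V b by simp
  qed
  then have pP: "p \<in> P" using prime_inD(6)[OF P pV bV] f(1) b by auto
  obtain e where e: "e \<in> P" "e \<noteq> 0" "\<And>b. b \<in> P \<Longrightarrow> b \<noteq> 0 \<Longrightarrow> deg_in x e \<le> deg_in x b"
    using ex_min_deg_in[OF f] by blast
  have PV: "P \<subseteq> vars_in ?V" using prime_inD(1)[OF P] by auto
  have PD: "\<exists>c q. c \<in> vars_in Y \<and> c \<noteq> 0 \<and> c * a = q * e" if "a \<in> P" for a
    by (rule pseudo_division[OF V(2) PV _ e that]) (auto intro: prime_in_diff[OF P] prime_inD(4)[OF P])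
  obtain c q where 1: "c \<in> vars_in Y" "c \<noteq> 0" "c * p = q * e" using PD[OF pP] by blast
  have "\<not> p dvd q"
  proof
    assume "p dvd q"
    then obtain q' where "q = p * q'" by blast
    then have "p * c = p * (q' * e)" using 1(3) by (simp add: mult_ac)
    then have "c = q' * e" using nz by simp
    then have "e \<in> vars_in Y" using dvd_vars[of e c Y] 1 by simp
    then show False using PY e by blast
  qed
  moreover have "p dvd q * e" using 1(3) by (metis dvd_triv_right)
  ultimately have pe: "p dvd e" using prime_elem_dvd_multD[OF p(1)] by blast
  show ?thesis
  proof (rule that[OF pP])
    fix g assume g: "g \<in> P"
    obtain c q where 2: "c \<in> vars_in Y" "c \<noteq> 0" "c * g = q * e" using PD[OF g] by blast
    have "p dvd c * g" unfolding 2(3) using pe by simp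
    moreover have "\<not> p dvd c" using dvd_vars[of p c Y] 2 PY[OF pP] nz by auto
    ultimately show "p dvd g" using prime_elem_dvd_multD[OF p(1)] by blast
  qed
qed

lemma max_ideal_times_Const:
  assumes "prime_in V P" "f \<in> max_ideal_times V P"
  shows "Const c * f \<in> max_ideal_times V P"
proof -
  obtain g where "f = (\<Sum>l\<in>V. Var l * g l)" "\<forall>l\<in>V. g l \<in> P" using assms(2) by (auto simp: max_ideal_times_def)
  then show ?thesis unfolding max_ideal_times_def using prime_inD(4)[OF assms(1) _ vars_in_Const]
    by (intro CollectI exI[of _ "\<lambda>l. Const c * g l"]) (auto simp: sum_distrib_left mult.left_commute)
qed

lemma const_term_mod_max_ideal_times:
  assumes P: "prime_in V P" and V: "finite V" and q: "q \<in> vars_in V" and p: "p \<in> P"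
  shows "q * p - Const (lookup q 0) * p \<in> max_ideal_times V P"
proof (induction q rule: poly_mapping_induct_single)
  case zero then show ?case using max_ideal_times_0[OF P] by simp
next
  case (single m c)
  show ?case
  proof (cases "m = 0")
    case True
    then show ?thesis using max_ideal_times_0[OF P] by (simp add: Const_def)
  next
    case False
    then obtain l m' where l: "l \<in> keys m" and mm: "m = single l 1 + m'" by (rule monomial_factor)
    have mV: "keys m \<subseteq> V" using single q by (auto simp: vars_in_def)
    then have "single m' c \<in> vars_in V" by (simp add: vars_in_single mm keys_add_nat)
    then have "single m' c * p \<in> P" by (rule prime_inD(4)[OF P p])
    then have "Var l * (single m' c * p) \<in> max_ideal_times V P"
      using mV l by (intro max_ideal_times_Var[OF P V]) auto
    moreover have "single m c = Var l * single m' c"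
      by (simp add: mm Var_def mult_single)
    moreover have "lookup (single m c) 0 = 0" using False by (simp add: lookup_single)
    ultimately show ?thesis by (simp only: mult.assoc Const_0 mult_zero_left diff_zero)
  qed
next
  case (add q r)
  have "(q + r) * p - Const (lookup (q + r) 0) * p
    = (q * p - Const (lookup q 0) * p) + (r * p - Const (lookup r 0) * p)"
    by (simp add: lookup_add Const_add algebra_simps)
  then show ?case using max_ideal_times_add[OF P add] by simp
qed

text \<open>All elements of a principal ideal \<open>P = (p)\<close> are multiples of \<open>p\<close> by constants, up to elements of the product with the
ideal of the variables.\<close>

lemma gens_le_one:
  fixes P :: "'k::field mpoly set"
  assumes V: "finite Y" "x \<notin> Y" and P: "prime_in (insert x Y) P"
    and PY: "\<And>f. f \<in> P \<Longrightarrow> f \<in> vars_in Y \<Longrightarrow> f = 0"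
  shows "gens_le 1 (insert x Y) P j"
  unfolding gens_le_def
proof (intro allI impI)
  let ?V = "insert x Y"
  fix S :: "nat set" and f assume S: "finite S" "1 < card S" "\<forall>x\<in>S. f x \<in> P \<and> homogeneous j (f x)"
  obtain p where p: "p \<in> P" "\<And>g. g \<in> P \<Longrightarrow> p dvd g" using prime_principal[OF V P PY] by blast
  have "\<exists>c. f s - Const c * p \<in> max_ideal_times ?V P" if "s \<in> S" for s
  proof (cases "f s = 0")
    case True then show ?thesis using max_ideal_times_0[OF P] by (intro exI[of _ 0]) simp
  next
    case False
    have fs: "f s \<in> P" using S(3) that by blast
    then obtain q where q: "f s = p * q" using p(2) by blast
    have "q \<in> vars_in ?V" by (rule dvd_vars[of q "f s"]) (use q False prime_inD(1)[OF P fs] in auto)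
    then show ?thesis using const_term_mod_max_ideal_times[OF P _ _ p(1), of q] V q by (auto simp: mult.commute)
  qed
  then obtain c where c: "\<And>s. s \<in> S \<Longrightarrow> f s - Const (c s) * p \<in> max_ideal_times ?V P" by metis
  obtain s where s: "s \<in> S" using S(2) by fastforce
  have "S - {s} \<noteq> {}" using S s by (metis card_Diff_singleton card.empty less_numeral_extra(3) zero_less_diff)
  then obtain t where t: "t \<in> S" "t \<noteq> s" by blast
  show "\<exists>lam. (\<exists>x\<in>S. lam x \<noteq> 0) \<and> (\<Sum>x\<in>S. Const (lam x) * f x) \<in> max_ideal_times ?V P"
  proof (cases "c s = 0")
    case True
    have "(\<Sum>x\<in>S. Const (if x = s then 1 else 0) * f x) = (\<Sum>x\<in>S. if x = s then f s else 0)"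
      by (rule sum.cong) auto
    then show ?thesis using c[OF s] True s S(1) by (intro exI[of _ "\<lambda>x. if x = s then 1 else 0"]) auto
  next
    case False
    let ?lam = "\<lambda>x. if x = s then c t else if x = t then - c s else 0"
    have "(\<Sum>x\<in>S. Const (?lam x) * f x) = (\<Sum>x\<in>{s, t}. Const (?lam x) * f x)"
      by (rule sum.mono_neutral_right) (use s t S in auto)
    also have "\<dots> = Const (c t) * f s + Const (- c s) * f t" using t(2) by simp
    also have "\<dots> = Const (c t) * (f s - Const (c s) * p) + Const (- c s) * (f t - Const (c t) * p)"
      by (simp add: Const_uminus algebra_simps)
    also have "\<dots> \<in> max_ideal_times ?V P"
      by (intro max_ideal_times_add[OF P] max_ideal_times_Const[OF P] c s t)
    finally show ?thesis using False t by (intro exI[of _ ?lam]) auto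
  qed
qed

section \<open>Homogeneous ideals\<close>

lemma vars_in_hcomp: "f \<in> vars_in V \<Longrightarrow> hcomp u f \<in> vars_in V"
  by (auto simp: vars_in_def in_keys_iff lookup_hcomp split: if_splits)

text \<open>The polynomials all of whose components lie in \<open>I\<close> form an ideal, and it contains the homogeneous
generators of \<open>I\<close>.\<close>

lemma homogeneous_ideal_hcomp:
  fixes I :: "'k::field mpoly set"
  assumes "homogeneous_ideal n I" "f \<in> I"
  shows "hcomp u f \<in> I"
proof -
  interpret R: cring "mpoly_ring n :: 'k mpoly ring" by (rule cring_mpoly_ring)
  obtain G where I: "ideal I (mpoly_ring n)" and G: "G \<subseteq> vars_in {..<n}" "\<And>g. g \<in> G \<Longrightarrow> \<exists>d. homogeneous d g"
    and IG: "I = Idl\<^bsub>mpoly_ring n\<^esub> G"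
    using assms(1) by (auto simp: homogeneous_ideal_def)
  interpret I: ideal I "mpoly_ring n" by (rule I)
  have I0: "0 \<in> I" using additive_subgroup.zero_closed[OF I.is_additive_subgroup] by simp
  have Iadd: "a + b \<in> I" if "a \<in> I" "b \<in> I" for a b
    using additive_subgroup.a_closed[OF I.is_additive_subgroup that] by simp
  have Imult: "c * a \<in> I" if "c \<in> vars_in {..<n}" "a \<in> I" for a c
    using I.I_l_closed[OF that(2), of c] that(1) by simp
  have Isum: "sum h A \<in> I" if "\<And>x. x \<in> A \<Longrightarrow> h x \<in> I" for h :: "nat \<Rightarrow> 'k mpoly" and A
    using that by (induction A rule: infinite_finite_induct) (auto intro: I0 Iadd)
  define J where "J = {f \<in> vars_in {..<n}. \<forall>u. hcomp u f \<in> I}"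
  have "ideal J (mpoly_ring n)"
  proof (rule ideal_mpoly_ringI)
    fix c f :: "'k mpoly" assume c: "c \<in> vars_in {..<n}" and f: "f \<in> J"
    have "hcomp u (c * f) \<in> I" for u
    proof -
      have "hcomp u (c * f) = (\<Sum>i=0..u. hcomp i c * hcomp (u - i) f)"
        using arg_cong[OF graded_expansion_mult, of "\<lambda>F. fps_nth F u" c f] by (simp add: fps_mult_nth)
      also have "\<dots> \<in> I" using f c by (intro Isum Imult vars_in_hcomp) (auto simp: J_def)
      finally show ?thesis .
    qed
    then show "c * f \<in> J" using c f by (simp add: J_def vars_in_mult)
  qed (auto simp: J_def I0 Iadd vars_in_add hcomp_add)
  moreover have "G \<subseteq> J"
  proof
    fix g assume g: "g \<in> G"
    then have "g \<in> I" using R.genideal_self[of G] G(1) by (auto simp: IG)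
    moreover obtain d where "homogeneous d g" using G(2)[OF g] by blast
    ultimately show "g \<in> J" using g G(1) I0 by (auto simp: J_def hcomp_homogeneous)
  qed
  ultimately have "I \<subseteq> J" unfolding IG by (rule R.genideal_minimal)
  then show ?thesis using assms(2) by (auto simp: J_def)
qed

section \<open>The graded Betti number\<close>

lemma subfield_Const: "subfield (range Const) (mpoly_ring n :: 'k::field mpoly ring)"
proof -
  let ?R = "mpoly_ring n :: 'k mpoly ring"
  interpret cring ?R by (rule cring_mpoly_ring)
  have "subring (range Const) ?R"
  proof (rule subringI)
    show "\<ominus>\<^bsub>?R\<^esub> h \<in> range Const" if h: "h \<in> range Const" for h
    proof -
      obtain a where a: "h = Const a" using h by blast
      have "\<ominus>\<^bsub>?R\<^esub> h = Const (- a)" unfolding a by (subst mpoly_ring_a_inv) (simp_all add: Const_uminus)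
      then show ?thesis by blast
    qed
    show "\<one>\<^bsub>?R\<^esub> \<in> range Const" using rangeI[of Const 1] by simp
  qed (auto simp flip: Const_add Const_mult)
  then have "subcring (range Const) ?R" by (rule subcringI')
  moreover have "Units (?R \<lparr> carrier := range Const \<rparr>) = range Const - {\<zero>\<^bsub>?R\<^esub>}"
  proof -
    have "\<exists>b. Const b * Const a = 1 \<and> Const a * Const b = 1" if "a \<noteq> 0" for a :: 'k
      using that by (intro exI[of _ "1 / a"]) (simp flip: Const_mult)
    then show ?thesis unfolding Units_def by auto
  qed
  ultimately show ?thesis by (rule subfieldI)
qed

lemma irrelevant_ideal: "ideal (irrelevant_ideal n :: 'k::field mpoly set) (mpoly_ring n)"
proof -
  interpret cring "mpoly_ring n :: 'k mpoly ring" by (rule cring_mpoly_ring)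
  show ?thesis unfolding irrelevant_ideal_def by (rule genideal_ideal) (auto intro: vars_in_Var)
qed

lemma max_ideal_times_subset:
  fixes P :: "'k::field mpoly set"
  assumes P: "prime_in {..<n} P"
  shows "max_ideal_times {..<n} P \<subseteq> irrelevant_ideal n \<cdot>\<^bsub>mpoly_ring n\<^esub> P"
proof
  interpret cring "mpoly_ring n :: 'k mpoly ring" by (rule cring_mpoly_ring)
  let ?M = "irrelevant_ideal n \<cdot>\<^bsub>mpoly_ring n\<^esub> P"
  have "Var ` {..<n} \<subseteq> (irrelevant_ideal n :: 'k mpoly set)"
    unfolding irrelevant_ideal_def by (rule genideal_self) (auto intro: vars_in_Var)
  then have V: "(Var l :: 'k mpoly) \<in> irrelevant_ideal n" if "l < n" for l using that by auto
  have "\<zero>\<^bsub>mpoly_ring n\<^esub> \<otimes>\<^bsub>mpoly_ring n\<^esub> 0 \<in> ?M"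
    using additive_subgroup.zero_closed[OF ideal.axioms(1)[OF irrelevant_ideal]] prime_inD(2)[OF P]
    by (rule ideal_prod.prod)
  then have 0: "0 \<in> ?M" by simp
  fix f assume "f \<in> max_ideal_times {..<n} P"
  then obtain g where f: "f = (\<Sum>l<n. Var l * g l)" and g: "\<forall>l<n. g l \<in> P" by (auto simp: max_ideal_times_def)
  have "(\<Sum>l\<in>A. Var l * g l) \<in> ?M" if "finite A" "A \<subseteq> {..<n}" for A
    using that
  proof (induction A rule: finite_induct)
    case (insert l A)
    have "Var l \<otimes>\<^bsub>mpoly_ring n\<^esub> g l \<in> ?M" using insert.prems V g by (intro ideal_prod.prod) auto
    from ideal_prod.sum[OF this insert.IH] insert show ?case by simp
  qed (simp add: 0)
  then show "f \<in> ?M" unfolding f by simp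
qed

text \<open>The dimension in \<open>graded_betti0\<close> is the length of a basis, and its value is determined only once a basis
is known to exist.  Independent lists in the degree \<open>j\<close> part have length at
most \<open>c\<close>, since a relation modulo \<open>max_ideal_times\<close> is a relation between cosets; one of maximal
length is a basis.\<close>

lemma graded_betti0_le:
  fixes P :: "'k::field mpoly set"
  assumes pr: "primeideal P (mpoly_ring n)" and gens: "gens_le c {..<n} P j"
  shows "graded_betti0 n j P \<le> c"
proof -
  let ?R = "mpoly_ring n :: 'k mpoly ring"
  interpret R: cring ?R by (rule cring_mpoly_ring)
  have P: "prime_in {..<n} P" by (rule prime_in_primeideal[OF pr])
  have idP: "ideal P ?R" using pr by (simp add: primeideal_def)
  define M where "M = irrelevant_ideal n \<cdot>\<^bsub>?R\<^esub> P"
  have idM: "ideal M ?R" unfolding M_def by (rule R.ideal_prod_is_ideal[OF irrelevant_ideal idP])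
  have MP: "M \<subseteq> P" using R.ideal_prod_inter[OF irrelevant_ideal[of n] idP] by (auto simp: M_def)
  interpret M: ideal M ?R by (rule idM)
  let ?Q = "?R Quot M"
  interpret hom: ring_hom_ring ?R ?Q "(+>\<^bsub>?R\<^esub>) M" by (rule M.rcos_ring_hom_ring)
  let ?h = "\<lambda>f. M +>\<^bsub>?R\<^esub> f"
  have ker: "?h f = \<zero>\<^bsub>?Q\<^esub> \<longleftrightarrow> f \<in> M" if "f \<in> vars_in {..<n}" for f
  proof -
    have "?h f = M \<longleftrightarrow> f \<in> M"
      using R.a_coset_join1[of M f] R.a_coset_join2[of f M] that M.a_subgroup by auto
    then show ?thesis by (simp add: FactRing_def)
  qed
  define K where "K = range (\<lambda>c. ?h (Const c))"
  define E where "E = {?h f | f. f \<in> P \<and> homogeneous j f}"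
  have "1 \<notin> M" using MP prime_inD(5)[OF P] by auto
  then have one: "\<one>\<^bsub>?Q\<^esub> \<noteq> \<zero>\<^bsub>?Q\<^esub>"
    using ker[of 1] hom.hom_one by simp
  have KF: "subfield K ?Q"
    using hom.img_is_subfield(2)[OF subfield_Const one] by (simp add: K_def image_image)
  have PV: "f \<in> vars_in {..<n}" if "f \<in> P" for f using prime_inD(1)[OF P that] .
  have EQ: "E \<subseteq> carrier ?Q" unfolding E_def using PV hom.hom_closed by auto
  have E_smult: "k \<otimes>\<^bsub>?Q\<^esub> v \<in> E" if "k \<in> K" "v \<in> E" for k v
  proof -
    obtain a f where *: "k = ?h (Const a)" "v = ?h f" "f \<in> P" "homogeneous j f"
      using \<open>k \<in> K\<close> \<open>v \<in> E\<close> unfolding K_def E_def by blast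
    have "k \<otimes>\<^bsub>?Q\<^esub> v = ?h (Const a * f)" using hom.hom_mult[of "Const a" f] PV * by simp
    moreover have "Const a * f \<in> P" using * by (intro prime_inD(4)[OF P]) auto
    ultimately show ?thesis unfolding E_def
      using homogeneous_Const_mult[OF *(4)] by (intro CollectI exI[of _ "Const a * f"] conjI)
  qed
  have E_add: "v \<oplus>\<^bsub>?Q\<^esub> w \<in> E" if vw: "v \<in> E" "w \<in> E" for v w
  proof -
    obtain f g where *: "v = ?h f" "f \<in> P" "homogeneous j f" "w = ?h g" "g \<in> P" "homogeneous j g"
      using vw unfolding E_def by blast
    have "v \<oplus>\<^bsub>?Q\<^esub> w = ?h (f + g)" using hom.hom_add[of f g] PV * by simp
    then show ?thesis unfolding E_def
      using prime_inD(3)[OF P *(2,5)] homogeneous_add[OF *(3,6)] by (intro CollectI exI[of _ "f + g"] conjI)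
  qed
  have E_zero: "\<zero>\<^bsub>?Q\<^esub> \<in> E"
  proof -
    have "0 \<in> M" using M.zero_closed by simp
    then have "\<zero>\<^bsub>?Q\<^esub> = ?h 0" using ker[of 0] by simp
    then show ?thesis unfolding E_def using prime_inD(2)[OF P] by (intro CollectI exI[of _ 0] conjI) auto
  qed
  have Span_E: "hom.S.Span K Us \<subseteq> E" if "set Us \<subseteq> E" for Us
    using that
  proof (induction Us)
    case Nil then show ?case using E_zero by simp
  next
    case (Cons u Us)
    show ?case
    proof
      fix v assume "v \<in> hom.S.Span K (u # Us)"
      then obtain k v' where "k \<in> K" "v' \<in> hom.S.Span K Us" "v = k \<otimes>\<^bsub>?Q\<^esub> u \<oplus>\<^bsub>?Q\<^esub> v'"
        using hom.S.line_extension_mem_iff by auto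
      then show "v \<in> E" using Cons E_add E_smult by auto
    qed
  qed
  have comb: "hom.S.combine (map (\<lambda>i. ?h (Const (lam i))) xs) (map (\<lambda>i. ?h (f i)) xs) = ?h (\<Sum>i\<leftarrow>xs. Const (lam i) * f i)"
    if "\<And>i. i \<in> set xs \<Longrightarrow> f i \<in> vars_in {..<n}" for xs :: "nat list" and lam :: "nat \<Rightarrow> 'k" and f :: "nat \<Rightarrow> 'k mpoly"
    using that
  proof (induction xs)
    case Nil
    then show ?case using ker[of 0] M.zero_closed by simp
  next
    case (Cons i xs)
    have s: "(\<Sum>i\<leftarrow>xs. Const (lam i) * f i) \<in> vars_in {..<n}"
      using Cons.prems by (induction xs) (auto intro!: vars_in_add vars_in_mult)
    have fi: "f i \<in> vars_in {..<n}" using Cons.prems by simp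
    then have p: "Const (lam i) * f i \<in> vars_in {..<n}" by (intro vars_in_mult) auto
    show ?case
      using Cons hom.hom_mult[of "Const (lam i)" "f i"] hom.hom_add[of "Const (lam i) * f i" "(\<Sum>i\<leftarrow>xs. Const (lam i) * f i)"] fi p s
      by simp
  qed
  have indep_le: "length Us \<le> c" if Us: "set Us \<subseteq> E" "hom.S.independent K Us" for Us
  proof (rule ccontr)
    assume len: "\<not> length Us \<le> c"
    have "\<forall>i<length Us. \<exists>f. f \<in> P \<and> homogeneous j f \<and> Us ! i = ?h f"
      using Us(1) nth_mem by (fastforce simp: E_def)
    then obtain f where f: "\<And>i. i < length Us \<Longrightarrow> f i \<in> P \<and> homogeneous j (f i) \<and> Us ! i = ?h (f i)" by metis
    obtain lam where lam: "\<exists>x\<in>{..<length Us}. lam x \<noteq> 0" "(\<Sum>x<length Us. Const (lam x) * f x) \<in> max_ideal_times {..<n} P"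
      using gens[unfolded gens_le_def, rule_format, of "{..<length Us}" f] len f by auto
    let ?xs = "[0..<length Us]"
    have UsEq: "Us = map (\<lambda>i. ?h (f i)) ?xs" by (rule nth_equalityI) (use f in auto)
    have "(\<Sum>i\<leftarrow>?xs. Const (lam i) * f i) = (\<Sum>x<length Us. Const (lam x) * f x)"
      by (simp add: sum_list_distinct_conv_sum_set atLeast0LessThan)
    also have "\<dots> \<in> M" using lam(2) max_ideal_times_subset[OF P] by (auto simp: M_def)
    finally have inM: "(\<Sum>i\<leftarrow>?xs. Const (lam i) * f i) \<in> M" .
    let ?Ks = "map (\<lambda>i. ?h (Const (lam i))) ?xs"
    have "hom.S.combine ?Ks Us = ?h (\<Sum>i\<leftarrow>?xs. Const (lam i) * f i)"
      by (subst UsEq, rule comb) (use f PV in auto)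
    also have "\<dots> = \<zero>\<^bsub>?Q\<^esub>" using ker[of "\<Sum>i\<leftarrow>?xs. Const (lam i) * f i"] inM MP PV by blast
    finally have z: "hom.S.combine ?Ks Us = \<zero>\<^bsub>?Q\<^esub>" .
    have "set ?Ks \<subseteq> K" by (auto simp: K_def)
    note triv = hom.S.independent_imp_trivial_combine[OF KF Us(2) this z]
    have "?h (Const (lam i)) = \<zero>\<^bsub>?Q\<^esub>" if i: "i < length Us" for i
    proof -
      have "?h (Const (lam i)) \<in> set (take (length Us) ?Ks)" using i by simp
      then show ?thesis using triv by blast
    qed
    then have "Const (lam i) \<in> M" if "i < length Us" for i using ker[of "Const (lam i)"] that by simp
    moreover obtain i where i: "i < length Us" "lam i \<noteq> 0" using lam(1) by auto
    ultimately have "Const (1 / lam i) * Const (lam i) \<in> P"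
      using MP by (intro prime_inD(4)[OF P]) auto
    then show False using i prime_inD(5)[OF P] by (simp flip: Const_mult)
  qed
  define ok where "ok l \<longleftrightarrow> (\<exists>Us. set Us \<subseteq> E \<and> hom.S.independent K Us \<and> length Us = l)" for l
  have "ok 0" unfolding ok_def by (intro exI[of _ "[]"]) simp
  have ok_le: "l \<le> c" if ok: "ok l" for l
  proof -
    obtain Us where "set Us \<subseteq> E" "hom.S.independent K Us" "length Us = l"
      using ok unfolding ok_def by (elim exE conjE)
    then show ?thesis using indep_le by blast
  qed
  define l where "l = Greatest ok"
  have l: "ok l" "\<And>m. ok m \<Longrightarrow> m \<le> l"
    unfolding l_def using GreatestI_nat[of ok 0 c] Greatest_le_nat[of ok _ c] \<open>ok 0\<close> ok_le by simp_all
  obtain Us where Us: "set Us \<subseteq> E" "hom.S.independent K Us" "length Us = l"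
    using l(1) unfolding ok_def by (elim exE conjE)
  have "E \<subseteq> hom.S.Span K Us"
  proof (rule ccontr)
    assume "\<not> E \<subseteq> hom.S.Span K Us"
    then obtain u where u: "u \<in> E" "u \<notin> hom.S.Span K Us" by blast
    then have "hom.S.independent K (u # Us)" using EQ Us by (intro hom.S.independent.intros(2)) auto
    then have "ok (Suc l)" unfolding ok_def using u Us by (intro exI[of _ "u # Us"]) auto
    then show False using l(2)[of "Suc l"] by simp
  qed
  then have "hom.S.Span K Us = E" using Span_E[OF Us(1)] by blast
  then have "hom.S.dimension l K E" using hom.S.dimensionI[OF KF Us(2)] Us(3) by simp
  then have "hom.S.dim K E = l" using hom.S.dimI[OF KF] by (simp add: over_def)
  then have "graded_betti0 n j P = l"
    by (simp add: graded_betti0_def Tor0_def Let_def M_def K_def E_def)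
  then show ?thesis using ok_le[OF l(1)] by simp
qed

section \<open>The numerical bound\<close>

lemma phase_bound_le: "1 \<le> t \<Longrightarrow> phase_bound D t \<le> D * (2 * t) ^ (2 ^ D)"
proof (induction D arbitrary: t)
  case (Suc D)
  define x where "x = 2 * t"
  have x: "1 \<le> x" "1 + t \<le> x" using Suc.prems by (auto simp: x_def)
  have s: "t * (\<Sum>s\<le>e. x ^ s) \<le> x ^ Suc e" for e
  proof (induction e)
    case (Suc e)
    have "t * (\<Sum>s\<le>Suc e. x ^ s) \<le> x ^ Suc e + t * x ^ Suc e" using Suc by (simp add: distrib_left)
    also have "\<dots> = (1 + t) * x ^ Suc e" by simp
    also have "\<dots> \<le> x * x ^ Suc e" using x by (intro mult_right_mono) auto
    finally show ?case by simp
  qed (simp add: x_def)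
  have D: "D + 2 \<le> 2 ^ Suc D" by (induction D) auto
  have "t * (\<Sum>s\<le>D. t * x ^ s) = t * (t * (\<Sum>s\<le>D. x ^ s))" by (simp add: sum_distrib_left)
  also have "\<dots> \<le> x * x ^ Suc D" using s[of D] x by (intro mult_mono) auto
  also have "\<dots> = x ^ (D + 2)" by simp
  also have "\<dots> \<le> x ^ (2 ^ Suc D)" using D x by (intro power_increasing) auto
  finally have 1: "t * (\<Sum>s\<le>D. t * x ^ s) \<le> x ^ (2 ^ Suc D)" .
  have "phase_bound D (2 * t\<^sup>2) \<le> D * (2 * (2 * t\<^sup>2)) ^ (2 ^ D)" using Suc.prems by (intro Suc.IH) simp
  also have "2 * (2 * t\<^sup>2) = x ^ 2" by (simp add: x_def power2_eq_square)
  also have "(x ^ 2) ^ (2 ^ D) = x ^ (2 ^ Suc D)" by (simp flip: power_mult)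
  finally show ?case using 1 by (simp add: x_def)
qed simp

text \<open>For \<open>j \<ge> 3\<close> and \<open>M = 2 ^ (j - 3)\<close>, the two summands are at most \<open>h ^ (11 * M)\<close> and \<open>(j - 1) * h ^ (11 * M)\<close>,
while the exponent on the right is \<open>16 * M - 3\<close>.  The constant 11 comes from
\<open>(3 * h) ^ 4 = 81 * h ^ 4 \<le> h ^ 11\<close>.  The estimate is too coarse for \<open>j = 2\<close>, which is computed
exactly.\<close>

lemma codim_bound_le:
  assumes h: "2 \<le> (h::nat)" and j: "1 \<le> j"
  shows "(\<Sum>s=1..j. h ^ s) + phase_bound (j - 1) (h + 1) \<le> h ^ (2 ^ (j + 1) - 3)"
proof -
  consider "j = 1" | "j = 2" | i where "j = i + 3"
  proof -
    have "j = 1 \<or> j = 2 \<or> j = (j - 3) + 3" using j by linarith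
    then show ?thesis using that by blast
  qed
  then show ?thesis
  proof cases
    case 1 then show ?thesis by simp
  next
    case 2
    have "(\<Sum>s=1..2. h ^ s) = h + h ^ 2" by (simp add: numeral_2_eq_2)
    moreover have "phase_bound 1 (h + 1) = (h + 1) ^ 2" by (simp add: power2_eq_square)
    moreover have "h + h ^ 2 + (h + 1) ^ 2 \<le> h ^ 5"
    proof -
      have "2 * h \<le> h ^ 2" using h by (simp add: power2_eq_square)
      moreover have "h + h ^ 2 + (h + 1) ^ 2 = 2 * h ^ 2 + 3 * h + 1" by (simp add: power2_eq_square)
      ultimately have "h + h ^ 2 + (h + 1) ^ 2 \<le> 4 * h ^ 2" using h by linarith
      also have "\<dots> \<le> h ^ 3 * h ^ 2"
      proof (rule mult_right_mono)
        have "(2::nat) ^ 3 \<le> h ^ 3" using h by (intro power_mono) auto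
        then show "4 \<le> h ^ 3" by simp
      qed simp
      finally show ?thesis by (simp flip: power_add)
    qed
    ultimately show ?thesis using 2 by simp
  next
    case (3 i)
    define M where "M = (2::nat) ^ i"
    have M: "i + 1 \<le> M" unfolding M_def by (induction i) auto
    have h1: "1 \<le> h" using h by simp
    have "(\<Sum>s=1..j. h ^ s) \<le> (\<Sum>s\<le>j. h ^ s)" by (rule sum_mono2) auto
    also have "\<dots> \<le> (h + 1) ^ j" by (rule sum_power_le)
    also have "\<dots> \<le> (h ^ 2) ^ j"
    proof (rule power_mono)
      have "2 * h \<le> h ^ 2" using h by (simp add: power2_eq_square)
      then show "h + 1 \<le> h ^ 2" using h by linarith
    qed simp
    also have "\<dots> = h ^ (2 * j)" by (simp flip: power_mult)
    also have "\<dots> \<le> h ^ (11 * M)" using M h1 3 by (intro power_increasing) auto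
    finally have A: "(\<Sum>s=1..j. h ^ s) \<le> h ^ (11 * M)" .
    have "phase_bound (j - 1) (h + 1) \<le> (j - 1) * (2 * (h + 1)) ^ (2 ^ (j - 1))" by (rule phase_bound_le) simp
    also have "\<dots> \<le> (j - 1) * h ^ (11 * M)"
    proof (rule mult_left_mono)
      have "(2::nat) ^ (j - 1) = 4 * M" by (simp add: 3 M_def power_add)
      then have "(2 * (h + 1)) ^ (2 ^ (j - 1)) = ((2 * (h + 1)) ^ 4) ^ M" by (simp flip: power_mult)
      also have "\<dots> \<le> (h ^ 11) ^ M"
      proof (rule power_mono)
        have "(2 * (h + 1)) ^ 4 \<le> (3 * h) ^ 4" using h by (intro power_mono) auto
        also have "\<dots> = 81 * h ^ 4" by (simp add: power_mult_distrib)
        also have "\<dots> \<le> h ^ 7 * h ^ 4"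
        proof (rule mult_right_mono)
          have "(2::nat) ^ 7 \<le> h ^ 7" using h by (intro power_mono) auto
          then show "81 \<le> h ^ 7" by simp
        qed simp
        finally show "(2 * (h + 1)) ^ 4 \<le> h ^ 11" by (simp flip: power_add)
      qed simp
      finally show "(2 * (h + 1)) ^ (2 ^ (j - 1)) \<le> h ^ (11 * M)" by (simp add: power_mult)
    qed simp
    finally have "(\<Sum>s=1..j. h ^ s) + phase_bound (j - 1) (h + 1) \<le> h ^ (11 * M) + (j - 1) * h ^ (11 * M)"
      using A by simp
    also have "\<dots> = j * h ^ (11 * M)" using j by (cases j) auto
    also have "\<dots> \<le> h ^ (5 * M - 3) * h ^ (11 * M)"
    proof (rule mult_right_mono)
      have "i + 3 \<le> 2 ^ (M + 1)"
      proof -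
        have "M + 1 \<le> 2 ^ M" by (induction M) auto
        then show ?thesis using M by simp
      qed
      also have "\<dots> \<le> 2 ^ (5 * M - 3)" using M by (intro power_increasing) auto
      also have "\<dots> \<le> h ^ (5 * M - 3)" using h by (intro power_mono) auto
      finally show "j \<le> h ^ (5 * M - 3)" using 3 by simp
    qed simp
    also have "\<dots> = h ^ (2 ^ (j + 1) - 3)"
    proof -
      have "(2::nat) ^ (j + 1) = 16 * M" by (simp add: 3 M_def power_add)
      then show ?thesis using M by (simp flip: power_add)
    qed
    finally show ?thesis .
  qed
qed

section \<open>The bound on the Betti numbers of a prime ideal\<close>

lemma gens_le_zero:
  assumes P: "prime_in V P" and z: "\<And>f. f \<in> P \<Longrightarrow> homogeneous j f \<Longrightarrow> f = 0"
  shows "gens_le 0 V P j"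
  unfolding gens_le_def
proof (intro allI impI)
  fix S :: "nat set" and f assume S: "finite S" "0 < card S" "\<forall>x\<in>S. f x \<in> P \<and> homogeneous j (f x)"
  have "(\<Sum>x\<in>S. Const 1 * f x) = 0" using S(3) z by (intro sum.neutral) auto
  moreover have "S \<noteq> {}" using S(2) by auto
  ultimately show "\<exists>lam. (\<exists>x\<in>S. lam x \<noteq> 0) \<and> (\<Sum>x\<in>S. Const (lam x) * f x) \<in> max_ideal_times V P"
    using max_ideal_times_0[OF P] by (intro exI[of _ "\<lambda>_. 1"]) auto
qed

theorem theoremA:
  fixes P :: "'k::field mpoly set" and n h j :: nat
  assumes "primeideal P (mpoly_ring n)"
    and "homogeneous_ideal n P"
    and "prime_height (mpoly_ring n) P = enat h"
  shows "real (graded_betti0 n j P) \<le> real h powi (2 ^ (j + 1) - 3)"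
proof -
  have P: "prime_in {..<n} P" by (rule prime_in_primeideal[OF assms(1)])
  obtain Y where Y: "Y \<subseteq> {..<n}" "\<And>f. f \<in> P \<Longrightarrow> f \<in> vars_in Y \<Longrightarrow> f = 0" and cY: "card ({..<n} - Y) \<le> h"
    by (rule independent_variables[OF assms(1,3)]) blast
  define e where "e = card ({..<n} - Y)"
  have finY: "finite Y" using Y(1) finite_subset by blast
  have zero: "graded_betti0 n j P = 0" if "\<And>f. f \<in> P \<Longrightarrow> homogeneous j f \<Longrightarrow> f = 0"
    using graded_betti0_le[OF assms(1) gens_le_zero[OF P that]] by simp
  show ?thesis
  proof (cases "j = 0 \<or> e = 0")
    case True
    have "f = 0" if f: "f \<in> P" "homogeneous j f" for f
      using True
    proof
      assume "j = 0"
      then obtain a where "f = Const a" using f(2) homogeneous_0_Const by blast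
      then show ?thesis using Y(2)[OF f(1)] by simp
    next
      assume "e = 0"
      then have "Y = {..<n}" using Y(1) by (auto simp: e_def)
      then show ?thesis using Y(2) f(1) prime_inD(1)[OF P f(1)] by simp
    qed
    then show ?thesis using zero by simp
  next
    case False
    define N where "N = (2::nat) ^ (j + 1) - 3"
    have "(4::nat) \<le> 2 ^ (j + 1)" using False power_increasing[of 2 "j + 1" "2::nat"] by simp
    then have "(2::int) ^ (j + 1) - 3 = int N" by (simp add: N_def of_nat_diff)
    then have exp: "real h powi (2 ^ (j + 1) - 3) = real (h ^ N)" by simp
    have "graded_betti0 n j P \<le> e ^ N"
    proof (cases "e = 1")
      case True
      then obtain x where x: "{..<n} - Y = {x}" by (auto simp: e_def card_1_singleton_iff)
      then have V: "{..<n} = insert x Y" "x \<notin> Y" using Y(1) by auto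
      have "gens_le 1 {..<n} P j"
        using gens_le_one[OF finY V(2), of P j] P Y(2) by (simp add: V(1))
      then show ?thesis using graded_betti0_le[OF assms(1)] True by simp
    next
      case e1: False
      then have "2 \<le> e" "1 \<le> j" using False by auto
      then have "(\<Sum>s=1..j. e ^ s) + phase_bound (j - 1) (e + 1) \<le> e ^ N"
        unfolding N_def by (rule codim_bound_le)
      moreover have "graded_betti0 n j P \<le> (\<Sum>s=1..j. e ^ s) + phase_bound (j - 1) (e + 1)"
        unfolding e_def
        by (rule graded_betti0_le[OF assms(1) gens_le_general[OF P _ homogeneous_ideal_hcomp[OF assms(2)] Y]])
          (use \<open>1 \<le> j\<close> in auto)
      ultimately show ?thesis by simp
    qed
    also have "\<dots> \<le> h ^ N" using cY by (intro power_mono) (auto simp: e_def)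
    finally show ?thesis unfolding exp by (rule of_nat_mono)
  qed
qed

end
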